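(* Let $K$ be an imaginary quadratic number field, $n\ge 1$ an integer, $\mathfrak a_i$ a representative of an ideal class of $K$, and $L_i=\mathcal O_K^{n-1}\oplus\mathfrak a_i$. Then the Voronoi algorithm for $L_i$ (described in the context) terminates after finitely many steps, and its output list $\mathcal L_i$ is a complete list of all $\gamma_i$-perfect Hermitian forms up to equivalence: every member of $\mathcal L_i$ is $\gamma_i$-perfect, and every $\gamma_i$-perfect form is equivalent to a member of $\mathcal L_i$.
   Context: $K\subseteq\mathbb C$ is an imaginary quadratic field with ring of integers $\mathcal O_K$; $\mathfrak a_1,\dots,\mathfrak a_{h_K}$ are representatives of the ideal classes of $K$, chosen integral and of minimal norm in their classes; $L_i=\mathcal O_K^{n-1}\oplus\mathfrak a_i\subset K^n$ (row vectors). $\mathcal H_n$ is the real vector space of complex Hermitian $n\times n$ matrices with scalar product $(\mathcal A,\mathcal B)\mapsto\mathrm{Trace}(\mathcal A\mathcal B)$, and $\mathcal H_n^+$ is the cone of positive definite ones. $x^*$ denotes conjugate transpose, $\mathcal A[x]=x\mathcal A x^*$ for a row vector $x$, and $\mathcal A[U]=U\mathcal A U^*$ for a matrix $U$. For $x\in K^n\setminus\{0\}$ let $\mathfrak a_x=x_1\mathcal O_K+\dots+x_{n-1}\mathcal O_K+x_n\mathfrak a_i^{-1}$, a fractional ideal, and let $N$ be the ideal norm. For $\mathcal A\in\mathcal H_n^+$ put $\min_{L_i}(\mathcal A)=\min_{x\in L_i\setminus\{0\}}\mathcal A[x]/N(\mathfrak a_x)$. Let $v\sim w$ iff $v=\kappa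 w$ for some $\kappa\in K^*$ (the quotient $\mathcal A[x]/N(\mathfrak a_x)$ depends only on the class of $x$), and let $S_i(\mathcal A)=\{x\in L_i\setminus\{0\}: \mathcal A[x]/N(\mathfrak a_x)=\min_{L_i}(\mathcal A)\}/\sim$, a finite set. $\mathcal A\in\mathcal H_n^+$ is $\gamma_i$-perfect if the matrices $x^*x$, $x\in S_i(\mathcal A)$, span $\mathcal H_n$ over $\mathbb R$. Its Voronoi domain is $\mathcal V_i(\mathcal A)=\{\sum_{x\in S_i(\mathcal A)}\lambda_x x^*x:\lambda_x\ge 0\}$. $\mathrm{GL}(L_i)=\{U\in\mathrm{GL}_n(K): L_iU=L_i\}$. Two forms in $\mathcal H_n^+$ are equivalent if they have the same class in $\mathbb R_{>0}\backslash\mathcal H_n^+/\mathrm{GL}(L_i)$, i.e. one is $\alpha\mathcal A[U]$ of the other, $\alpha\in\mathbb R_{>0}$, $U\in\mathrm{GL}(L_i)$. Let $\mathcal A$ be $\gamma_i$-perfect and $\mathcal S$ a facet (codimension-one face) of $\mathcal V_i(\mathcal A)$. A facet vector of $\mathcal S$ is a nonzero $R\in\mathcal H_n$ with $\mathrm{Trace}(RS)=0$ for $S\in\mathcal S$ and $\mathrm{Trace}(RT)\ge0$ for $T\in\mathcal V_i(\mathcal A)$. The contiguous form to $\mathcal A$ through $\mathcal S$ is the $\gamma_i$-perfect form $\mathcal A+\rho R$, $\rho>0$, with $\min_{L_i}(\mathcal A+\rho R)=\min_{L_i}(\mathcal A)$ (it is unique when it exists). Voronoi algorithm (input $K,n,\mathfrak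 a_i$; output $\mathcal L_i$); determining minimal vectors, facets and contiguous forms and testing equivalence are regarded as single steps. (1) Fix the lattice $L_i$. (2) Find a first $\gamma_i$-perfect form: start with any $\mathcal A\in\mathcal H_n^+$. As long as $\mathcal A$ is not $\gamma_i$-perfect, choose a nonzero $R\in\mathcal H_n$ orthogonal to the span of $\mathcal V_i(\mathcal A)$, with sign chosen so that the largest $\rho>0$ such that $\mathcal A+tR$ is positive definite with $\min_{L_i}(\mathcal A+tR)=\min_{L_i}(\mathcal A)$ for all $0\le t\le\rho$ is finite, and replace $\mathcal A$ by $\mathcal A+\rho R$. Put the resulting $\gamma_i$-perfect form into $\mathcal L_i$ and into a second list $\mathcal T_i$. (3) While $\mathcal T_i\neq\emptyset$: take $T\in\mathcal T_i$, determine the contiguous forms to $T$ through all facets of $\mathcal V_i(T)$, and check each for equivalence with the forms in $\mathcal L_i$; each one not equivalent to a form currently in $\mathcal L_i$ is added to both $\mathcal L_i$ and $\mathcal T_i$, the others are ignored. Then remove $T$ from $\mathcal T_i$. *)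

theory Defs
  imports "HOL-Analysis.Analysis" "HOL-Computational_Algebra.Polynomial"
begin

section \<open>Imaginary quadratic fields and their ideals\<close>

definition complex_subfield :: "complex set \<Rightarrow> bool" where
  "complex_subfield K \<longleftrightarrow> 0 \<in> K \<and> 1 \<in> K
     \<and> (\<forall>x\<in>K. \<forall>y\<in>K. x + y \<in> K \<and> x * y \<in> K)
     \<and> (\<forall>x\<in>K. - x \<in> K \<and> inverse x \<in> K)"

definition imaginary_quadratic_field :: "complex set \<Rightarrow> bool" where
  "imaginary_quadratic_field K \<longleftrightarrow> complex_subfield K
     \<and> vector_space.dim (\<lambda>(q::rat) (z::complex). of_rat q * z) K = 2
     \<and> \<not> K \<subseteq> \<real>"

definition ring_of_integers :: "complex set \<Rightarrow> complex set" where
  "ring_of_integers K = {x \<in> K. algebraic_int x}"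

definition nonzero_ideal :: "complex set \<Rightarrow> complex set \<Rightarrow> bool" where
  "nonzero_ideal K I \<longleftrightarrow> I \<subseteq> ring_of_integers K \<and> 0 \<in> I \<and> I \<noteq> {0}
     \<and> (\<forall>x\<in>I. \<forall>y\<in>I. x + y \<in> I)
     \<and> (\<forall>r\<in>ring_of_integers K. \<forall>x\<in>I. r * x \<in> I)"

definition ideal_index :: "complex set \<Rightarrow> complex set \<Rightarrow> nat" where
  "ideal_index K I = card (ring_of_integers K //
     {(x, y). x \<in> ring_of_integers K \<and> y \<in> ring_of_integers K \<and> x - y \<in> I})"

text \<open>The absolute norm of a fractional ideal: clear denominators by a nonzero integer \<open>d\<close>
  and divide the index of \<open>d J\<close> by that of the principal ideal \<open>(d)\<close>. The quotient does not
  depend on \<open>d\<close>.\<close>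

definition ideal_norm :: "complex set \<Rightarrow> complex set \<Rightarrow> real" where
  "ideal_norm K J = (THE r. \<exists>d \<in> ring_of_integers K - {0}.
     (*) d ` J \<subseteq> ring_of_integers K \<and>
     r = real (ideal_index K ((*) d ` J)) / real (ideal_index K ((*) d ` ring_of_integers K)))"

definition ideal_inverse :: "complex set \<Rightarrow> complex set \<Rightarrow> complex set" where
  "ideal_inverse K I = {z \<in> K. (*) z ` I \<subseteq> ring_of_integers K}"

definition same_ideal_class :: "complex set \<Rightarrow> complex set \<Rightarrow> complex set \<Rightarrow> bool" where
  "same_ideal_class K I J \<longleftrightarrow> (\<exists>\<kappa>\<in>K - {0}. J = (*) \<kappa> ` I)"

definition minimal_class_representative :: "complex set \<Rightarrow> complex set \<Rightarrow> bool" where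
  "minimal_class_representative K I \<longleftrightarrow> nonzero_ideal K I
     \<and> (\<forall>J. nonzero_ideal K J \<and> same_ideal_class K I J \<longrightarrow> ideal_norm K I \<le> ideal_norm K J)"


section \<open>Hermitian forms\<close>

text \<open>Elements of \<^typ>\<open>complex^'n\<close> are row vectors; matrices act on them from the right
  through \<open>v*\<close>.\<close>

definition conj_transpose :: "complex^'n^'m \<Rightarrow> complex^'m^'n" where
  "conj_transpose A = (\<chi> i j. cnj (A $ j $ i))"

definition hermitian_matrices :: "(complex^'n^'n) set" where
  "hermitian_matrices = {A. conj_transpose A = A}"

text \<open>\<open>A[x] = x A x\<^sup>*\<close> and \<open>Trace (A B)\<close> are real for Hermitian \<open>A\<close>, \<open>B\<close>, so that taking
  real parts only changes the type.\<close>

definition form_value :: "complex^'n^'n \<Rightarrow> complex^'n \<Rightarrow> real" where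
  "form_value A x = Re (\<Sum>j\<in>UNIV. (x v* A) $ j * cnj (x $ j))"

definition trace_product :: "complex^'n^'n \<Rightarrow> complex^'n^'n \<Rightarrow> real" where
  "trace_product A B = Re (trace (A ** B))"

definition positive_forms :: "(complex^'n^'n) set" where
  "positive_forms = {A \<in> hermitian_matrices. \<forall>x. x \<noteq> 0 \<longrightarrow> 0 < form_value A x}"

definition rank_one :: "complex^'n \<Rightarrow> complex^'n^'n" where
  "rank_one x = (\<chi> i j. cnj (x $ i) * x $ j)"


section \<open>The lattice and its minimal vectors\<close>

text \<open>\<open>l\<close> is the coordinate that carries the ideal \<open>\<aa>\<close>, the last one in the usual numbering.\<close>

definition steinitz_lattice :: "complex set \<Rightarrow> complex set \<Rightarrow> 'n \<Rightarrow> (complex^'n) set" where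
  "steinitz_lattice K \<aa> l = {x. \<forall>j. x $ j \<in> (if j = l then \<aa> else ring_of_integers K)}"

definition vector_ideal :: "complex set \<Rightarrow> complex set \<Rightarrow> 'n \<Rightarrow> complex^'n \<Rightarrow> complex set" where
  "vector_ideal K \<aa> l x = {(\<Sum>j\<in>UNIV. x $ j * y j) | y.
     \<forall>j. y j \<in> (if j = l then ideal_inverse K \<aa> else ring_of_integers K)}"

definition normalized_value ::
    "complex set \<Rightarrow> complex set \<Rightarrow> 'n \<Rightarrow> complex^'n^'n \<Rightarrow> complex^'n \<Rightarrow> real" where
  "normalized_value K \<aa> l A x = form_value A x / ideal_norm K (vector_ideal K \<aa> l x)"

definition lattice_min :: "complex set \<Rightarrow> complex set \<Rightarrow> 'n \<Rightarrow> complex^'n^'n \<Rightarrow> real" where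
  "lattice_min K \<aa> l A =
     (LEAST m. \<exists>x \<in> steinitz_lattice K \<aa> l - {0}. m = normalized_value K \<aa> l A x)"

definition minimal_vectors ::
    "complex set \<Rightarrow> complex set \<Rightarrow> 'n \<Rightarrow> complex^'n^'n \<Rightarrow> (complex^'n) set" where
  "minimal_vectors K \<aa> l A =
     {x \<in> steinitz_lattice K \<aa> l - {0}. normalized_value K \<aa> l A x = lattice_min K \<aa> l A}"

definition minimal_classes ::
    "complex set \<Rightarrow> complex set \<Rightarrow> 'n \<Rightarrow> complex^'n^'n \<Rightarrow> (complex^'n) set set" where
  "minimal_classes K \<aa> l A = minimal_vectors K \<aa> l A //
     {(v, w). v \<in> minimal_vectors K \<aa> l A \<and> w \<in> minimal_vectors K \<aa> l A
        \<and> (\<exists>\<kappa>\<in>K - {0}. v = \<kappa> *s w)}"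

text \<open>The matrix \<open>x\<^sup>* x\<close> for an arbitrary representative \<open>x\<close> of a class. Another representative
  changes it by a positive real factor, which affects neither spans nor cones.\<close>

definition class_matrix :: "(complex^'n) set \<Rightarrow> complex^'n^'n" where
  "class_matrix c = rank_one (SOME x. x \<in> c)"

definition perfect_form :: "complex set \<Rightarrow> complex set \<Rightarrow> 'n \<Rightarrow> complex^'n^'n \<Rightarrow> bool" where
  "perfect_form K \<aa> l A \<longleftrightarrow> A \<in> positive_forms
     \<and> span (class_matrix ` minimal_classes K \<aa> l A) = hermitian_matrices"

definition voronoi_domain ::
    "complex set \<Rightarrow> complex set \<Rightarrow> 'n \<Rightarrow> complex^'n^'n \<Rightarrow> (complex^'n^'n) set" where
  "voronoi_domain K \<aa> l A =
     {(\<Sum>c\<in>minimal_classes K \<aa> l A. \<mu> c *\<^sub>R class_matrix c) | \<mu>.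
        \<forall>c\<in>minimal_classes K \<aa> l A. 0 \<le> (\<mu> c :: real)}"


section \<open>Equivalence and contiguity\<close>

definition lattice_automorphisms ::
    "complex set \<Rightarrow> complex set \<Rightarrow> 'n \<Rightarrow> (complex^'n^'n) set" where
  "lattice_automorphisms K \<aa> l = {U. (\<forall>i j. U $ i $ j \<in> K)
     \<and> (\<exists>V. (\<forall>i j. V $ i $ j \<in> K) \<and> U ** V = mat 1 \<and> V ** U = mat 1)
     \<and> (\<lambda>x. x v* U) ` steinitz_lattice K \<aa> l = steinitz_lattice K \<aa> l}"

definition equivalent_forms ::
    "complex set \<Rightarrow> complex set \<Rightarrow> 'n \<Rightarrow> complex^'n^'n \<Rightarrow> complex^'n^'n \<Rightarrow> bool" where
  "equivalent_forms K \<aa> l A B \<longleftrightarrow>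
     (\<exists>\<alpha>>0. \<exists>U\<in>lattice_automorphisms K \<aa> l. B = \<alpha> *\<^sub>R (U ** A ** conj_transpose U))"

definition facet_vector ::
    "complex set \<Rightarrow> complex set \<Rightarrow> 'n \<Rightarrow> complex^'n^'n \<Rightarrow> (complex^'n^'n) set
       \<Rightarrow> complex^'n^'n \<Rightarrow> bool" where
  "facet_vector K \<aa> l A F R \<longleftrightarrow> R \<in> hermitian_matrices \<and> R \<noteq> 0
     \<and> (\<forall>S\<in>F. trace_product R S = 0)
     \<and> (\<forall>T\<in>voronoi_domain K \<aa> l A. 0 \<le> trace_product R T)"

definition contiguous_through ::
    "complex set \<Rightarrow> complex set \<Rightarrow> 'n \<Rightarrow> complex^'n^'n \<Rightarrow> (complex^'n^'n) set
       \<Rightarrow> complex^'n^'n \<Rightarrow> bool" where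
  "contiguous_through K \<aa> l A F B \<longleftrightarrow> (\<exists>R. \<exists>\<rho>>0. facet_vector K \<aa> l A F R
     \<and> B = A + \<rho> *\<^sub>R R
     \<and> perfect_form K \<aa> l B \<and> lattice_min K \<aa> l B = lattice_min K \<aa> l A)"

text \<open>A facet need not have a contiguous form: in dimension one there is none.\<close>

definition contiguous_forms ::
    "complex set \<Rightarrow> complex set \<Rightarrow> 'n \<Rightarrow> complex^'n^'n \<Rightarrow> (complex^'n^'n) set" where
  "contiguous_forms K \<aa> l A =
     {B. \<exists>F. F facet_of voronoi_domain K \<aa> l A \<and> contiguous_through K \<aa> l A F B}"


section \<open>The Voronoi algorithm\<close>

text \<open>In the search for a first perfect form, \<open>A\<close> may be moved to \<open>A + \<rho> R\<close> when \<open>\<rho>\<close> is the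
  largest element of the following set.\<close>

definition admissible_lengths ::
    "complex set \<Rightarrow> complex set \<Rightarrow> 'n \<Rightarrow> complex^'n^'n \<Rightarrow> complex^'n^'n \<Rightarrow> real set" where
  "admissible_lengths K \<aa> l A R = {\<rho>. 0 < \<rho> \<and> (\<forall>t. 0 \<le> t \<and> t \<le> \<rho> \<longrightarrow>
     A + t *\<^sub>R R \<in> positive_forms \<and> lattice_min K \<aa> l (A + t *\<^sub>R R) = lattice_min K \<aa> l A)}"

text \<open>\<open>Search A\<close>: looking for a first perfect form, currently at \<open>A\<close>.
  \<open>Loop Ls Ts\<close>: at the head of the main loop.
  \<open>Check T Cs Ls Ts\<close>: in the loop body for \<open>T\<close>, with the contiguous forms \<open>Cs\<close> still to be tested.\<close>

datatype 'n voronoi_state =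
    Search "complex^'n^'n"
  | Loop "(complex^'n^'n) list" "(complex^'n^'n) list"
  | Check "complex^'n^'n" "(complex^'n^'n) list" "(complex^'n^'n) list" "(complex^'n^'n) list"

text \<open>All choices left open by the algorithm (the direction \<open>R\<close>, the form \<open>T\<close> and the order of its
  contiguous forms) are nondeterministic. The states \<open>Loop Ls []\<close> are the only ones in which
  the algorithm is meant to halt, with output \<open>Ls\<close>.\<close>

inductive voronoi_step ::
    "complex set \<Rightarrow> complex set \<Rightarrow> 'n::finite \<Rightarrow> 'n voronoi_state \<Rightarrow> 'n voronoi_state \<Rightarrow> bool"
  for K \<aa> l where
  improve: "\<lbrakk>\<not> perfect_form K \<aa> l A; R \<in> hermitian_matrices; R \<noteq> 0;
      \<forall>T\<in>span (voronoi_domain K \<aa> l A). trace_product R T = 0;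
      \<rho> \<in> admissible_lengths K \<aa> l A R; \<forall>\<sigma>\<in>admissible_lengths K \<aa> l A R. \<sigma> \<le> \<rho>\<rbrakk>
    \<Longrightarrow> voronoi_step K \<aa> l (Search A) (Search (A + \<rho> *\<^sub>R R))"
| found: "perfect_form K \<aa> l A \<Longrightarrow> voronoi_step K \<aa> l (Search A) (Loop [A] [A])"
| take: "\<lbrakk>T \<in> set Ts; distinct Cs; set Cs = contiguous_forms K \<aa> l T\<rbrakk>
    \<Longrightarrow> voronoi_step K \<aa> l (Loop Ls Ts) (Check T Cs Ls Ts)"
| ignore: "\<exists>A\<in>set Ls. equivalent_forms K \<aa> l A C
    \<Longrightarrow> voronoi_step K \<aa> l (Check T (C # Cs) Ls Ts) (Check T Cs Ls Ts)"
| add: "\<not> (\<exists>A\<in>set Ls. equivalent_forms K \<aa> l A C)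
    \<Longrightarrow> voronoi_step K \<aa> l (Check T (C # Cs) Ls Ts) (Check T Cs (Ls @ [C]) (Ts @ [C]))"
| finish: "voronoi_step K \<aa> l (Check T [] Ls Ts) (Loop Ls (remove1 T Ts))"

text \<open>The main theorem has to exclude halting in any other state, for instance by failing to find
  a direction \<open>R\<close> or by having infinitely many contiguous forms to list.\<close>

definition halts_at ::
    "complex set \<Rightarrow> complex set \<Rightarrow> 'n \<Rightarrow> complex^'n^'n \<Rightarrow> 'n voronoi_state \<Rightarrow> bool" where
  "halts_at K \<aa> l A s \<longleftrightarrow>
     (voronoi_step K \<aa> l)\<^sup>*\<^sup>* (Search A) s \<and> (\<nexists>s'. voronoi_step K \<aa> l s s')"

end

theory Submission
  imports Defs
begin

text \<open>
  A form is determined near its minimum by the discrete set of normalized rank one matrices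
  \<open>x\<^sup>* x / N(\<aa>\<^sub>x)\<close>, \<open>x \<in> L\<close>, on which it takes the values \<open>A[x] / N(\<aa>\<^sub>x)\<close>. Discreteness holds because
  every class of vectors has a representative with bounded \<open>N(\<aa>\<^sub>x)\<close>, and a Hermitian form bounded
  below by a positive constant on this set is positive definite, by simultaneous Diophantine
  approximation. So moving in a direction in which some value decreases always stops at a positive
  definite form with a new minimal vector. This gives the first perfect form (the span of the minimal
  vectors grows with every step) and the contiguous form through every facet whose facet vector is
  negative somewhere on the lattice.

  There are only finitely many perfect forms up to equivalence: if \<open>x\<^sub>1, \<dots>, x\<^sub>n\<close> are independent
  minimal vectors with bounded \<open>N(\<aa>\<^sub>x)\<close>, approximation again shows that the lattice lies between
  \<open>\<Oplus> \<O> x\<^sub>j\<close> and \<open>1/M \<Oplus> \<O> x\<^sub>j\<close> with \<open>M\<close> depending only on \<open>K\<close> and \<open>n\<close>, which leaves finitely many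
  orbits of tuples; and forms of minimum one bounded on a fixed basis stay in a compact set of
  positive definite forms. Hence the algorithm terminates. For completeness, let \<open>Q\<close> be the sum of
  the rank one matrices of the minimal vectors of a perfect form \<open>B\<close>. Descending along contiguous
  forms decreases the trace product with \<open>Q\<close> until \<open>Q\<close> lies in the Voronoi domain, and then the form
  reached is \<open>B\<close>.
\<close>


section \<open>Integers of an imaginary quadratic field\<close>

text \<open>Dirichlet approximation takes the place of Minkowski's theorem and of reduction theory.
  In the class bound and in the bound on denominators, a multiple by some q <= Q, with Q independent
  of the data, lies near an integral point; the difference belongs to the ideal or lattice in
  question and is too small to be nonzero, and \<open>fact Q\<close> absorbs all possible q. The
  obstacle in every limit process is that positive definiteness is an open condition. Requiring all
  normalized values to be at least a constant m > 0 is closed and implies it, so suprema and compact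
  sets of forms stay inside the cone. Completeness does not go through a tessellation of the cone by
  Voronoi domains. Only finitely many perfect forms of minimum one lie in a bounded set, so Tr(A Q)
  attains its least value on the orbits of the listed forms, and a single descent step gives the
  contradiction. The facets met there have a facet vector R with Tr(R Q) < 0, hence negative at some
  lattice vector; an arbitrary facet may have no contiguous form.\<close>

lemma complex_Rats_Reals: "(q::complex) \<in> \<rat> \<Longrightarrow> q \<in> \<real>"
  by (auto elim!: Rats_cases' simp: complex_is_Real_iff)

text \<open>Gauss's lemma: contents multiply, so a b = content G * content H, while each content
  divides the corresponding leading coefficient. Hence a and content G differ by a unit.\<close>

lemma lead_coeff_dvd_coeff_if_monic_product:
  fixes P G H :: "int poly"
  assumes "lead_coeff P = 1" "smult (a * b) P = G * H" "a > 0" "b > 0"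
    and "a = lead_coeff G" "b = lead_coeff H"
  shows "a dvd coeff G i"
proof -
  have "P \<noteq> 0" using assms(1) by auto
  have cP: "content P = 1"
    by (metis assms(1) content_dvd_coeff content_1 content_primitive_part is_unit_content_iff)
  have ab: "a * b = content G * content H"
    using arg_cong[OF assms(2), of content] assms(3,4) cP by (simp add: content_mult)
  have "content G dvd a" "content H dvd b" using assms(5,6) by auto
  then obtain u v where uv: "a = content G * u" "b = content H * v" by (auto elim!: dvdE)
  have "content G * content H \<noteq> 0" using ab assms(3,4) by auto
  then have "u * v = 1" using ab uv by (auto simp: algebra_simps)
  then have "a dvd content G"
    using uv(1) by (metis dvd_mult_unit_iff dvd_refl dvd_triv_left dvd_triv_right mult_unit_dvd_iff)
  then show ?thesis using content_dvd_coeff dvd_trans by blast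
qed

lemma rational_poly_denominator:
  fixes P :: "complex poly"
  assumes "\<And>i. coeff P i \<in> \<rat>"
  obtains b Q where "(b::int) > 0" "smult (of_int b) P = map_poly of_int Q"
proof -
  have "\<forall>i. \<exists>d a. (d::int) > 0 \<and> coeff P i = of_int a / of_int d"
    using Rats_cases'[OF assms] by metis
  then obtain d a where d: "\<And>i. (d i :: int) > 0" "\<And>i. coeff P i = of_int (a i) / of_int (d i)"
    by metis
  define b where "b = (\<Prod>i\<le>degree P. d i)"
  have b: "b > 0" using d by (simp add: b_def prod_pos)
  have "of_int b * coeff P i \<in> \<int>" for i
  proof (cases "i \<le> degree P")
    case True
    then have "d i dvd b" unfolding b_def by (intro dvd_prodI) auto
    then obtain c where "b = d i * c" by blast
    then have "of_int b * coeff P i = of_int (c * a i)" using d(1)[of i] by (simp add: d(2))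
    then show ?thesis by (metis Ints_of_int)
  qed (simp add: coeff_eq_0)
  then have "\<forall>i. \<exists>k. of_int k = of_int b * coeff P i" by (metis Ints_cases)
  then obtain k where k: "\<And>i. of_int (k i) = of_int b * coeff P i" by metis
  define Q where "Q = Poly (map k [0..<Suc (degree P)])"
  have "smult (of_int b) P = map_poly of_int Q"
  proof (rule poly_eqI)
    fix i
    show "coeff (smult (of_int b) P) i = coeff (map_poly of_int Q) i"
      using k[of i] by (auto simp: Q_def coeff_map_poly nth_default_def coeff_eq_0 simp del: upt_Suc)
  qed
  then show thesis using that b by blast
qed

text \<open>Division with remainder by a monic quadratic, carried out inside
  \<open>complex poly\<close> one coefficient at a time so that rationality of quotient and
  remainder can be read off.\<close>

lemma rational_quadratic_division:
  fixes P :: "complex poly" and t n :: complex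
  assumes "\<And>i. coeff P i \<in> \<rat>" "t \<in> \<rat>" "n \<in> \<rat>"
  shows "\<exists>Q r s. (\<forall>i. coeff Q i \<in> \<rat>) \<and> r \<in> \<rat> \<and> s \<in> \<rat> \<and> P = [:n, -t, 1:] * Q + [:r, s:]"
  using assms(1)
proof (induction P)
  case 0
  then show ?case by (intro exI[of _ 0]) auto
next
  case (pCons a P)
  have "coeff P i \<in> \<rat>" for i using pCons.prems[of "Suc i"] by simp
  then obtain Q r s where *: "\<forall>i. coeff Q i \<in> \<rat>" "r \<in> \<rat>" "s \<in> \<rat>" "P = [:n, -t, 1:] * Q + [:r, s:]"
    using pCons.IH by blast
  have a: "a \<in> \<rat>" using pCons.prems[of 0] by simp
  have "pCons a P = [:n, -t, 1:] * pCons s Q + [:a - s * n, r + s * t:]"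
    by (simp add: *(4) algebra_simps)
  moreover have "\<forall>i. coeff (pCons s Q) i \<in> \<rat>" using * by (auto simp: coeff_pCons split: nat.split)
  moreover have "a - s * n \<in> \<rat>" "r + s * t \<in> \<rat>" using a * assms by auto
  ultimately show ?case by blast
qed

text \<open>The remainder of P modulo X^2 - t X + n is linear with rational coefficients and
  vanishes at the nonreal x, so it is zero. By Gauss's lemma a monic rational factor of a monic
  integral polynomial is integral.\<close>

lemma nonreal_quadratic_algebraic_int:
  fixes x :: complex
  assumes "algebraic_int x" "x \<notin> \<real>" "x + cnj x \<in> \<rat>" "x * cnj x \<in> \<rat>"
  shows "x + cnj x \<in> \<int> \<and> x * cnj x \<in> \<int>"
proof -
  define t n where "t = x + cnj x" and "n = x * cnj x"
  obtain p where p: "poly (map_poly of_int p) x = 0" "lead_coeff p = 1"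
    using assms(1) by (auto simp: algebraic_int_altdef_ipoly)
  define P :: "complex poly" where "P = map_poly of_int p"
  have "coeff P i \<in> \<rat>" for i by (simp add: P_def coeff_map_poly)
  then obtain Q r s where Q: "\<forall>i. coeff Q i \<in> \<rat>" "r \<in> \<rat>" "s \<in> \<rat>" "P = [:n, -t, 1:] * Q + [:r, s:]"
    using rational_quadratic_division[of P t n] assms(3,4) unfolding t_def n_def by blast
  have root: "poly [:n, -t, 1:] x = 0" by (simp add: t_def n_def algebra_simps)
  have P0: "poly P x = 0" using p P_def by simp
  then have rs: "r + s * x = 0"
    using root unfolding Q(4) by (simp only: poly_add poly_mult) (simp add: mult.commute)
  have s0: "s = 0"
  proof (rule ccontr)
    assume "s \<noteq> 0"
    then have "x = - r / s" using rs by (simp add: field_simps eq_neg_iff_add_eq_0)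
    moreover have "r \<in> \<real>" "s \<in> \<real>" using Q complex_Rats_Reals by auto
    ultimately show False using assms(2) by auto
  qed
  then have r0: "r = 0" using rs by simp
  have PQ: "P = [:n, -t, 1:] * Q" using Q(4) s0 r0 by simp
  have lP: "lead_coeff P = 1" using p by (simp add: P_def coeff_map_poly degree_map_poly)
  then have lQ: "lead_coeff Q = 1" unfolding PQ lead_coeff_mult by simp
  have "coeff [:n, -t, 1:] i \<in> \<rat>" for i
    using assms(3,4) Rats_diff[OF Rats_diff[OF Rats_0 assms(3)] Rats_0]
    by (auto simp: coeff_pCons t_def n_def split: nat.split)
  from rational_poly_denominator[OF this] obtain a G
    where G: "(a::int) > 0" "smult (of_int a) [:n, -t, 1:] = map_poly of_int G" by metis
  from rational_poly_denominator[of Q] Q(1) obtain b H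
    where H: "(b::int) > 0" "smult (of_int b) Q = map_poly of_int H" by metis
  have hom: "map_poly of_int (A * B) = (map_poly of_int A * map_poly of_int B :: complex poly)" for A B
    by (rule poly_eqI) (simp add: coeff_map_poly coeff_mult)
  have "map_poly of_int (smult (a * b) p) = (smult (of_int (a * b)) P)"
    by (rule poly_eqI) (simp add: coeff_map_poly P_def)
  also have "\<dots> = smult (of_int a) [:n, -t, 1:] * smult (of_int b) Q"
    using PQ by (simp only: mult_smult_left mult_smult_right smult_smult of_int_mult mult.commute)
  also have "\<dots> = map_poly of_int (G * H)" using G H hom by simp
  finally have "(map_poly of_int (smult (a * b) p) :: complex poly) = map_poly of_int (G * H)" .
  then have eq: "smult (a * b) p = G * H" by (simp add: poly_eq_iff coeff_map_poly del: coeff_smult)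
  have cG: "of_int (coeff G i) = of_int a * coeff [:n, -t, 1:] i" for i
    using arg_cong[OF G(2), of "\<lambda>p. coeff p i"] by (simp only: coeff_map_poly of_int_0 coeff_smult)
  have degG: "degree G = 2" using arg_cong[OF G(2), of degree] G(1) by (simp add: degree_map_poly)
  have "(of_int (lead_coeff G) :: complex) = of_int a" using cG[of 2] degG by (simp add: numeral_2_eq_2)
  then have lG: "a = lead_coeff G" by simp
  have "degree H = degree Q" using arg_cong[OF H(2), of degree] H(1) by (simp add: degree_map_poly)
  then have "(of_int (lead_coeff H) :: complex) = of_int b"
    using arg_cong[OF H(2), of "\<lambda>p. coeff p (degree Q)"] lQ by (simp add: coeff_map_poly)
  then have lH: "b = lead_coeff H" by simp
  have dv: "a dvd coeff G i" for i using lead_coeff_dvd_coeff_if_monic_product[OF p(2) eq G(1) H(1) lG lH] .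
  have int: "coeff [:n, -t, 1:] i \<in> \<int>" for i
  proof -
    obtain c where "coeff G i = a * c" using dv by blast
    then have "of_int a * coeff [:n, -t, 1:] i = of_int a * of_int c" using cG[of i] by (simp only: of_int_mult)
    then have "coeff [:n, -t, 1:] i = of_int c" using G(1) by (simp del: coeff_pCons)
    then show ?thesis by (metis Ints_of_int)
  qed
  have "n \<in> \<int>" using int[of 0] by simp
  moreover have "t \<in> \<int>" using int[of 1] by simp
  ultimately show ?thesis by (simp add: t_def n_def)
qed

lemma algebraic_int_if_integral_trace_norm:
  fixes x :: complex
  assumes "x + cnj x \<in> \<int>" "x * cnj x \<in> \<int>"
  shows "algebraic_int x"
proof (rule algebraic_int.intros)
  let ?p = "[:x * cnj x, - (x + cnj x), 1:]"
  show "lead_coeff ?p = 1" by simp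
  show "\<forall>i. coeff ?p i \<in> \<int>"
    using assms Ints_minus[OF assms(1)] by (auto simp: coeff_pCons split: nat.split)
  show "poly ?p x = 0" by (simp add: algebra_simps)
qed

section \<open>Trace, norm and an integral basis of an imaginary quadratic field\<close>

locale imaginary_quadratic =
  fixes K :: "complex set"
  assumes iq: "imaginary_quadratic_field K"
begin

abbreviation "OK \<equiv> ring_of_integers K"

lemma K_0: "0 \<in> K" and K_1: "1 \<in> K"
  and K_add: "x \<in> K \<Longrightarrow> y \<in> K \<Longrightarrow> x + y \<in> K"
  and K_mult: "x \<in> K \<Longrightarrow> y \<in> K \<Longrightarrow> x * y \<in> K"
  and K_minus: "x \<in> K \<Longrightarrow> - x \<in> K"
  and K_inverse: "x \<in> K \<Longrightarrow> inverse x \<in> K"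
  using iq by (auto simp: imaginary_quadratic_field_def complex_subfield_def)

lemma K_diff: "x \<in> K \<Longrightarrow> y \<in> K \<Longrightarrow> x - y \<in> K" using K_add[of x "-y"] K_minus by simp

lemma K_divide: "x \<in> K \<Longrightarrow> y \<in> K \<Longrightarrow> x / y \<in> K"
  using K_mult[of x "inverse y"] K_inverse by (simp add: divide_inverse)

lemma K_of_nat: "of_nat n \<in> K" by (induction n) (auto intro: K_0 K_1 K_add)

lemma K_of_int: "of_int n \<in> K" by (cases n rule: int_cases2) (auto intro: K_of_nat K_minus)

lemma K_Rats: "q \<in> \<rat> \<Longrightarrow> q \<in> K" by (auto elim!: Rats_cases' intro: K_divide K_of_int)

lemma K_sum: "(\<And>i. i \<in> S \<Longrightarrow> f i \<in> K) \<Longrightarrow> sum f S \<in> K"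
  by (induction S rule: infinite_finite_induct) (auto intro: K_0 K_add)

lemma K_basis:
  obtains a where "a \<in> K" "a \<notin> \<real>" "\<And>x. x \<in> K \<Longrightarrow> \<exists>r\<in>\<rat>. \<exists>s\<in>\<rat>. x = r + s * a"
proof -
  interpret Q: vector_space "\<lambda>(q::rat) (z::complex). of_rat q * z"
    by unfold_locales (auto simp: algebra_simps of_rat_add of_rat_mult)
  obtain a where a: "a \<in> K" "a \<notin> \<real>" using iq by (auto simp: imaginary_quadratic_field_def)
  have a1: "a \<noteq> 1" "a \<noteq> 0" using a by auto
  have real: "of_rat q \<in> (\<real> :: complex set)" for q by (simp add: complex_Rats_Reals)
  have ind: "Q.independent {1, a}"
  proof -
    have "a \<notin> Q.span {1}" using real a(2) by (auto simp: Q.span_singleton)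
    then show ?thesis using Q.independent_insert[of a "{1}"] Q.dependent_single[of 1]
      by (auto simp: insert_commute)
  qed
  obtain B where B: "{1, a} \<subseteq> B" "B \<subseteq> K" "Q.independent B" "K \<subseteq> Q.span B"
    using Q.maximal_independent_subset_extend[OF _ ind, of K] a K_1 by blast
  have "card B = 2" using Q.dim_eq_card[of B K] B iq Q.span_mono[OF B(2)]
    by (simp add: imaginary_quadratic_field_def Q.basis_card_eq_dim)
  then have "B = {1, a}"
    using B(1) a1 by (metis card_2_iff card_subset_eq card_ge_0_finite zero_less_numeral)
  then have "\<exists>r s. x = of_rat r + of_rat s * a" if "x \<in> K" for x
  proof -
    have "x \<in> Q.span {1, a}" using B that \<open>B = _\<close> by blast
    then obtain k where "x - of_rat k * 1 \<in> Q.span {a}" using Q.span_insert by blast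
    then obtain s where "x - of_rat k * 1 = of_rat s * a" by (auto simp: Q.span_singleton)
    then show ?thesis by (intro exI[of _ k] exI[of _ s]) (simp add: algebra_simps)
  qed
  then have "\<And>x. x \<in> K \<Longrightarrow> \<exists>r\<in>\<rat>. \<exists>s\<in>\<rat>. x = r + s * a" by (metis Rats_of_rat)
  with a that show thesis by blast
qed

lemma Rats_real: "q \<in> \<rat> \<Longrightarrow> cnj q = q" by (auto elim!: Rats_cases')

lemma K_trace_norm:
  assumes "x \<in> K"
  shows "x + cnj x \<in> \<rat>" "x * cnj x \<in> \<rat>" "cnj x \<in> K"
proof -
  obtain a where a: "a \<in> K" "a \<notin> \<real>" and span: "\<And>x. x \<in> K \<Longrightarrow> \<exists>r\<in>\<rat>. \<exists>s\<in>\<rat>. x = r + s * a"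
    using K_basis by blast
  obtain q p where pq: "q \<in> \<rat>" "p \<in> \<rat>" "a * a = q + p * a"
    using span[OF K_mult[OF a(1) a(1)]] by blast
  have "cnj a * cnj a = q + p * cnj a"
    using arg_cong[OF pq(3), of cnj] Rats_real[OF pq(1)] Rats_real[OF pq(2)]
    by (simp only: complex_cnj_mult complex_cnj_add)
  \<comment> \<open>a and cnj a are two distinct roots of X^2 - p X - q, so p is their sum and -q
    their product.\<close>
  then have "(a - cnj a) * (a + cnj a - p) = 0" using pq(3) by (simp add: algebra_simps)
  moreover have "a \<noteq> cnj a" using a(2) by (metis Reals_cnj_iff)
  ultimately have tr: "a + cnj a = p" by simp
  then have cnja: "cnj a = p - a" by (simp add: algebra_simps)
  have nm: "a * cnj a = - q" using pq(3) unfolding cnja by (simp add: algebra_simps)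
  obtain r s where x: "r \<in> \<rat>" "s \<in> \<rat>" "x = r + s * a" using span[OF assms] by blast
  have cx: "cnj x = r + s * cnj a" using x Rats_real by simp
  have "x + cnj x = r + r + s * p" using x cx tr by (simp add: algebra_simps flip: tr)
  then show "x + cnj x \<in> \<rat>" using x(1,2) pq(2) by (simp only: Rats_add Rats_mult)
  have "x * cnj x = r * r + r * s * (a + cnj a) + s * s * (a * cnj a)"
    using x cx by (simp add: algebra_simps)
  then have "x * cnj x = r * r + r * s * p + s * s * (- q)" using tr nm by simp
  then show "x * cnj x \<in> \<rat>" using x(1,2) pq(1,2) by (simp only: Rats_add Rats_mult Rats_minus_iff)
  show "cnj x \<in> K" unfolding cx cnja using x pq a K_Rats by (intro K_add K_mult K_diff) auto
qed

lemma K_real_rational: "x \<in> K \<Longrightarrow> x \<in> \<real> \<Longrightarrow> x \<in> \<rat>"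
proof -
  assume x: "x \<in> K" "x \<in> \<real>"
  then have "x + x \<in> \<rat>" using K_trace_norm(1)[OF x(1)] by (simp add: Reals_cnj_iff)
  then have "(x + x) / 2 \<in> \<rat>" by (intro Rats_divide) auto
  then show "x \<in> \<rat>" by simp
qed

text \<open>Real elements of \<open>K\<close> are rational, and a rational algebraic integer is an
  integer; the others fall under the quadratic case. In terms of trace and norm, closure under sums
  and products becomes a computation.\<close>

lemma O_iff: "x \<in> OK \<longleftrightarrow> x \<in> K \<and> x + cnj x \<in> \<int> \<and> x * cnj x \<in> \<int>"
proof
  assume "x \<in> OK"
  then have x: "x \<in> K" "algebraic_int x" by (auto simp: ring_of_integers_def)
  show "x \<in> K \<and> x + cnj x \<in> \<int> \<and> x * cnj x \<in> \<int>"
  proof (cases "x \<in> \<real>")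
    case True
    then have "x \<in> \<int>" using x K_real_rational rational_algebraic_int_is_int by blast
    then show ?thesis using x True by (auto simp: Reals_cnj_iff)
  next
    case False
    then show ?thesis using x nonreal_quadratic_algebraic_int K_trace_norm by blast
  qed
qed (auto simp: ring_of_integers_def algebraic_int_if_integral_trace_norm)

lemma O_K: "x \<in> OK \<Longrightarrow> x \<in> K" by (simp add: O_iff)

lemma O_cnj: "x \<in> OK \<Longrightarrow> cnj x \<in> OK" by (simp add: O_iff K_trace_norm add.commute mult.commute)

text \<open>The mixed trace \<open>u = Tr (x y\<^sup>*)\<close> is a root of \<open>X\<^sup>2 - Tr(x) Tr(y) X + \<dots>\<close>
  because \<open>Tr (x y) + u\<close> and \<open>Tr (x y) u\<close> are integers.\<close>

lemma O_mixed_trace: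
  assumes x: "x \<in> OK" and y: "y \<in> OK"
  shows "x * cnj y + cnj x * y \<in> \<int>"
proof (rule rational_algebraic_int_is_int)
  let ?u = "x * cnj y + cnj x * y" and ?w = "x * y + cnj x * cnj y"
  have "x * cnj y \<in> K" using x y O_K K_trace_norm(3) K_mult by blast
  then show "?u \<in> \<rat>" using K_trace_norm(1)[of "x * cnj y"] by simp
  let ?tx = "x + cnj x" and ?ty = "y + cnj y" and ?nx = "x * cnj x" and ?ny = "y * cnj y"
  have ints: "?tx \<in> \<int>" "?ty \<in> \<int>" "?nx \<in> \<int>" "?ny \<in> \<int>" using x y by (auto simp: O_iff)
  have sum: "?u + ?w = ?tx * ?ty" by (simp add: algebra_simps)
  have prod: "?u * ?w = ?ny * (?tx * ?tx - 2 * ?nx) + ?nx * (?ty * ?ty - 2 * ?ny)"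
    by (simp add: algebra_simps)
  have s: "?u + ?w \<in> \<int>" unfolding sum by (rule Ints_mult[OF ints(1,2)])
  have p: "?u * ?w \<in> \<int>" unfolding prod using ints by (intro Ints_add[OF Ints_mult[OF _ Ints_diff[OF Ints_mult Ints_mult]] Ints_mult[OF _ Ints_diff[OF Ints_mult Ints_mult]]]) simp_all
  let ?p = "[:?u * ?w, - (?u + ?w), 1:]"
  show "algebraic_int ?u"
  proof (rule algebraic_int.intros)
    show "lead_coeff ?p = 1" by simp
    show "\<forall>i. coeff ?p i \<in> \<int>"
      using s p Ints_minus[OF s] by (auto simp: coeff_pCons split: nat.split)
    show "poly ?p ?u = 0" by (simp add: algebra_simps)
  qed
qed

lemma O_add: "x \<in> OK \<Longrightarrow> y \<in> OK \<Longrightarrow> x + y \<in> OK"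
proof -
  assume x: "x \<in> OK" and y: "y \<in> OK"
  have "(x + y) + cnj (x + y) = (x + cnj x) + (y + cnj y)" by simp
  moreover have "(x + y) * cnj (x + y) = x * cnj x + y * cnj y + (x * cnj y + cnj x * y)"
    by (simp add: algebra_simps)
  ultimately show ?thesis
    using x y O_mixed_trace[OF x y] by (auto simp only: O_iff intro!: K_add Ints_add)
qed

lemma O_mult: "x \<in> OK \<Longrightarrow> y \<in> OK \<Longrightarrow> x * y \<in> OK"
proof -
  assume x: "x \<in> OK" and y: "y \<in> OK"
  have "(x * y) + cnj (x * y) = (x + cnj x) * (y + cnj y) - (x * cnj y + cnj x * y)"
    by (simp add: algebra_simps)
  moreover have "(x * y) * cnj (x * y) = (x * cnj x) * (y * cnj y)" by (simp add: algebra_simps)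
  ultimately show ?thesis
    using x y O_mixed_trace[OF x y] by (auto simp only: O_iff intro!: K_mult Ints_diff Ints_mult)
qed

lemma O_of_int [simp]: "of_int n \<in> OK" by (auto simp: O_iff K_of_int)

lemma O_0 [simp]: "0 \<in> OK" and O_1 [simp]: "1 \<in> OK" and O_of_nat [simp]: "of_nat m \<in> OK"
  using O_of_int[of 0] O_of_int[of 1] O_of_int[of "int m"] by auto

lemma O_minus: "x \<in> OK \<Longrightarrow> - x \<in> OK" using O_mult[of "-1" x] O_of_int[of "-1"] by simp

lemma O_diff: "x \<in> OK \<Longrightarrow> y \<in> OK \<Longrightarrow> x - y \<in> OK" using O_add[of x "-y"] O_minus by simp

lemma O_sum: "(\<And>i. i \<in> S \<Longrightarrow> f i \<in> OK) \<Longrightarrow> sum f S \<in> OK"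
  by (induction S rule: infinite_finite_induct) (auto intro: O_add)

lemma O_norm: "x \<in> OK \<Longrightarrow> \<exists>m::nat. of_nat m = x * cnj x \<and> real m = (norm x)\<^sup>2"
proof -
  assume "x \<in> OK"
  then obtain k where k: "x * cnj x = of_int k" by (auto simp: O_iff elim: Ints_cases)
  have "complex_of_real ((norm x)\<^sup>2) = of_int k" using k by (simp only: complex_norm_square)
  then have r: "(norm x)\<^sup>2 = of_int k" by (metis of_real_eq_iff of_real_of_int_eq)
  then have "k \<ge> 0" by (metis of_int_0_le_iff zero_le_power2)
  then show ?thesis using k r by (intro exI[of _ "nat k"]) auto
qed

lemma K_denominator: "x \<in> K \<Longrightarrow> \<exists>m::nat. m > 0 \<and> of_nat m * x \<in> OK"
proof -
  assume x: "x \<in> K"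
  obtain b a where b: "b > 0" "x + cnj x = of_int a / of_int b"
    using Rats_cases'[OF K_trace_norm(1)[OF x]] by metis
  obtain d c where d: "d > 0" "x * cnj x = of_int c / of_int d"
    using Rats_cases'[OF K_trace_norm(2)[OF x]] by metis
  let ?m = "nat (b * d)"
  have m: "of_nat ?m = (of_int b * of_int d :: complex)" using b d by (simp add: of_nat_nat)
  have "of_nat ?m * x + cnj (of_nat ?m * x) = of_int d * of_int b * (x + cnj x)"
    unfolding m by (simp add: algebra_simps)
  also have "\<dots> = of_int (d * a)" using b by simp
  finally have 1: "of_nat ?m * x + cnj (of_nat ?m * x) \<in> \<int>" by simp
  have "of_nat ?m * x * cnj (of_nat ?m * x) = of_int b * of_int b * of_int d * of_int d * (x * cnj x)"
    unfolding m by (simp add: algebra_simps)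
  also have "\<dots> = of_int (b * b * d * c)" using d by simp
  finally have 2: "of_nat ?m * x * cnj (of_nat ?m * x) \<in> \<int>" by simp
  have "?m > 0" using b d by simp
  moreover have "of_nat ?m * x \<in> OK" using 1 2 x by (simp add: O_iff K_mult K_of_nat)
  ultimately show ?thesis by blast
qed

lemma O_real: "x \<in> OK \<Longrightarrow> x \<in> \<real> \<Longrightarrow> x \<in> \<int>"
  using K_real_rational rational_algebraic_int_is_int by (auto simp: ring_of_integers_def)

text \<open>The identity is 4 (Im x)^2 = 4 N(x) - Tr(x)^2. It makes the imaginary parts discrete, so
  a least positive one exists.\<close>

lemma O_Im: "x \<in> OK \<Longrightarrow> \<exists>m::nat. 4 * (Im x)\<^sup>2 = real m"
proof -
  assume x: "x \<in> OK"
  obtain t where t: "x + cnj x = of_int t" using x by (auto simp: O_iff elim: Ints_cases)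
  obtain m where m: "real m = (norm x)\<^sup>2" using O_norm[OF x] by blast
  have "2 * Re x = of_int t" using arg_cong[OF t, of Re] by simp
  then have "4 * (Im x)\<^sup>2 = of_int (4 * int m - t\<^sup>2)"
    using m by (simp add: cmod_power2 flip: \<open>2 * Re x = _\<close>)
  moreover from this have "4 * int m - t\<^sup>2 \<ge> 0"
    by (metis of_int_0_le_iff mult_nonneg_nonneg zero_le_numeral zero_le_power2)
  ultimately show ?thesis by (intro exI[of _ "nat (4 * int m - t\<^sup>2)"]) simp
qed

text \<open>\<omega> is an integer with least positive imaginary part. Subtracting the multiple
  given by the floor of a quotient of imaginary parts leaves an integer with imaginary part in [0,
  Im \<omega>), hence a real one, hence a rational integer.\<close>

lemma O_basis:
  obtains \<omega> where "\<omega> \<in> OK" "Im \<omega> > 0" "\<And>x. x \<in> OK \<longleftrightarrow> (\<exists>a b. x = of_int a + of_int b * \<omega>)"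
proof -
  define P where "P = (\<lambda>m::nat. \<exists>x\<in>OK. Im x > 0 \<and> 4 * (Im x)\<^sup>2 = real m)"
  obtain a where a: "a \<in> K" "a \<notin> \<real>" using K_basis by blast
  obtain m where m: "m > 0" "of_nat m * a \<in> OK" using K_denominator[OF a(1)] by blast
  have "Im a \<noteq> 0" using a by (auto simp: complex_is_Real_iff)
  have "\<exists>x\<in>OK. Im x > 0"
  proof (cases "Im a > 0")
    case True
    then show ?thesis using m by (intro bexI[of _ "of_nat m * a"]) auto
  next
    case False
    then show ?thesis using m \<open>Im a \<noteq> 0\<close> O_minus[OF m(2)]
      by (intro bexI[of _ "- (of_nat m * a)"]) (auto simp: mult_pos_neg)
  qed
  then have "\<exists>m. P m" unfolding P_def using O_Im by meson
  then obtain k where k: "P k" "\<And>j. P j \<Longrightarrow> k \<le> j" by (metis LeastI Least_le)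
  then obtain \<omega> where \<omega>: "\<omega> \<in> OK" "Im \<omega> > 0" "4 * (Im \<omega>)\<^sup>2 = real k" unfolding P_def by blast
  have min: "Im \<omega> \<le> Im x" if "x \<in> OK" "Im x > 0" for x
  proof -
    obtain j where j: "4 * (Im x)\<^sup>2 = real j" using O_Im[OF \<open>x \<in> OK\<close>] by blast
    then have "k \<le> j" using k(2) that unfolding P_def by blast
    then have "(Im \<omega>)\<^sup>2 \<le> (Im x)\<^sup>2" using j \<omega>(3) by simp
    then show ?thesis using that by (simp add: power2_le_iff_abs_le)
  qed
  have "x \<in> OK \<longleftrightarrow> (\<exists>a b. x = of_int a + of_int b * \<omega>)" for x
  proof
    assume x: "x \<in> OK"
    define b where "b = \<lfloor>Im x / Im \<omega>\<rfloor>"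
    define y where "y = x - of_int b * \<omega>"
    have y: "y \<in> OK" unfolding y_def using x \<omega> by (intro O_diff O_mult) auto
    have "0 \<le> Im y \<and> Im y < Im \<omega>"
    proof -
      have "of_int b \<le> Im x / Im \<omega>" "Im x / Im \<omega> < of_int b + 1" unfolding b_def by linarith+
      then show ?thesis using \<omega>(2) by (auto simp: y_def field_simps)
    qed
    then have "Im y = 0" using min[OF y] by force
    then have "y \<in> \<int>" using O_real[OF y] by (simp add: complex_is_Real_iff)
    then obtain a where "y = of_int a" by (auto elim: Ints_cases)
    then have "x = of_int a + of_int b * \<omega>" unfolding y_def by (simp add: algebra_simps)
    then show "\<exists>a b. x = of_int a + of_int b * \<omega>" by blast
  qed (auto intro!: O_add O_mult \<omega>(1))
  with \<omega> that show thesis by blast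
qed

end


section \<open>Ideals, indices and bounded class representatives\<close>

text \<open>Indices are computed by exhibiting coset representatives, which are easier to combine
  and to conjugate than quotient sets.\<close>

definition transversal :: "complex set \<Rightarrow> complex set \<Rightarrow> complex set \<Rightarrow> bool" where
  "transversal G H T \<longleftrightarrow> T \<subseteq> G \<and> (\<forall>g\<in>G. \<exists>!t. t \<in> T \<and> g - t \<in> H)"

context imaginary_quadratic
begin

section \<open>Indices of ideals and the norm\<close>

abbreviation "idl \<equiv> nonzero_ideal K"

abbreviation "idx \<equiv> ideal_index K"

definition ideal_congruence :: "complex set \<Rightarrow> (complex \<times> complex) set" where
  "ideal_congruence I = {(x, y). x \<in> OK \<and> y \<in> OK \<and> x - y \<in> I}"

lemma ideal_congruence_iff [simp]:
  "(x, y) \<in> ideal_congruence I \<longleftrightarrow> x \<in> OK \<and> y \<in> OK \<and> x - y \<in> I" by (simp add: ideal_congruence_def)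

lemma ideal_index_eq: "idx I = card (OK // ideal_congruence I)"
  by (simp add: ideal_index_def ideal_congruence_def)

lemma ideal_O: "idl I \<Longrightarrow> I \<subseteq> OK"
  and ideal_0: "idl I \<Longrightarrow> 0 \<in> I"
  and ideal_add: "idl I \<Longrightarrow> x \<in> I \<Longrightarrow> y \<in> I \<Longrightarrow> x + y \<in> I"
  and ideal_mult: "idl I \<Longrightarrow> r \<in> OK \<Longrightarrow> x \<in> I \<Longrightarrow> r * x \<in> I" by (auto simp: nonzero_ideal_def)

lemma ideal_minus: "idl I \<Longrightarrow> x \<in> I \<Longrightarrow> - x \<in> I" using ideal_mult[of I "-1" x] O_of_int[of "-1"] by simp

lemma ideal_diff: "idl I \<Longrightarrow> x \<in> I \<Longrightarrow> y \<in> I \<Longrightarrow> x - y \<in> I"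
  using ideal_add[of I x "- y"] ideal_minus by simp

lemma ideal_nonzero_elem: "idl I \<Longrightarrow> \<exists>\<beta>\<in>I. \<beta> \<noteq> 0" by (auto simp: nonzero_ideal_def)

lemma ideal_OK: "idl OK"
proof -
  have "OK \<noteq> {0}" using O_1 by (metis singletonD zero_neq_one)
  then show ?thesis by (simp add: nonzero_ideal_def O_add O_mult)
qed

lemma ideal_scale:
  assumes "idl I" "\<kappa> \<noteq> 0" "(*) \<kappa> ` I \<subseteq> OK"
  shows "idl ((*) \<kappa> ` I)" unfolding nonzero_ideal_def
proof (intro conjI ballI)
  obtain \<beta> where "\<beta> \<in> I" "\<beta> \<noteq> 0" using ideal_nonzero_elem assms(1) by blast
  then show "(*) \<kappa> ` I \<noteq> {0}" using assms(2) by (metis imageI mult_eq_0_iff singletonD)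
  show "0 \<in> (*) \<kappa> ` I" using ideal_0[OF assms(1)] by force
  fix x y assume "x \<in> (*) \<kappa> ` I" "y \<in> (*) \<kappa> ` I"
  then show "x + y \<in> (*) \<kappa> ` I" using ideal_add[OF assms(1)] by (auto simp flip: distrib_left)
next
  fix r x assume "r \<in> OK" "x \<in> (*) \<kappa> ` I"
  then show "r * x \<in> (*) \<kappa> ` I"
    using ideal_mult[OF assms(1)] by (auto simp: image_iff mult.left_commute)
qed (use assms in auto)

lemma ideal_scale_O: "idl I \<Longrightarrow> d \<in> OK \<Longrightarrow> d \<noteq> 0 \<Longrightarrow> idl ((*) d ` I)"
  by (rule ideal_scale) (auto dest: ideal_O intro: O_mult)

lemma ideal_congruence_equiv: "idl I \<Longrightarrow> equiv OK (ideal_congruence I)"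
proof (rule equivI)
  assume I: "idl I"
  show "refl_on OK (ideal_congruence I)" using ideal_0[OF I] by (auto simp: refl_on_def)
  show "ideal_congruence I \<subseteq> OK \<times> OK" by (auto simp: ideal_congruence_def)
  show "sym (ideal_congruence I)"
    using ideal_minus[OF I] by (auto simp: sym_def) (metis minus_diff_eq)
  show "trans (ideal_congruence I)"
    using ideal_add[OF I] by (auto simp: trans_def) (metis diff_add_cancel add_diff_eq)
qed

lemma ideal_index_transversal:
  assumes "idl I" "transversal OK I T"
  shows "idx I = card T"
proof -
  let ?r = "ideal_congruence I"
  have eq: "equiv OK ?r" using ideal_congruence_equiv assms(1) .
  have TO: "T \<subseteq> OK" using assms(2) by (auto simp: transversal_def)
  have "bij_betw (\<lambda>t. ?r `` {t}) T (OK // ?r)" unfolding bij_betw_def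
  proof
    show "inj_on (\<lambda>t. ?r `` {t}) T"
    proof (rule inj_onI)
      fix s t assume st: "s \<in> T" "t \<in> T" "?r `` {s} = ?r `` {t}"
      then have "s - t \<in> I" using eq_equiv_class[OF st(3) eq] TO by auto
      moreover have "s - s \<in> I" using ideal_0[OF assms(1)] by simp
      ultimately show "s = t" using assms(2) st TO unfolding transversal_def by (metis subsetD)
    qed
    show "(\<lambda>t. ?r `` {t}) ` T = OK // ?r"
    proof
      show "(\<lambda>t. ?r `` {t}) ` T \<subseteq> OK // ?r" using TO by (auto intro: quotientI)
      show "OK // ?r \<subseteq> (\<lambda>t. ?r `` {t}) ` T"
      proof
        fix c assume "c \<in> OK // ?r"
        then obtain g where g: "g \<in> OK" "c = ?r `` {g}" by (rule quotientE)
        then obtain t where t: "t \<in> T" "g - t \<in> I" using assms(2) unfolding transversal_def by blast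
        then have "(g, t) \<in> ?r" using g TO by auto
        then have "c = ?r `` {t}" using g equiv_class_eq[OF eq] by blast
        then show "c \<in> (\<lambda>t. ?r `` {t}) ` T" using t by blast
      qed
    qed
  qed
  then show ?thesis unfolding ideal_index_eq by (simp add: bij_betw_same_card)
qed

lemma transversal_exists:
  assumes "idl I"
  obtains T where "transversal OK I T"
proof -
  let ?r = "ideal_congruence I"
  define f where "f = (\<lambda>g. SOME x. x \<in> ?r `` {g})"
  have eq: "equiv OK ?r" using ideal_congruence_equiv assms(1) .
  have f: "f g \<in> ?r `` {g}" if "g \<in> OK" for g
    unfolding f_def by (rule someI[of _ g]) (use that ideal_0[OF assms] in auto)
  have "transversal OK I (f ` OK)" unfolding transversal_def
  proof (intro conjI ballI)
    show "f ` OK \<subseteq> OK" using f by auto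
    fix g assume g: "g \<in> OK"
    show "\<exists>!t. t \<in> f ` OK \<and> g - t \<in> I"
    proof (rule ex1I[of _ "f g"])
      show "f g \<in> f ` OK \<and> g - f g \<in> I" using f[OF g] g by auto
      fix t assume t: "t \<in> f ` OK \<and> g - t \<in> I"
      then obtain h where h: "h \<in> OK" "t = f h" by blast
      have "(h, t) \<in> ?r" "(g, t) \<in> ?r" using f[OF h(1)] h t g by auto
      then have "?r `` {h} = ?r `` {g}"
        using equiv_class_eq[OF eq, of h t] equiv_class_eq[OF eq, of g t] by simp
      then show "t = f g" using h by (simp only: f_def)
    qed
  qed
  then show thesis using that by blast
qed

text \<open>The chain O_K, d O_K, d I has steps of index [O_K : (d)] and [O_K : I], the latter
  because multiplication by d is injective. Representatives are s + d t.\<close>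

lemma ideal_index_mult:
  assumes I: "idl I" and d: "d \<in> OK" "d \<noteq> 0"
  shows "idx ((*) d ` I) = idx ((*) d ` OK) * idx I"
proof -
  have dO: "idl ((*) d ` OK)" and dI: "idl ((*) d ` I)" using ideal_scale_O d I ideal_OK by auto
  obtain S where S: "transversal OK ((*) d ` OK) S" using transversal_exists[OF dO] .
  obtain T where T: "transversal OK I T" using transversal_exists[OF I] .
  have SO: "S \<subseteq> OK" and TO: "T \<subseteq> OK" using S T by (auto simp: transversal_def)
  let ?h = "\<lambda>(s, t). s + d * t"
  have uniq: "s = s' \<and> t = t'"
    if st: "s \<in> S" "s' \<in> S" "t \<in> T" "t' \<in> T" and mem: "s + d * t - (s' + d * t') \<in> (*) d ` I" for s s' t t'
  proof -
    obtain i where i: "i \<in> I" "s + d * t - (s' + d * t') = d * i" using mem by blast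
    have "s - s' = d * (i + t' - t)" using i by (simp add: algebra_simps)
    moreover have "i + t' - t \<in> OK" using i ideal_O[OF I] TO st by (intro O_diff O_add) auto
    ultimately have "s - s' \<in> (*) d ` OK" by blast
    moreover have "s - s \<in> (*) d ` OK" using ideal_0[OF dO] by simp
    ultimately have s: "s = s'" using S st SO unfolding transversal_def by (metis subsetD)
    then have "t - t' = i" using i d by (simp add: algebra_simps) (metis add_diff_cancel_left' distrib_left mult_left_cancel)
    then have "t - t' \<in> I" "t - t \<in> I" using i ideal_0[OF I] by auto
    then show ?thesis using s T st TO unfolding transversal_def by (metis subsetD)
  qed
  have "transversal OK ((*) d ` I) (?h ` (S \<times> T))" unfolding transversal_def
  proof (intro conjI ballI)
    show "?h ` (S \<times> T) \<subseteq> OK" using SO TO d by (auto intro!: O_add O_mult)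
    fix g assume g: "g \<in> OK"
    then obtain s where s: "s \<in> S" "g - s \<in> (*) d ` OK" using S unfolding transversal_def by blast
    then obtain z where z: "z \<in> OK" "g - s = d * z" by blast
    then obtain t where t: "t \<in> T" "z - t \<in> I" using T unfolding transversal_def by blast
    have e: "g - (s + d * t) = d * (z - t)" using z by (simp add: algebra_simps)
    show "\<exists>!u. u \<in> ?h ` (S \<times> T) \<and> g - u \<in> (*) d ` I"
    proof (rule ex1I[of _ "s + d * t"])
      show "s + d * t \<in> ?h ` (S \<times> T) \<and> g - (s + d * t) \<in> (*) d ` I" using s t e by force
      fix u assume u: "u \<in> ?h ` (S \<times> T) \<and> g - u \<in> (*) d ` I"
      then obtain s' t' where u': "s' \<in> S" "t' \<in> T" "u = s' + d * t'" by auto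
      have "s + d * t - u = (g - u) - (g - (s + d * t))" by simp
      moreover have "g - (s + d * t) \<in> (*) d ` I" unfolding e using t by blast
      ultimately have "s + d * t - u \<in> (*) d ` I" using u ideal_diff[OF dI] by metis
      then show "u = s + d * t" using uniq[OF s(1) u'(1) t(1) u'(2)] u' by auto
    qed
  qed
  then have "idx ((*) d ` I) = card (?h ` (S \<times> T))" using ideal_index_transversal[OF dI] by blast
  also have "\<dots> = card (S \<times> T)"
    by (rule card_image) (auto simp: inj_on_def uniq ideal_0[OF dI] intro!: uniq)
  also have "\<dots> = idx ((*) d ` OK) * idx I"
    using ideal_index_transversal S T dO I by (simp add: card_cartesian_product)
  finally show ?thesis .
qed

text \<open>Modulo m, the two coordinates with respect to 1, \<omega> vary independently over 0,
  ..., m - 1.\<close>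

lemma ideal_index_of_nat:
  assumes "m > 0"
  shows "idx ((*) (of_nat m) ` OK) = m * m"
proof -
  obtain \<omega> where w: "\<omega> \<in> OK" "Im \<omega> > 0" "\<And>x. x \<in> OK \<longleftrightarrow> (\<exists>a b. x = of_int a + of_int b * \<omega>)"
    using O_basis by blast
  let ?h = "\<lambda>(a, b). of_int a + of_int b * \<omega>"
  have inj: "a = a' \<and> b = b'" if "of_int a + of_int b * \<omega> = of_int a' + of_int b' * \<omega>" for a b a' b'
  proof -
    have "of_int b * Im \<omega> = of_int b' * Im \<omega>" using arg_cong[OF that, of Im] by simp
    then have "b = b'" using w by simp
    then show ?thesis using that by simp
  qed
  let ?R = "{0..<int m} \<times> {0..<int m}"
  have mO: "idl ((*) (of_nat m) ` OK)" using ideal_scale_O[OF ideal_OK, of "of_nat m"] assms by simp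
  have "transversal OK ((*) (of_nat m) ` OK) (?h ` ?R)" unfolding transversal_def
  proof (intro conjI ballI)
    show "?h ` ?R \<subseteq> OK" using w(3) by auto
    fix g assume "g \<in> OK"
    then obtain a b where g: "g = of_int a + of_int b * \<omega>" using w by blast
    let ?t = "of_int (a mod int m) + of_int (b mod int m) * \<omega>"
    show "\<exists>!t. t \<in> ?h ` ?R \<and> g - t \<in> (*) (of_nat m) ` OK"
    proof (rule ex1I[of _ ?t])
      have "g - ?t = of_nat m * (of_int (a div int m) + of_int (b div int m) * \<omega>)"
      proof -
        have "complex_of_int a = of_int (a div int m) * of_nat m + of_int (a mod int m)" for a
          by (metis div_mult_mod_eq of_int_add of_int_mult of_int_of_nat_eq)
        from this[of a] this[of b] show ?thesis unfolding g by (simp add: algebra_simps)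
      qed
      moreover have "of_int (a div int m) + of_int (b div int m) * \<omega> \<in> OK" using w by blast
      ultimately show "?t \<in> ?h ` ?R \<and> g - ?t \<in> (*) (of_nat m) ` OK"
        using assms by (auto intro!: image_eqI[of _ _ "(a mod int m, b mod int m)"])
      fix t assume t: "t \<in> ?h ` ?R \<and> g - t \<in> (*) (of_nat m) ` OK"
      then obtain c d where cd: "(c, d) \<in> ?R" "t = of_int c + of_int d * \<omega>" by auto
      obtain x where x: "x \<in> OK" "g - t = of_nat m * x" using t by blast
      obtain u v where uv: "x = of_int u + of_int v * \<omega>" using x w by blast
      have "of_int a + of_int b * \<omega> = of_int (c + int m * u) + of_int (d + int m * v) * \<omega>"
        using x(2) unfolding g cd uv by (simp add: algebra_simps)
      then have "a = c + int m * u" "b = d + int m * v" using inj by blast+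
      then have "a mod int m = c" "b mod int m = d" using cd by auto
      then show "t = ?t" using cd by simp
    qed
  qed
  then have "idx ((*) (of_nat m) ` OK) = card (?h ` ?R)"
    using ideal_index_transversal[OF mO] by blast
  also have "\<dots> = card ?R" by (rule card_image) (auto simp: inj_on_def dest: inj)
  finally show ?thesis by (simp add: card_cartesian_product)
qed

text \<open>Conjugation carries a transversal of (d) to one of (cnj d), so both ideals have the same
  index. Their product is generated by m = N(d) and has index m^2, so multiplicativity identifies
  the square of the index of (d) with m^2.\<close>

lemma ideal_index_principal:
  assumes d: "d \<in> OK" "d \<noteq> 0"
  shows "real (idx ((*) d ` OK)) = (norm d)\<^sup>2"
proof -
  obtain m where m: "of_nat m = d * cnj d" "real m = (norm d)\<^sup>2" using O_norm[OF d(1)] by blast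
  have m0: "m > 0" using m d by (metis gr0I of_nat_0 zero_eq_power2 norm_eq_zero)
  have c: "cnj d \<in> OK" "cnj d \<noteq> 0" using d O_cnj by auto
  have dO: "idl ((*) d ` OK)" "idl ((*) (cnj d) ` OK)" using ideal_scale_O ideal_OK d c by auto
  have cdO: "z \<in> (*) (cnj d) ` OK \<longleftrightarrow> cnj z \<in> (*) d ` OK" for z
    using O_cnj by (auto simp: image_iff) (metis complex_cnj_cnj complex_cnj_mult)+
  obtain T where T: "transversal OK ((*) d ` OK) T" using transversal_exists[OF dO(1)] .
  have "transversal OK ((*) (cnj d) ` OK) (cnj ` T)" unfolding transversal_def
  proof (intro conjI ballI)
    show "cnj ` T \<subseteq> OK" using T O_cnj by (auto simp: transversal_def)
    fix g assume "g \<in> OK"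
    then obtain t where t: "t \<in> T" "cnj g - t \<in> (*) d ` OK"
      "\<And>s. s \<in> T \<Longrightarrow> cnj g - s \<in> (*) d ` OK \<Longrightarrow> s = t" using T O_cnj unfolding transversal_def by metis
    show "\<exists>!t. t \<in> cnj ` T \<and> g - t \<in> (*) (cnj d) ` OK"
    proof (rule ex1I[of _ "cnj t"])
      have "cnj (g - cnj t) = cnj g - t" by simp
      then show "cnj t \<in> cnj ` T \<and> g - cnj t \<in> (*) (cnj d) ` OK" using t(1,2) cdO by (metis imageI)
      fix u assume u: "u \<in> cnj ` T \<and> g - u \<in> (*) (cnj d) ` OK"
      then obtain s where s: "s \<in> T" "u = cnj s" by blast
      have "cnj (g - u) \<in> (*) d ` OK" using u cdO by blast
      then have "cnj g - s \<in> (*) d ` OK" using s by simp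
      then show "u = cnj t" using t(3) s by blast
    qed
  qed
  then have "idx ((*) (cnj d) ` OK) = card (cnj ` T)"
    using ideal_index_transversal[OF dO(2)] by blast
  also have "\<dots> = card T" by (rule card_image) (auto simp: inj_on_def)
  also have "\<dots> = idx ((*) d ` OK)" using ideal_index_transversal[OF dO(1) T] by simp
  finally have conj: "idx ((*) (cnj d) ` OK) = idx ((*) d ` OK)" .
  have "m * m = idx ((*) (of_nat m) ` OK)" using ideal_index_of_nat[OF m0] by simp
  also have "(*) (complex_of_nat m) ` OK = (*) d ` (*) (cnj d) ` OK"
    unfolding m(1) by (auto simp: image_image mult.assoc)
  also have "idx \<dots> = idx ((*) d ` OK) * idx ((*) d ` OK)"
    using ideal_index_mult[OF dO(2) d] conj by simp
  finally have "idx ((*) d ` OK) = m" by (simp flip: power2_eq_square)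
  then show ?thesis using m by simp
qed

text \<open>A transversal of the smaller ideal (\<beta>) meets every class modulo I. Positivity
  includes finiteness of the quotient, since \<open>card\<close> vanishes on infinite sets.\<close>

lemma ideal_index_le:
  assumes I: "idl I" and b: "\<beta> \<in> I" "\<beta> \<noteq> 0"
  shows "0 < idx I" "real (idx I) \<le> (norm \<beta>)\<^sup>2"
proof -
  let ?r = "ideal_congruence I"
  have bO: "\<beta> \<in> OK" using b ideal_O[OF I] by blast
  have bI: "idl ((*) \<beta> ` OK)" using ideal_scale_O ideal_OK bO b by blast
  obtain T where T: "transversal OK ((*) \<beta> ` OK) T" using transversal_exists[OF bI] .
  have cT: "real (card T) = (norm \<beta>)\<^sup>2"
    using ideal_index_transversal[OF bI T] ideal_index_principal[OF bO b(2)] by simp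
  then have "finite T" using b by (metis card.infinite norm_eq_zero of_nat_0 zero_eq_power2)
  have "OK // ?r \<subseteq> (\<lambda>t. ?r `` {t}) ` T"
  proof
    fix c assume "c \<in> OK // ?r"
    then obtain g where g: "g \<in> OK" "c = ?r `` {g}" by (rule quotientE)
    then obtain t where t: "t \<in> T" "g - t \<in> (*) \<beta> ` OK" using T unfolding transversal_def by blast
    then have "g - t \<in> I" using ideal_mult[OF I _ b(1)] by (metis imageE mult.commute)
    then have "(g, t) \<in> ?r" using g T t by (auto simp: transversal_def)
    then have "c = ?r `` {t}" using g equiv_class_eq[OF ideal_congruence_equiv[OF I]] by blast
    then show "c \<in> (\<lambda>t. ?r `` {t}) ` T" using t by blast
  qed
  then have fin: "finite (OK // ?r)" and "card (OK // ?r) \<le> card T"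
    using \<open>finite T\<close> surj_card_le by (auto intro: finite_subset)
  then show "real (idx I) \<le> (norm \<beta>)\<^sup>2" unfolding ideal_index_eq using cT by simp
  have "OK // ?r \<noteq> {}" using quotientI[OF O_0, of ?r] by (metis empty_iff)
  then show "0 < idx I" unfolding ideal_index_eq using fin by (simp add: card_gt_0_iff)
qed

lemma ideal_index_pos: "idl I \<Longrightarrow> 0 < idx I"
  using ideal_nonzero_elem[of I] ideal_index_le(1)[of I] by auto

lemma ideal_index_scale_O:
  assumes "idl I" "d \<in> OK" "d \<noteq> 0"
  shows "real (idx ((*) d ` I)) = (norm d)\<^sup>2 * real (idx I)"
  by (simp add: ideal_index_mult[OF assms] ideal_index_principal[OF assms(2,3)])

lemma ideal_index_scale:
  assumes "idl I" "\<kappa> \<in> K" "\<kappa> \<noteq> 0" "idl ((*) \<kappa> ` I)"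
  shows "real (idx ((*) \<kappa> ` I)) = (norm \<kappa>)\<^sup>2 * real (idx I)"
proof -
  obtain m where m: "m > 0" "of_nat m * \<kappa> \<in> OK" using K_denominator assms(2) by blast
  have "(norm (of_nat m * \<kappa>))\<^sup>2 * real (idx I) = real (idx ((*) (of_nat m * \<kappa>) ` I))"
    using ideal_index_scale_O[OF assms(1) m(2)] m assms by simp
  also have "(*) (of_nat m * \<kappa>) ` I = (*) (of_nat m) ` (*) \<kappa> ` I"
    by (auto simp: image_image mult.assoc)
  also have "real (idx \<dots>) = (norm (complex_of_nat m))\<^sup>2 * real (idx ((*) \<kappa> ` I))"
    using ideal_index_scale_O[OF assms(4), of "of_nat m"] m by simp
  finally have "(real m)\<^sup>2 * ((norm \<kappa>)\<^sup>2 * real (idx I)) = (real m)\<^sup>2 * real (idx ((*) \<kappa> ` I))"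
    by (simp only: norm_mult power_mult_distrib norm_of_nat mult.assoc)
  moreover have "(real m)\<^sup>2 \<noteq> 0" using m(1) by simp
  ultimately show ?thesis by (metis mult_left_cancel)
qed

text \<open>The quotient in the definition is the same for every admissible d, which justifies
  \<open>THE\<close>; d = 1 is the witness.\<close>

lemma ideal_norm_integral:
  assumes J: "idl J"
  shows "ideal_norm K J = real (idx J)" unfolding ideal_norm_def
proof (rule the_equality)
  have quot: "real (idx ((*) d ` J)) / real (idx ((*) d ` OK)) = real (idx J)"
    if "d \<in> OK" "d \<noteq> 0" for d
    unfolding ideal_index_scale_O[OF J that] ideal_index_principal[OF that] using that(2) by simp
  show "\<exists>d\<in>OK - {0}. (*) d ` J \<subseteq> OK \<and>
      real (idx J) = real (idx ((*) d ` J)) / real (idx ((*) d ` OK))"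
  proof (intro bexI conjI)
    show "(*) 1 ` J \<subseteq> OK" using ideal_O[OF J] by simp
    show "real (idx J) = real (idx ((*) 1 ` J)) / real (idx ((*) 1 ` OK))"
      by (rule quot[symmetric]) simp_all
    show "1 \<in> OK - {0}" by simp
  qed
  show "r = real (idx J)" if "\<exists>d\<in>OK - {0}. (*) d ` J \<subseteq> OK \<and>
      r = real (idx ((*) d ` J)) / real (idx ((*) d ` OK))" for r
  proof -
    from that obtain d where "d \<in> OK" "d \<noteq> 0"
      "r = real (idx ((*) d ` J)) / real (idx ((*) d ` OK))" by blast
    then show ?thesis using quot[of d] by simp
  qed
qed

text \<open>Dirichlet's theorem for the real coordinates of z with respect to 1, \<omega>. What
  matters later is that Q depends on \<open>K\<close>, \<epsilon> and the number of coordinates, but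
  not on z.\<close>

lemma O_approximation:
  assumes "\<epsilon> > 0"
  shows "\<exists>Q::nat. \<forall>z :: 'm::finite \<Rightarrow> complex. \<exists>q w. 0 < q \<and> q \<le> Q
           \<and> (\<forall>j. w j \<in> OK \<and> norm (of_nat q * z j - w j) < \<epsilon>)"
proof -
  obtain \<omega> where w: "\<omega> \<in> OK" "Im \<omega> > 0" "\<And>x. x \<in> OK \<longleftrightarrow> (\<exists>a b. x = of_int a + of_int b * \<omega>)"
    using O_basis by blast
  \<comment> \<open>An error below 1/N in both real coordinates gives an error of at most (1 +
    |\<omega>|)/N in the complex number.\<close>
  obtain N :: nat where N: "(1 + norm \<omega>) / \<epsilon> < real N" using reals_Archimedean2 by blast
  moreover have "0 < (1 + norm \<omega>) / \<epsilon>" using assms by (simp add: add_pos_nonneg)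
  ultimately have N0: "N > 0" by (metis gr0I of_nat_0 order_less_asym)
  have Ne: "(1 + norm \<omega>) / real N < \<epsilon>" using N N0 assms by (simp add: field_simps)
  obtain f :: "'m \<Rightarrow> nat" where f: "bij_betw f UNIV {0..<CARD('m)}"
    using ex_bij_betw_finite_nat[of "UNIV :: 'm set"] by auto
  have fj: "f j < CARD('m)" for j using f by (auto simp: bij_betw_def)
  have inv: "inv f (f j) = j" for j using f by (simp add: bij_betw_def)
  show ?thesis
  proof (rule exI[of _ "N ^ (2 * CARD('m))"], rule allI)
    fix z :: "'m \<Rightarrow> complex"
    define b where "b = (\<lambda>j. Im (z j) / Im \<omega>)"
    define a where "a = (\<lambda>j. Re (z j) - b j * Re \<omega>)"
    have z: "z j = of_real (a j) + of_real (b j) * \<omega>" for j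
      using w(2) by (simp add: complex_eq_iff a_def b_def)
    \<comment> \<open>The coordinates are interleaved: even positions hold the coefficients of 1,
      odd positions those of \<omega>.\<close>
    define \<theta> where "\<theta> = (\<lambda>i. if even i then a (inv f (i div 2)) else b (inv f (i div 2)))"
    obtain q p where q: "0 < q" "q \<le> int (N ^ (2 * CARD('m)))"
      and qp: "\<And>i. i < 2 * CARD('m) \<Longrightarrow> \<bar>of_int q * \<theta> i - of_int (p i)\<bar> < 1 / real N"
      using Dirichlet_approx_simult[OF N0, of "2 * CARD('m)" \<theta>] by blast
    define u where "u = (\<lambda>j. of_int (p (2 * f j)) + of_int (p (2 * f j + 1)) * \<omega>)"
    have "norm (of_nat (nat q) * z j - u j) < \<epsilon>" for j
    proof -
      have 1: "\<bar>of_int q * a j - of_int (p (2 * f j))\<bar> < 1 / real N"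
        using qp[of "2 * f j"] fj[of j] by (simp add: \<theta>_def inv)
      have 2: "\<bar>of_int q * b j - of_int (p (2 * f j + 1))\<bar> < 1 / real N"
        using qp[of "2 * f j + 1"] fj[of j] by (simp add: \<theta>_def inv)
      have "of_nat (nat q) * z j - u j = of_real (of_int q * a j - of_int (p (2 * f j)))
          + of_real (of_int q * b j - of_int (p (2 * f j + 1))) * \<omega>"
        using q by (simp add: z u_def algebra_simps of_nat_nat)
      then have "norm (of_nat (nat q) * z j - u j) \<le> \<bar>of_int q * a j - of_int (p (2 * f j))\<bar>
          + \<bar>of_int q * b j - of_int (p (2 * f j + 1))\<bar> * norm \<omega>"
        by (metis norm_triangle_ineq norm_mult norm_of_real)
      also have "\<dots> \<le> 1 / real N + 1 / real N * norm \<omega>"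
        using 1 2 by (intro add_mono mult_right_mono) auto
      also have "\<dots> = (1 + norm \<omega>) / real N" by (simp add: add_divide_distrib)
      finally show ?thesis using Ne by simp
    qed
    moreover have "u j \<in> OK" for j unfolding u_def using w(3) by blast
    moreover have "nat q \<le> N ^ (2 * CARD('m))" using q by (simp add: nat_le_iff)
    ultimately show "\<exists>q w. 0 < q \<and> q \<le> N ^ (2 * CARD('m))
           \<and> (\<forall>j. w j \<in> OK \<and> norm (of_nat q * z j - w j) < \<epsilon>)"
      using q(1) by (intro exI[of _ "nat q"] exI[of _ u]) auto
  qed
qed

text \<open>Hurwitz's form of the finiteness of the class number: an element \<open>\<beta>\<close> of least absolute
  value in \<open>I\<close> divides \<open>M I\<close>, because some \<open>q \<alpha> - w \<beta>\<close> with \<open>q\<close> bounded is smaller than \<open>\<beta>\<close>.\<close>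

lemma ideal_class_bound:
  "\<exists>M::nat. M > 0 \<and> (\<forall>I. idl I \<longrightarrow>
     (\<exists>\<kappa>\<in>K. \<kappa> \<noteq> 0 \<and> (*) \<kappa> ` I \<subseteq> OK \<and> of_nat M \<in> (*) \<kappa> ` I))"
proof -
  obtain Q :: nat where Q: "\<And>z :: unit \<Rightarrow> complex. \<exists>q w. 0 < q \<and> q \<le> Q
           \<and> (\<forall>j. w j \<in> OK \<and> norm (of_nat q * z j - w j) < 1)"
    using O_approximation[where 'm = unit, of 1] by auto
  show ?thesis
  proof (intro exI[of _ "fact Q"] conjI allI impI)
    fix I assume I: "idl I"
    define P where "P = (\<lambda>m::nat. \<exists>x\<in>I. x \<noteq> 0 \<and> (norm x)\<^sup>2 = real m)"
    have IO: "x \<in> I \<Longrightarrow> x \<in> OK" for x using ideal_O[OF I] by blast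
    have "\<exists>m. P m" unfolding P_def using ideal_nonzero_elem[OF I] O_norm IO by metis
    then obtain k where k: "P k" "\<And>j. P j \<Longrightarrow> k \<le> j" by (metis LeastI Least_le)
    then obtain \<beta> where b: "\<beta> \<in> I" "\<beta> \<noteq> 0" "(norm \<beta>)\<^sup>2 = real k" unfolding P_def by blast
    have min: "x = 0" if xI: "x \<in> I" and xb: "norm x < norm \<beta>" for x
    proof (rule ccontr)
      assume "x \<noteq> 0"
      obtain j where j: "(norm x)\<^sup>2 = real j" using O_norm[OF IO[OF xI]] by metis
      then have "k \<le> j" using k(2) xI \<open>x \<noteq> 0\<close> unfolding P_def by blast
      then have "(norm \<beta>)\<^sup>2 \<le> (norm x)\<^sup>2" using j b by simp
      then show False using xb by (simp add: power2_le_iff_abs_le)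
    qed
    \<comment> \<open>The denominator q depends on \<alpha>, but \<open>fact Q\<close> is a multiple
      of every positive q <= Q.\<close>
    have div: "of_nat (fact Q) / \<beta> * \<alpha> \<in> OK" if "\<alpha> \<in> I" for \<alpha>
    proof -
      obtain q w where qw: "0 < q" "q \<le> Q" "w \<in> OK" "norm (of_nat q * (\<alpha> / \<beta>) - w) < 1"
        using Q[of "\<lambda>_. \<alpha> / \<beta>"] by auto
      have "of_nat q * \<alpha> - w * \<beta> \<in> I"
        using that b qw by (intro ideal_diff[OF I] ideal_mult[OF I]) auto
      moreover have "of_nat q * \<alpha> - w * \<beta> = (of_nat q * (\<alpha> / \<beta>) - w) * \<beta>"
        using b by (simp add: field_simps)
      then have "norm (of_nat q * \<alpha> - w * \<beta>) < norm \<beta>" using qw b by (simp add: norm_mult)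
      ultimately have "of_nat q * \<alpha> = w * \<beta>" using min by force
      then have "of_nat q / \<beta> * \<alpha> = w" using b by (simp add: field_simps)
      moreover obtain c where "fact Q = q * c" using qw dvd_fact[of q Q] by (auto elim: dvdE)
      ultimately have "of_nat (fact Q) / \<beta> * \<alpha> = of_nat c * w" by (auto simp: field_simps)
      then show ?thesis using O_mult[OF O_of_nat qw(3)] by metis
    qed
    show "\<exists>\<kappa>\<in>K. \<kappa> \<noteq> 0 \<and> (*) \<kappa> ` I \<subseteq> OK \<and> of_nat (fact Q) \<in> (*) \<kappa> ` I"
    proof (intro bexI conjI)
      show "of_nat (fact Q) / \<beta> \<in> K" using b IO O_K by (intro K_divide K_of_nat) auto
      show "of_nat (fact Q) / \<beta> \<noteq> 0" using b by simp
      show "(*) (of_nat (fact Q) / \<beta>) ` I \<subseteq> OK" using div by blast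
      show "of_nat (fact Q) \<in> (*) (of_nat (fact Q) / \<beta>) ` I"
        by (rule image_eqI[of _ _ \<beta>]) (use b in auto)
    qed
  qed auto
qed

end


section \<open>Hermitian forms\<close>

lemma complex_inner_cnj: "inner a b = Re (a * cnj b)" for a b :: complex
  by (simp add: inner_complex_def)

text \<open>A[x] is real linear in A and is the Euclidean inner product with x^* x. Expressed this
  way, orthogonality and convexity in the Euclidean space of matrices apply directly to form
  values.\<close>

lemma form_value_inner: "form_value A x = A \<bullet> rank_one x"
proof -
  have "A \<bullet> rank_one x = (\<Sum>i\<in>UNIV. \<Sum>j\<in>UNIV. Re (A $ i $ j * x $ i * cnj (x $ j)))"
    by (simp add: inner_vec_def rank_one_def complex_inner_cnj mult.assoc)
  also have "\<dots> = (\<Sum>j\<in>UNIV. \<Sum>i\<in>UNIV. Re (A $ i $ j * x $ i * cnj (x $ j)))" by (rule sum.swap)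
  also have "\<dots> = Re (\<Sum>j\<in>UNIV. (\<Sum>i\<in>UNIV. A $ i $ j * x $ i) * cnj (x $ j))"
    by (simp only: Re_sum sum_distrib_right)
  also have "\<dots> = form_value A x" by (simp add: form_value_def vector_matrix_mult_def mult.commute)
  finally show ?thesis by simp
qed

abbreviation fval :: "complex^'n^'n \<Rightarrow> complex^'n \<Rightarrow> real" where
  "fval A x \<equiv> A \<bullet> rank_one x"

lemma trace_product_inner:
  assumes "B \<in> hermitian_matrices"
  shows "trace_product A B = A \<bullet> B"
proof -
  have "cnj (B $ i $ j) = B $ j $ i" for i j
    using assms by (simp add: hermitian_matrices_def conj_transpose_def vec_eq_iff)
  then show ?thesis
    by (simp add: trace_product_def trace_def matrix_matrix_mult_def inner_vec_def complex_inner_cnj)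
qed

lemma hermitian_component: "A \<in> hermitian_matrices \<Longrightarrow> cnj (A $ i $ j) = A $ j $ i"
  by (simp add: hermitian_matrices_def conj_transpose_def vec_eq_iff)

lemma subspace_hermitian: "subspace hermitian_matrices"
  by (auto simp: subspace_def hermitian_matrices_def conj_transpose_def vec_eq_iff)

lemma hermitian_add_scaleR:
  "A \<in> hermitian_matrices \<Longrightarrow> R \<in> hermitian_matrices \<Longrightarrow> A + t *\<^sub>R R \<in> hermitian_matrices"
  by (simp add: subspace_add[OF subspace_hermitian] subspace_scale[OF subspace_hermitian])

lemma span_hermitian [simp]: "span hermitian_matrices = hermitian_matrices"
  using subspace_hermitian by (simp add: span_eq_iff)

lemma rank_one_hermitian: "rank_one x \<in> hermitian_matrices"
  by (simp add: hermitian_matrices_def conj_transpose_def rank_one_def vec_eq_iff mult.commute)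

lemma rank_one_0 [simp]: "rank_one 0 = 0" by (simp add: rank_one_def vec_eq_iff)

lemma rank_one_minus [simp]: "rank_one (- x) = rank_one x" by (simp add: rank_one_def vec_eq_iff)

lemma rank_one_smult: "rank_one (c *s x) = (norm c)\<^sup>2 *\<^sub>R rank_one x"
  by (simp add: rank_one_def vec_eq_iff scaleR_conv_of_real[where 'a = complex] complex_norm_square
      algebra_simps del: of_real_power)

lemma rank_one_scaleR: "rank_one (r *\<^sub>R x) = r\<^sup>2 *\<^sub>R rank_one x"
  by (simp add: rank_one_def vec_eq_iff scaleR_conv_of_real[where 'a = complex] power2_eq_square algebra_simps)

lemma rank_one_parallelogram:
  "rank_one (x + y) + rank_one (x - y) = 2 *\<^sub>R rank_one x + 2 *\<^sub>R rank_one y"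
  by (simp add: rank_one_def vec_eq_iff scaleR_conv_of_real algebra_simps)

lemma norm_rank_one: "norm (rank_one x) = (norm x)\<^sup>2"
proof -
  have nx: "(norm x)\<^sup>2 = (\<Sum>i\<in>UNIV. (norm (x $ i))\<^sup>2)"
    by (simp add: norm_vec_def L2_set_def sum_nonneg)
  have "(norm (rank_one x))\<^sup>2 = (\<Sum>i\<in>UNIV. \<Sum>j\<in>UNIV. (norm (x $ i))\<^sup>2 * (norm (x $ j))\<^sup>2)"
    by (simp add: norm_vec_def L2_set_def sum_nonneg rank_one_def norm_mult power_mult_distrib)
  also have "\<dots> = ((norm x)\<^sup>2)\<^sup>2" by (simp add: nx power2_eq_square[of "sum _ _"] sum_product)
  finally show ?thesis by (rule power2_eq_imp_eq) simp_all
qed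

lemma continuous_on_rank_one [continuous_intros]:
  "continuous_on S f \<Longrightarrow> continuous_on S (\<lambda>x. rank_one (f x))"
  unfolding rank_one_def by (intro continuous_intros)

lemma positive_forms_hermitian: "A \<in> positive_forms \<Longrightarrow> A \<in> hermitian_matrices"
  by (simp add: positive_forms_def)

lemma positive_forms_iff:
  "A \<in> positive_forms \<longleftrightarrow> A \<in> hermitian_matrices \<and> (\<forall>x. x \<noteq> 0 \<longrightarrow> 0 < fval A x)"
  by (simp add: positive_forms_def form_value_inner)

lemma positive_forms_nonneg: "A \<in> positive_forms \<Longrightarrow> 0 \<le> fval A x"
  by (cases "x = 0") (auto simp: positive_forms_iff less_imp_le)

text \<open>The parallelogram law with the nonnegative term at x - y dropped.\<close>

lemma semidefinite_add_le:
  assumes "\<And>x. 0 \<le> fval A x"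
  shows "fval A (x + y) \<le> 2 * (fval A x) + 2 * (fval A y)"
proof -
  have "fval A (x + y) + fval A (x - y) = 2 * (fval A x) + 2 * (fval A y)"
    using arg_cong[OF rank_one_parallelogram[of x y], of "inner A"] by (simp add: inner_add_right)
  then show ?thesis using assms[of "x - y"] by linarith
qed

lemma semidefinite_sum_le:
  assumes "\<And>x. 0 \<le> fval A x" "finite S"
  shows "fval A (\<Sum>j\<in>S. y j) \<le> 2 ^ card S * (\<Sum>j\<in>S. fval A (y j))" using assms(2)
proof (induction S rule: finite_induct)
  case (insert s S)
  have "fval A (\<Sum>j\<in>insert s S. y j) \<le> 2 * (fval A (y s)) + 2 * (fval A (\<Sum>j\<in>S. y j))"
    using semidefinite_add_le[OF assms(1)] insert by simp
  also have "\<dots> \<le> 2 ^ card (insert s S) * (fval A (y s))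
      + 2 * (2 ^ card S * (\<Sum>j\<in>S. fval A (y j)))"
  proof (intro add_mono mult_left_mono mult_right_mono)
    show "(2::real) \<le> 2 ^ card (insert s S)"
      using power_increasing[of 1 "card (insert s S)" "2::real"] insert by simp
  qed (use insert assms(1) in auto)
  also have "\<dots> = 2 ^ card (insert s S) * (\<Sum>j\<in>insert s S. fval A (y j))"
    using insert by (simp add: algebra_simps)
  finally show ?case .
qed auto

lemma sum_sum_delta_inner:
  "(\<Sum>a\<in>UNIV. \<Sum>b\<in>UNIV. inner (F a b) (if a = i then (if b = j then c else 0) else 0))
     = inner (F i j) (c :: complex)" for i :: "'a::finite" and j :: "'b::finite"
proof -
  have "(\<Sum>b\<in>UNIV. inner (F a b) (if a = i then (if b = j then c else 0) else 0))
      = (if a = i then inner (F i j) c else 0)" for a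
  proof (cases "a = i")
    case True
    have "(\<Sum>b\<in>UNIV. inner (F i b) (if b = j then c else 0)) = (\<Sum>b\<in>UNIV. if b = j then inner (F i b) c else 0)"
      by (rule sum.cong) auto
    then show ?thesis using True by simp
  qed simp
  then show ?thesis by simp
qed

lemma hermitian_eq_0:
  assumes A: "A \<in> hermitian_matrices" and 0: "\<And>x. fval A x = 0"
  shows "A = 0"
proof -
  have "A $ i $ j = 0" for i j
  proof -
    define c where "c = A $ i $ j"
    \<comment> \<open>Polarization: R has only the entries c at (i, j) and its conjugate at (j, i),
      which add up when i = j. Taking c to be the entry of A itself makes the pairing 2
      |c|^2.\<close>
    define R where "R = rank_one (axis i 1 + axis j c) - rank_one (axis i 1) - rank_one (axis j c)"
    have R: "R $ a $ b = (if a = i then (if b = j then c else 0) else 0)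
        + (if a = j then (if b = i then cnj c else 0) else 0)" for a b
      by (simp add: R_def rank_one_def axis_def algebra_simps)
    have "A \<bullet> R = 0" by (simp add: R_def inner_diff_right 0)
    moreover have "A \<bullet> R = inner (A $ i $ j) c + inner (A $ j $ i) (cnj c)"
      by (simp only: inner_vec_def R inner_add_right sum.distrib sum_sum_delta_inner)
    moreover have "\<dots> = 2 * (norm c)\<^sup>2" using hermitian_component[OF A, of i j]
      by (simp add: c_def inner_complex_def cmod_power2 flip: \<open>cnj (A $ i $ j) = A $ j $ i\<close>)
        (simp add: power2_eq_square)
    ultimately show ?thesis by (simp add: c_def)
  qed
  then show ?thesis by (simp add: vec_eq_iff)
qed

lemma span_eq_hermitianI:
  assumes "S \<subseteq> hermitian_matrices"
    and "\<And>A. A \<in> hermitian_matrices \<Longrightarrow> (\<And>s. s \<in> S \<Longrightarrow> A \<bullet> s = 0) \<Longrightarrow> A = 0"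
  shows "span S = hermitian_matrices"
proof (rule ccontr)
  assume "span S \<noteq> hermitian_matrices"
  moreover have "span S \<subseteq> hermitian_matrices" using span_mono[OF assms(1)] by simp
  ultimately have "span S \<subset> span hermitian_matrices" by auto
  then obtain A where A: "A \<noteq> 0" "A \<in> hermitian_matrices" "\<And>y. y \<in> span S \<Longrightarrow> orthogonal A y"
    using orthogonal_to_subspace_exists_gen[of S hermitian_matrices] by auto
  then have "A \<bullet> s = 0" if "s \<in> S" for s using that span_base by (auto simp: orthogonal_def)
  then show False using assms(2) A by blast
qed

lemma span_rank_one: "span (range rank_one) = hermitian_matrices"
  by (rule span_eq_hermitianI) (auto simp: rank_one_hermitian intro: hermitian_eq_0)

lemma inner_span_eq_0:
  assumes "T \<in> span S" "\<And>s. s \<in> S \<Longrightarrow> R \<bullet> s = 0"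
  shows "R \<bullet> T = 0"
  using assms(1) by (induction rule: span_induct) (auto simp: subspace_def inner_add_right assms(2))

lemma orthogonal_span_eq_0: "A \<in> span S \<Longrightarrow> (\<And>s. s \<in> S \<Longrightarrow> A \<bullet> s = 0) \<Longrightarrow> A = 0"
  using inner_span_eq_0[of A S A] by simp

text \<open>f is injective on the span, because A \<bullet> f A is the sum of the squares of the
  pairings with S; an injective linear map on a finite-dimensional space is bounded below. This
  converts bounds on form values into bounds on forms.\<close>

lemma norm_le_sum_inner_on_span:
  fixes S :: "'a::euclidean_space set"
  assumes "finite S"
  shows "\<exists>c>0. \<forall>A\<in>span S. norm A \<le> c * (\<Sum>s\<in>S. \<bar>A \<bullet> s\<bar>)"
proof -
  define f where "f A = (\<Sum>s\<in>S. (A \<bullet> s) *\<^sub>R s)" for A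
  have lin: "bounded_linear f"
    unfolding f_def by (intro bounded_linear_sum bounded_linear_scaleR_left[THEN bounded_linear_compose] bounded_linear_inner_left)
  have "A = 0" if "A \<in> span S" "f A = 0" for A
  proof (rule orthogonal_span_eq_0[OF that(1)])
    have "(\<Sum>s\<in>S. (A \<bullet> s)\<^sup>2) = A \<bullet> f A" by (simp add: f_def inner_sum_right power2_eq_square)
    then show "A \<bullet> s = 0" if "s \<in> S" for s
      using \<open>f A = 0\<close> that assms by (simp add: sum_nonneg_eq_0_iff)
  qed
  then obtain e where e: "e > 0" "\<forall>A\<in>span S. e * norm A \<le> norm (f A)"
    using injective_imp_isometric[OF closed_span[of S] subspace_span lin] by (auto simp: mult.commute)
  define b where "b = 1 + (\<Sum>s\<in>S. norm s)"
  have b: "b > 0" "\<And>s. s \<in> S \<Longrightarrow> norm s \<le> b"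
    using assms by (auto simp: b_def add_pos_nonneg sum_nonneg intro!: add_increasing member_le_sum)
  have "norm A \<le> b / e * (\<Sum>s\<in>S. \<bar>A \<bullet> s\<bar>)" if "A \<in> span S" for A
  proof -
    have "norm (f A) \<le> (\<Sum>s\<in>S. \<bar>A \<bullet> s\<bar> * b)"
      unfolding f_def using b(2) by (intro sum_norm_le) (simp add: mult_left_mono)
    then have "e * norm A \<le> b * (\<Sum>s\<in>S. \<bar>A \<bullet> s\<bar>)"
      using e(2) that by (fastforce simp: sum_distrib_left mult.commute)
    then show ?thesis using e(1) by (simp add: field_simps)
  qed
  then show ?thesis using e(1) b(1) by (intro exI[of _ "b / e"]) auto
qed

text \<open>A continuous positive function attains its minimum on the compact product of C with the
  unit sphere; homogeneity extends the bound to all x.\<close>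

lemma compact_positive_forms_bound:
  fixes C :: "(complex^'n^'n) set"
  assumes "compact C" "C \<subseteq> positive_forms"
  shows "\<exists>c>0. \<forall>A\<in>C. \<forall>x. c * (norm x)\<^sup>2 \<le> fval A x"
proof (cases "C = {}")
  case False
  define S where "S = C \<times> sphere (0 :: complex^'n) 1"
  let ?f = "\<lambda>p. fst p \<bullet> rank_one (snd p)"
  have "axis undefined 1 \<in> sphere (0 :: complex^'n) 1" by simp
  then have "S \<noteq> {}" using False by (auto simp: S_def simp del: mem_sphere_0)
  moreover have "compact S" unfolding S_def using assms by (intro compact_Times) auto
  moreover have "continuous_on S ?f" by (intro continuous_intros)
  ultimately obtain p where p: "p \<in> S" "\<And>q. q \<in> S \<Longrightarrow> ?f p \<le> ?f q"
    using continuous_attains_inf[of S ?f] by blast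
  have "snd p \<noteq> 0" using p(1) by (auto simp: S_def)
  then have pos: "?f p > 0" using p(1) assms(2) by (auto simp: S_def positive_forms_iff)
  have "?f p * (norm x)\<^sup>2 \<le> fval A x" if "A \<in> C" for A and x :: "complex^'n"
  proof (cases "x = 0")
    case False
    let ?u = "x /\<^sub>R norm x"
    have "(A, ?u) \<in> S" using that False by (simp add: S_def)
    then have "?f p \<le> fval A ?u" using p(2)[of "(A, ?u)"] by simp
    also have "\<dots> = (fval A x) / (norm x)\<^sup>2"
      by (simp add: rank_one_scaleR divide_inverse power_inverse mult.commute)
    finally show ?thesis using False by (simp add: field_simps)
  qed simp
  then show ?thesis using pos by blast
qed (auto intro: exI[of _ 1])


section \<open>The lattice and discreteness of the normalized rank one forms\<close>

locale steinitz = imaginary_quadratic K for K +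
  fixes \<aa> :: "complex set" and l :: "'n::finite"
  assumes ideal_\<aa>: "nonzero_ideal K \<aa>"
begin

abbreviation "L \<equiv> steinitz_lattice K \<aa> l"

abbreviation "L0 \<equiv> steinitz_lattice K \<aa> l - {0}"

abbreviation "vid \<equiv> vector_ideal K \<aa> l"

text \<open>The dual of \<open>L\<close> for the bilinear pairing with values in O_K; the ideal of x
  consists of the pairings of x with it.\<close>

definition dual_lattice :: "('n \<Rightarrow> complex) set" where
  "dual_lattice = {y. \<forall>j. y j \<in> (if j = l then ideal_inverse K \<aa> else OK)}"

text \<open>\<open>vnorm x\<close> is \<open>N(\<aa>\<^sub>x)\<close> only if \<open>\<aa>\<^sub>x\<close> is integral, in particular for \<open>x \<in> L\<close>.\<close>

definition vnorm :: "complex^'n \<Rightarrow> real" where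
  "vnorm x = real (idx (vid x))"

text \<open>Unlike \<open>rank_one x\<close>, this is the same for all nonzero lattice vectors on
  one line over \<open>K\<close>, and its pairing with A is the normalized value.\<close>

definition nrank_one :: "complex^'n \<Rightarrow> complex^'n^'n" where
  "nrank_one x = rank_one x /\<^sub>R vnorm x"

lemma \<aa>_O: "z \<in> \<aa> \<Longrightarrow> z \<in> OK" using ideal_O[OF ideal_\<aa>] by blast

lemma L_iff: "x \<in> L \<longleftrightarrow> x $ l \<in> \<aa> \<and> (\<forall>j. j \<noteq> l \<longrightarrow> x $ j \<in> OK)" by (auto simp: steinitz_lattice_def)

lemma dual_lattice_iff:
  "y \<in> dual_lattice \<longleftrightarrow> y l \<in> ideal_inverse K \<aa> \<and> (\<forall>j. j \<noteq> l \<longrightarrow> y j \<in> OK)"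
  by (auto simp: dual_lattice_def)

lemma L_O: "x \<in> L \<Longrightarrow> x $ j \<in> OK" using \<aa>_O[of "x $ j"] by (cases "j = l") (auto simp: L_iff)

lemma L_add: "x \<in> L \<Longrightarrow> y \<in> L \<Longrightarrow> x + y \<in> L" using ideal_add[OF ideal_\<aa>] O_add by (simp add: L_iff)

lemma L_smult: "r \<in> OK \<Longrightarrow> x \<in> L \<Longrightarrow> r *s x \<in> L"
  using ideal_mult[OF ideal_\<aa>] O_mult by (simp add: L_iff)

lemma L_0: "0 \<in> L" using ideal_0[OF ideal_\<aa>] by (simp add: L_iff)

lemma L_diff: "x \<in> L \<Longrightarrow> y \<in> L \<Longrightarrow> x - y \<in> L" using ideal_diff[OF ideal_\<aa>] O_diff by (simp add: L_iff)

lemma L_sum: "(\<And>i. i \<in> S \<Longrightarrow> f i \<in> L) \<Longrightarrow> sum f S \<in> L"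
  by (induction S rule: infinite_finite_induct) (auto intro: L_0 L_add)

text \<open>With an integer g in the ideal, g O_K^n lies in \<open>L\<close>; approximation over O_K
  is carried over to \<open>L\<close> through this sublattice.\<close>

lemma \<aa>_integer:
  obtains g :: nat where "g > 0" "of_nat g \<in> \<aa>"
proof -
  obtain \<beta> where b: "\<beta> \<in> \<aa>" "\<beta> \<noteq> 0" using ideal_nonzero_elem[OF ideal_\<aa>] by blast
  obtain m :: nat where m: "of_nat m = \<beta> * cnj \<beta>" using O_norm[OF \<aa>_O[OF b(1)]] by blast
  have "cnj \<beta> * \<beta> \<in> \<aa>" using ideal_mult[OF ideal_\<aa> O_cnj[OF \<aa>_O[OF b(1)]] b(1)] .
  then have "of_nat m \<in> \<aa>" using m by (simp add: mult.commute)
  moreover have "m > 0" using m b by (metis complex_cnj_zero_iff gr0I mult_eq_0_iff of_nat_0)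
  ultimately show thesis using that by blast
qed

lemma L_integer_multiple:
  assumes "of_nat g \<in> \<aa>" "\<And>j. w j \<in> OK"
  shows "(\<chi> j. of_nat g * w j) \<in> L"
proof -
  have "of_nat g * w j \<in> \<aa>" "of_nat g * w j \<in> OK" for j
    using ideal_mult[OF ideal_\<aa> assms(2) assms(1), of j] O_mult[OF O_of_nat assms(2), of g j]
    by (simp_all add: mult.commute)
  then show ?thesis by (simp add: L_iff)
qed

lemma inverse_1: "1 \<in> ideal_inverse K \<aa>" using \<aa>_O K_1 by (auto simp: ideal_inverse_def)

lemma dual_lattice_pairing:
  assumes "x \<in> L" "y \<in> dual_lattice"
  shows "(\<Sum>j\<in>UNIV. x $ j * y j) \<in> OK"
proof (rule O_sum)
  fix j
  have x: "x $ l \<in> \<aa>" "j \<noteq> l \<Longrightarrow> x $ j \<in> OK" and y: "y l \<in> ideal_inverse K \<aa>" "j \<noteq> l \<Longrightarrow> y j \<in> OK"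
    using assms unfolding L_iff dual_lattice_iff by blast+
  show "x $ j * y j \<in> OK"
  proof (cases "j = l")
    case True
    then have "y j * x $ j \<in> OK" using x y by (auto simp: ideal_inverse_def)
    then show ?thesis by (simp add: mult.commute)
  next
    case False
    then show ?thesis using x y O_mult by simp
  qed
qed

lemma dual_lattice_add: "y \<in> dual_lattice \<Longrightarrow> z \<in> dual_lattice \<Longrightarrow> (\<lambda>j. y j + z j) \<in> dual_lattice"
  using O_add K_add by (simp add: dual_lattice_iff ideal_inverse_def image_subset_iff distrib_right)

lemma dual_lattice_mult:
  assumes "r \<in> OK" "y \<in> dual_lattice"
  shows "(\<lambda>j. r * y j) \<in> dual_lattice"
proof -
  have "r * z \<in> ideal_inverse K \<aa>" if "z \<in> ideal_inverse K \<aa>" for z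
    using that O_mult[OF assms(1)] K_mult[OF O_K[OF assms(1)]]
    by (auto simp: ideal_inverse_def image_subset_iff mult.assoc)
  then show ?thesis using assms O_mult by (simp add: dual_lattice_iff)
qed

lemma vector_ideal_eq: "vid x = {(\<Sum>j\<in>UNIV. x $ j * y j) | y. y \<in> dual_lattice}"
  by (simp add: vector_ideal_def dual_lattice_def)

lemma vector_idealI: "y \<in> dual_lattice \<Longrightarrow> (\<Sum>j\<in>UNIV. x $ j * y j) \<in> vid x"
  unfolding vector_ideal_eq by blast

lemma vector_ideal_component: "x $ j \<in> vid x"
proof -
  have "(\<lambda>i. if i = j then 1 else 0) \<in> dual_lattice"
    using inverse_1 K_0 by (auto simp: dual_lattice_iff ideal_inverse_def)
  moreover have "x $ j = (\<Sum>i\<in>UNIV. x $ i * (if i = j then 1 else 0))"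
    by (simp add: if_distrib cong: if_cong)
  ultimately show ?thesis using vector_idealI[of "\<lambda>i. if i = j then 1 else 0" x] by simp
qed

lemma ideal_vector_ideal:
  assumes "x \<in> L0"
  shows "idl (vid x)" unfolding nonzero_ideal_def
proof (intro conjI ballI)
  show "vid x \<subseteq> OK" using assms dual_lattice_pairing by (auto simp: vector_ideal_eq)
  have "(\<lambda>j. 0) \<in> dual_lattice" by (auto simp: dual_lattice_iff ideal_inverse_def K_0)
  then have "(\<Sum>j\<in>UNIV. x $ j * 0) \<in> vid x" by (rule vector_idealI)
  then show "0 \<in> vid x" by simp
  obtain j where "x $ j \<noteq> 0" using assms by (auto simp: vec_eq_iff)
  then show "vid x \<noteq> {0}" using vector_ideal_component[of x j] by auto
next
  fix u v assume "u \<in> vid x" "v \<in> vid x"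
  then obtain y z where y: "y \<in> dual_lattice" "u = (\<Sum>j\<in>UNIV. x $ j * y j)"
    and z: "z \<in> dual_lattice" "v = (\<Sum>j\<in>UNIV. x $ j * z j)" unfolding vector_ideal_eq by blast
  have "u + v = (\<Sum>j\<in>UNIV. x $ j * (y j + z j))" by (simp add: y z sum.distrib distrib_left)
  then show "u + v \<in> vid x" using vector_idealI[OF dual_lattice_add[OF y(1) z(1)]] by simp
next
  fix r u assume r: "r \<in> OK" and "u \<in> vid x"
  then obtain y where y: "y \<in> dual_lattice" "u = (\<Sum>j\<in>UNIV. x $ j * y j)"
    unfolding vector_ideal_eq by blast
  have "r * u = (\<Sum>j\<in>UNIV. x $ j * (r * y j))" by (simp add: y sum_distrib_left mult.left_commute)
  then show "r * u \<in> vid x" using vector_idealI[OF dual_lattice_mult[OF r y(1)]] by simp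
qed

lemma vector_ideal_smult: "vid (\<kappa> *s x) = (*) \<kappa> ` vid x"
proof -
  have "(\<Sum>j\<in>UNIV. (\<kappa> *s x) $ j * y j) = \<kappa> * (\<Sum>j\<in>UNIV. x $ j * y j)" for y
    by (simp add: sum_distrib_left mult.assoc)
  then show ?thesis unfolding vector_ideal_eq by auto
qed

lemma vnorm_ge_1: "x \<in> L0 \<Longrightarrow> 1 \<le> vnorm x"
  using ideal_index_pos[OF ideal_vector_ideal] by (simp add: vnorm_def Suc_leI)

lemma vnorm_smult:
  assumes "x \<in> L0" "\<kappa> \<in> K" "\<kappa> \<noteq> 0" "\<kappa> *s x \<in> L0"
  shows "vnorm (\<kappa> *s x) = (norm \<kappa>)\<^sup>2 * vnorm x" unfolding vnorm_def vector_ideal_smult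
  by (rule ideal_index_scale) (use assms ideal_vector_ideal vector_ideal_smult in metis)+

lemma nrank_one_smult:
  assumes "x \<in> L0" "\<kappa> \<in> K" "\<kappa> \<noteq> 0" "\<kappa> *s x \<in> L0"
  shows "nrank_one (\<kappa> *s x) = nrank_one x"
  using assms by (simp add: nrank_one_def vnorm_smult rank_one_smult)

abbreviation "nval A x \<equiv> A \<bullet> nrank_one x"

lemma inner_nrank_one: "nval A x = (fval A x) / vnorm x"
  by (simp add: nrank_one_def divide_inverse mult.commute)

lemma rank_one_nrank_one: "x \<in> L0 \<Longrightarrow> rank_one x = vnorm x *\<^sub>R nrank_one x"
  using vnorm_ge_1[of x] by (simp add: nrank_one_def)

lemma norm_nrank_one: "x \<in> L0 \<Longrightarrow> norm (nrank_one x) = (norm x)\<^sup>2 / vnorm x"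
  using vnorm_ge_1[of x] by (simp add: nrank_one_def norm_rank_one divide_inverse mult.commute)

lemma normalized_value_eq: "x \<in> L0 \<Longrightarrow> normalized_value K \<aa> l A x = nval A x"
  by (simp add: normalized_value_def form_value_inner inner_nrank_one vnorm_def
      ideal_norm_integral ideal_vector_ideal)

text \<open>The class bound scales the ideal of x to an integral ideal containing M; a further
  factor g brings the vector back into \<open>L\<close>. Its ideal then contains g M and so has norm
  at most (g M)^2.\<close>

lemma bounded_vnorm_representative:
  "\<exists>C>0. \<forall>x\<in>L0. \<exists>\<kappa>\<in>K. \<kappa> \<noteq> 0 \<and> \<kappa> *s x \<in> L0 \<and> vnorm (\<kappa> *s x) \<le> C"
proof -
  obtain g :: nat where g: "g > 0" "of_nat g \<in> \<aa>" using \<aa>_integer .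
  obtain M :: nat where M: "M > 0" "\<And>I. idl I \<Longrightarrow> \<exists>\<kappa>\<in>K. \<kappa> \<noteq> 0 \<and> (*) \<kappa> ` I \<subseteq> OK \<and> of_nat M \<in> (*) \<kappa> ` I"
    using ideal_class_bound by metis
  show ?thesis
  proof (intro exI[of _ "(real (g * M))\<^sup>2"] conjI ballI)
    show "(real (g * M))\<^sup>2 > 0" using g M by simp
    fix x assume x: "x \<in> L0"
    obtain \<kappa> where k: "\<kappa> \<in> K" "\<kappa> \<noteq> 0" "(*) \<kappa> ` vid x \<subseteq> OK"
      "of_nat M \<in> (*) \<kappa> ` vid x" using M(2)[OF ideal_vector_ideal[OF x]] by blast
    define \<mu> where "\<mu> = of_nat g * \<kappa>"
    have l0: "\<mu> \<in> K" "\<mu> \<noteq> 0" using k g by (auto simp: \<mu>_def K_mult K_of_nat)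
    have "\<kappa> * x $ j \<in> OK" for j using k(3) vector_ideal_component[of x j] by blast
    then have "(\<chi> j. of_nat g * (\<kappa> * x $ j)) \<in> L" by (rule L_integer_multiple[OF g(2)])
    moreover have "\<mu> *s x = (\<chi> j. of_nat g * (\<kappa> * x $ j))"
      by (simp add: vec_eq_iff \<mu>_def mult.assoc)
    ultimately have "\<mu> *s x \<in> L" by simp
    moreover have "\<mu> *s x \<noteq> 0" using l0(2) x by simp
    ultimately have L: "\<mu> *s x \<in> L0" by simp
    obtain z where z: "z \<in> vid x" "of_nat M = \<kappa> * z" using k(4) by blast
    have "of_nat (g * M) = \<mu> * z" using z by (simp add: \<mu>_def mult.assoc)
    then have "of_nat (g * M) \<in> vid (\<mu> *s x)" using z unfolding vector_ideal_smult by blast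
    moreover have "complex_of_nat (g * M) \<noteq> 0" using g M by simp
    ultimately have "vnorm (\<mu> *s x) \<le> (norm (complex_of_nat (g * M)))\<^sup>2"
      unfolding vnorm_def using ideal_index_le(2)[OF ideal_vector_ideal[OF L]] by blast
    then show "\<exists>\<kappa>\<in>K. \<kappa> \<noteq> 0 \<and> \<kappa> *s x \<in> L0 \<and> vnorm (\<kappa> *s x) \<le> (real (g * M))\<^sup>2"
      using l0 L by (intro bexI[of _ \<mu>]) (simp_all only: norm_of_nat simp_thms)
  qed
qed

section \<open>Finiteness of lattice points and normalized matrices in balls\<close>

lemma finite_O_ball: "finite {z \<in> OK. norm z \<le> b}"
proof -
  obtain \<omega> where w: "\<omega> \<in> OK" "Im \<omega> > 0" "\<And>x. x \<in> OK \<longleftrightarrow> (\<exists>a b. x = of_int a + of_int b * \<omega>)"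
    using O_basis by blast
  define B where "B = b / Im \<omega>"
  define A where "A = b + B * norm \<omega>"
  let ?Z = "\<lambda>r. {- \<lceil>r\<rceil>..\<lceil>r\<rceil>}"
  have "{z \<in> OK. norm z \<le> b} \<subseteq> (\<lambda>(p, q). of_int p + of_int q * \<omega>) ` (?Z A \<times> ?Z B)"
  proof
    fix z assume z: "z \<in> {z \<in> OK. norm z \<le> b}"
    then obtain p q where pq: "z = of_int p + of_int q * \<omega>" using w(3) by blast
    have "\<bar>Im z\<bar> \<le> b" using z abs_Im_le_cmod[of z] by simp
    then have "\<bar>of_int q\<bar> * Im \<omega> \<le> b" using w(2) by (simp add: pq abs_mult)
    then have q: "\<bar>of_int q\<bar> \<le> B" using w(2) by (simp add: B_def pos_le_divide_eq)
    have "norm (z - of_int q * \<omega>) \<le> norm z + norm (of_int q * \<omega>)" by (rule norm_triangle_ineq4)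
    also have "\<dots> \<le> b + B * norm \<omega>" using z q by (intro add_mono) (auto simp: norm_mult intro!: mult_right_mono)
    finally have p: "\<bar>of_int p\<bar> \<le> A" by (simp add: pq A_def)
    have int: "k \<in> ?Z r" if "\<bar>of_int k\<bar> \<le> r" for k :: int and r :: real
      using that by (simp add: abs_le_iff) linarith
    show "z \<in> (\<lambda>(p, q). of_int p + of_int q * \<omega>) ` (?Z A \<times> ?Z B)"
      using int[OF p] int[OF q] pq by (intro image_eqI[of _ _ "(p, q)"]) auto
  qed
  then show ?thesis by (rule finite_subset) auto
qed

lemma finite_L_ball: "finite {x \<in> L. norm x \<le> b}"
proof (rule finite_subset)
  let ?S = "{z \<in> OK. norm z \<le> b}"
  show "{x \<in> L. norm x \<le> b} \<subseteq> (\<lambda>f. \<chi> j. f j) ` (UNIV \<rightarrow>\<^sub>E ?S)"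
  proof
    fix x assume "x \<in> {x \<in> L. norm x \<le> b}"
    then have "x $ j \<in> ?S" for j
      using L_O[of x j] order_trans[OF Finite_Cartesian_Product.norm_nth_le[of x j]] by simp
    then show "x \<in> (\<lambda>f. \<chi> j. f j) ` (UNIV \<rightarrow>\<^sub>E ?S)" by (intro image_eqI[of _ _ "\<lambda>j. x $ j"]) auto
  qed
  show "finite ((\<lambda>f. \<chi> j. f j) ` (UNIV \<rightarrow>\<^sub>E ?S))"
    by (intro finite_imageI finite_PiE) (use finite_O_ball in auto)
qed

text \<open>For a representative y with N(\<aa>_y) <= C, a bound on the normalized matrix d bounds
  |y|^2 = |d| N(\<aa>_y).\<close>

lemma finite_nrank_one_ball: "finite {d \<in> nrank_one ` L0. norm d \<le> b}"
proof -
  obtain C where C: "C > 0" "\<And>x. x \<in> L0 \<Longrightarrow> \<exists>\<kappa>\<in>K. \<kappa> \<noteq> 0 \<and> \<kappa> *s x \<in> L0 \<and> vnorm (\<kappa> *s x) \<le> C"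
    using bounded_vnorm_representative by blast
  have "{d \<in> nrank_one ` L0. norm d \<le> b} \<subseteq> nrank_one ` {x \<in> L. norm x \<le> sqrt (b * C)}"
  proof
    fix d assume "d \<in> {d \<in> nrank_one ` L0. norm d \<le> b}"
    then obtain x where x: "x \<in> L0" "d = nrank_one x" "norm d \<le> b" by blast
    obtain \<kappa> where k: "\<kappa> \<in> K" "\<kappa> \<noteq> 0" "\<kappa> *s x \<in> L0" "vnorm (\<kappa> *s x) \<le> C" using C(2)[OF x(1)] by blast
    let ?y = "\<kappa> *s x"
    have d: "d = nrank_one ?y" using nrank_one_smult[OF x(1) k(1-3)] x by simp
    have v: "1 \<le> vnorm ?y" using vnorm_ge_1[OF k(3)] .
    have "norm d = (norm ?y)\<^sup>2 / vnorm ?y" unfolding d by (rule norm_nrank_one[OF k(3)])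
    then have "(norm ?y)\<^sup>2 \<le> b * vnorm ?y" using x(3) v by (simp add: divide_le_eq)
    also have "\<dots> \<le> b * C" using k(4) x(3) norm_ge_zero[of d] by (intro mult_left_mono) linarith+
    finally have "norm ?y \<le> sqrt (b * C)" by (simp add: real_le_rsqrt)
    then show "d \<in> nrank_one ` {x \<in> L. norm x \<le> sqrt (b * C)}" using d k(3) by blast
  qed
  then show ?thesis by (rule finite_subset) (use finite_L_ball in blast)
qed

section \<open>Approximation by lattice points and positivity\<close>

lemma of_nat_smult: "of_nat q *s v = real q *\<^sub>R v" for v :: "complex^'m"
  by (simp add: vec_eq_iff scaleR_conv_of_real[where 'a = complex])

lemma L_approximation:
  fixes v :: "complex^'n"
  assumes "\<epsilon> > 0"
  obtains q :: nat and x where "q > 0" "x \<in> L" "norm (of_nat q *s v - x) < \<epsilon>"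
proof -
  obtain g :: nat where g: "g > 0" "of_nat g \<in> \<aa>" using \<aa>_integer .
  \<comment> \<open>v / g is approximated; multiplying back by g and summing over the n coordinates
    brings the error below g n \<delta> = \<epsilon>.\<close>
  define \<delta> where "\<delta> = \<epsilon> / (real g * real CARD('n))"
  have d: "\<delta> > 0" using assms g by (simp add: \<delta>_def)
  obtain q w where qw: "0 < q" "\<And>j. w j \<in> OK" "\<And>j. norm (of_nat q * (v $ j / of_nat g) - w j) < \<delta>"
    using O_approximation[where 'm = 'n, OF d] by (elim exE allE[of _ "\<lambda>j. v $ j / of_nat g"]) blast
  define x where "x = (\<chi> j. of_nat g * w j)"
  have "x \<in> L" unfolding x_def by (rule L_integer_multiple[OF g(2) qw(2)])
  moreover have "norm (of_nat q *s v - x) < \<epsilon>"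
  proof -
    have "norm ((of_nat q *s v - x) $ j) < real g * \<delta>" for j
    proof -
      have "(of_nat q *s v - x) $ j = of_nat g * (of_nat q * (v $ j / of_nat g) - w j)"
        using g by (simp add: x_def field_simps)
      then show ?thesis using qw(3)[of j] g by (simp add: norm_mult)
    qed
    then have "(\<Sum>j\<in>UNIV. norm ((of_nat q *s v - x) $ j)) < (\<Sum>j\<in>(UNIV :: 'n set). real g * \<delta>)"
      by (intro sum_strict_mono) auto
    moreover have "norm (of_nat q *s v - x) \<le> (\<Sum>j\<in>UNIV. norm ((of_nat q *s v - x) $ j))"
      unfolding norm_vec_def by (rule L2_set_le_sum) simp
    moreover have "(\<Sum>j\<in>(UNIV :: 'n set). real g * \<delta>) = \<epsilon>" using g by (simp add: \<delta>_def)
    ultimately show ?thesis by linarith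
  qed
  ultimately show thesis using that qw(1) by blast
qed

text \<open>A negative value at v persists on a ball around v. If x is a lattice point within
  \<epsilon> of q v, then x / q lies in that ball, and x takes a negative value as well.\<close>

lemma semidefinite_if_nonneg_on_L:
  assumes "\<And>x. x \<in> L0 \<Longrightarrow> 0 \<le> fval A x"
  shows "0 \<le> fval A v"
proof (rule ccontr)
  assume neg: "\<not> 0 \<le> fval A v"
  have "continuous_on UNIV (\<lambda>x. fval A x)" by (intro continuous_intros)
  then have "open {x. fval A x < 0}" by (intro open_Collect_less continuous_intros)
  then obtain \<epsilon> where e: "\<epsilon> > 0" "ball v \<epsilon> \<subseteq> {x. fval A x < 0}"
    using neg by (metis linorder_not_le mem_Collect_eq openE)
  obtain q :: nat and x where q: "q > 0" "x \<in> L" "norm (of_nat q *s v - x) < \<epsilon>"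
    using L_approximation[OF e(1)] by blast
  define w where "w = x /\<^sub>R real q"
  have x: "x = real q *\<^sub>R w" using q(1) by (simp add: w_def)
  have "norm (of_nat q *s v - x) = real q * norm (v - w)"
    unfolding x of_nat_smult by (simp flip: scaleR_right_diff_distrib)
  moreover have "norm (v - w) \<le> real q * norm (v - w)"
    using q(1) mult_right_mono[of 1 "real q" "norm (v - w)"] by simp
  ultimately have "w \<in> ball v \<epsilon>" using q(3) by (simp add: dist_norm)
  then have "fval A w < 0" using e by blast
  then have "fval A x < 0" unfolding x rank_one_scaleR using q(1) by (simp add: mult_pos_neg)
  moreover from this have "x \<in> L0" using q(2) by auto
  ultimately show False using assms[of x] by linarith
qed

lemma hermitian_eq_0_if_zero_on_L:
  assumes "A \<in> hermitian_matrices" "\<And>x. x \<in> L0 \<Longrightarrow> fval A x = 0"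
  shows "A = 0"
proof (rule hermitian_eq_0[OF assms(1)])
  fix x
  show "fval A x = 0"
    using semidefinite_if_nonneg_on_L[of A x] semidefinite_if_nonneg_on_L[of "- A" x] assms(2) by simp
qed

text \<open>If a semidefinite form had a kernel vector \<open>v\<close>, it would take arbitrarily small values on
  the lattice points close to the multiples of \<open>v\<close>.\<close>

lemma positive_if_bounded_below_on_L:
  assumes A: "A \<in> hermitian_matrices" and m: "m > 0" "\<And>x. x \<in> L0 \<Longrightarrow> m \<le> nval A x"
  shows "A \<in> positive_forms"
proof -
  have val: "m \<le> fval A x" if "x \<in> L0" for x
  proof -
    have "m * 1 \<le> (nval A x) * vnorm x"
      using m that vnorm_ge_1[OF that] by (intro mult_mono) (auto intro: less_imp_le order_less_le_trans)
    then show ?thesis using vnorm_ge_1[OF that] by (simp add: inner_nrank_one)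
  qed
  have psd: "0 \<le> fval A v" for v using semidefinite_if_nonneg_on_L[of A v] val m(1) by fastforce
  have "fval A u \<noteq> 0" if "u \<noteq> 0" for u
  proof
    assume zero: "fval A u = 0"
    define v where "v = u /\<^sub>R norm u"
    have v: "norm v = 1" "fval A v = 0" using \<open>u \<noteq> 0\<close> zero by (auto simp: v_def rank_one_scaleR)
    \<comment> \<open>The bound 1 keeps x nonzero, since q v has length q >= 1, and gives
      \<epsilon>^2 <= \<epsilon>; the second bound brings the value at x below m.\<close>
    define \<epsilon> where "\<epsilon> = min 1 (m / (2 * (norm A + 1)))"
    have e: "\<epsilon> > 0" "\<epsilon> \<le> 1" "\<epsilon> \<le> m / (2 * (norm A + 1))" using m(1) by (auto simp: \<epsilon>_def add_nonneg_pos)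
    obtain q :: nat and x where q: "q > 0" "x \<in> L" "norm (of_nat q *s v - x) < \<epsilon>"
      using L_approximation[OF e(1)] by blast
    let ?e = "of_nat q *s v - x"
    have "x \<noteq> 0"
    proof
      assume "x = 0"
      then have "norm ?e = real q" using v by (simp add: of_nat_smult)
      then show False using q e by linarith
    qed
    then have x: "x \<in> L0" using q by simp
    have "fval A x = fval A (real q *\<^sub>R v + (- ?e))" by (simp add: of_nat_smult)
    also have "\<dots> \<le> 2 * (fval A (real q *\<^sub>R v)) + 2 * (fval A (- ?e))"
      by (rule semidefinite_add_le[OF psd])
    also have "\<dots> = 2 * (fval A ?e)" by (simp add: rank_one_scaleR v del: minus_diff_eq)
    also have "\<dots> \<le> 2 * (norm A * (norm ?e)\<^sup>2)"
      using norm_cauchy_schwarz[of A "rank_one ?e"] by (simp add: norm_rank_one)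
    also have "(norm ?e)\<^sup>2 \<le> \<epsilon>"
      using q(3) e(1,2) by (smt (verit) norm_ge_zero mult_left_le_one_le mult_right_le_one_le power2_eq_square)
    finally have "fval A x \<le> 2 * (norm A * \<epsilon>)" by (simp add: mult_left_mono)
    also have "\<dots> < 2 * ((norm A + 1) * \<epsilon>)" using e(1) by simp
    also have "\<dots> \<le> m" using e(3) norm_ge_zero[of A] by (simp add: pos_le_divide_eq mult.commute mult.left_commute)
    finally show False using val[OF x] by simp
  qed
  then show ?thesis using A psd by (simp add: positive_forms_iff less_le)
qed

end


section \<open>Minima and Voronoi domains\<close>

context steinitz
begin

section \<open>The minimum and its attainment\<close>

abbreviation "mn \<equiv> lattice_min K \<aa> l"

abbreviation "perfect \<equiv> perfect_form K \<aa> l"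

abbreviation "MV \<equiv> minimal_vectors K \<aa> l"

abbreviation "VD \<equiv> voronoi_domain K \<aa> l"

lemma inner_rank_one_sign:
  assumes "x \<in> L0"
  shows "0 \<le> fval R x \<longleftrightarrow> 0 \<le> nval R x"
    and "fval R x < 0 \<longleftrightarrow> nval R x < 0"
    and "fval R x = 0 \<longleftrightarrow> nval R x = 0"
  using vnorm_ge_1[OF assms] by (auto simp: inner_nrank_one zero_le_divide_iff divide_less_0_iff)

lemma nrank_one_lower_bound:
  assumes "\<forall>x. c * (norm x)\<^sup>2 \<le> fval A x" "x \<in> L0"
  shows "c * norm (nrank_one x) \<le> nval A x"
  using assms vnorm_ge_1[OF assms(2)] by (simp add: norm_nrank_one inner_nrank_one divide_right_mono)

lemma positive_form_coercive:
  assumes "A \<in> positive_forms"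
  obtains c where "c > 0" "\<And>x. x \<in> L0 \<Longrightarrow> c * norm (nrank_one x) \<le> nval A x"
proof -
  obtain c where c: "c > 0" "\<forall>x. c * (norm x)\<^sup>2 \<le> fval A x"
    using compact_positive_forms_bound[of "{A}"] assms by auto
  show thesis by (rule that[OF c(1)]) (rule nrank_one_lower_bound[OF c(2)])
qed

lemma L0_nonempty: "L0 \<noteq> {}"
proof -
  obtain g :: nat where g: "g > 0" "of_nat g \<in> \<aa>" using \<aa>_integer .
  let ?x = "(\<chi> j. of_nat g * 1) :: complex^'n"
  have "?x \<in> L" by (rule L_integer_multiple[OF g(2) O_1])
  moreover have "?x $ l \<noteq> 0" using g by simp
  then have "?x \<noteq> 0" by (metis zero_index)
  ultimately show ?thesis by blast
qed

lemma min_attained: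
  assumes "A \<in> positive_forms"
  obtains x where "x \<in> L0" "\<And>y. y \<in> L0 \<Longrightarrow> nval A x \<le> nval A y"
proof -
  obtain c where c: "c > 0" "\<And>x. x \<in> L0 \<Longrightarrow> c * norm (nrank_one x) \<le> nval A x"
    using positive_form_coercive[OF assms] by blast
  obtain x0 where x0: "x0 \<in> L0" using L0_nonempty by blast
  \<comment> \<open>By coercivity every vector outside F has a larger value than x0, which leaves a
    minimum over a finite set.\<close>
  define b where "b = (nval A x0) / c"
  define F where "F = {d \<in> nrank_one ` L0. norm d \<le> b}"
  have fin: "finite F" unfolding F_def by (rule finite_nrank_one_ball)
  have out: "nval A x0 < nval A y" if "y \<in> L0" "nrank_one y \<notin> F" for y
  proof -
    have "b < norm (nrank_one y)" using that by (auto simp: F_def)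
    then have "nval A x0 < c * norm (nrank_one y)" using c(1) by (simp add: b_def field_simps)
    then show ?thesis using c(2)[OF that(1)] by linarith
  qed
  have x0F: "nrank_one x0 \<in> F" using out[OF x0] by auto
  then have "(\<bullet>) A ` F \<noteq> {}" by blast
  then have "Min ((\<bullet>) A ` F) \<in> (\<bullet>) A ` F" using fin by (intro Min_in) auto
  then obtain d where d: "d \<in> F" "Min ((\<bullet>) A ` F) = A \<bullet> d" by blast
  then obtain x where "x \<in> L0" "d = nrank_one x" unfolding F_def by blast
  then have x: "x \<in> L0" "nrank_one x \<in> F" "nval A x = Min ((\<bullet>) A ` F)" using d by auto
  have le: "nval A x \<le> A \<bullet> d" if "d \<in> F" for d unfolding x(3) using fin that by (intro Min_le) auto
  have "nval A x \<le> nval A y" if "y \<in> L0" for y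
  proof (cases "nrank_one y \<in> F")
    case False
    then show ?thesis using out[OF that] le[OF x0F] by linarith
  qed (rule le)
  then show thesis using that x(1) by blast
qed

lemma lattice_min_eqI:
  assumes "x \<in> L0" "nval A x = m" "\<And>y. y \<in> L0 \<Longrightarrow> m \<le> nval A y"
  shows "mn A = m" unfolding lattice_min_def
proof (rule Least_equality)
  show "\<exists>x\<in>L0. m = normalized_value K \<aa> l A x"
    using assms(1,2) normalized_value_eq[OF assms(1), of A] by (intro bexI[of _ x]) auto
  show "m \<le> y" if "\<exists>x\<in>L0. y = normalized_value K \<aa> l A x" for y
    using that assms(3) normalized_value_eq by auto
qed

lemma lattice_min_attained: "A \<in> positive_forms \<Longrightarrow> \<exists>x\<in>L0. nval A x = mn A"
  using min_attained[of A] lattice_min_eqI by metis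

lemma lattice_min_le: "A \<in> positive_forms \<Longrightarrow> y \<in> L0 \<Longrightarrow> mn A \<le> nval A y"
  using min_attained[of A] lattice_min_eqI by metis

lemma lattice_min_pos:
  assumes "A \<in> positive_forms"
  shows "0 < mn A"
proof -
  obtain x where x: "x \<in> L0" "nval A x = mn A" using lattice_min_attained[OF assms] by blast
  then have "0 < fval A x" using assms by (auto simp: positive_forms_iff)
  then show ?thesis using x vnorm_ge_1[OF x(1)] by (simp add: inner_nrank_one flip: x(2))
qed

lemma MV_iff: "x \<in> MV A \<longleftrightarrow> x \<in> L0 \<and> nval A x = mn A"
  using normalized_value_eq[of x A] by (auto simp: minimal_vectors_def)

lemma minimal_vectors_nonempty: "A \<in> positive_forms \<Longrightarrow> \<exists>x. x \<in> MV A"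
  using lattice_min_attained MV_iff by blast

section \<open>Classes of minimal vectors and the Voronoi domain\<close>

definition class_rel :: "complex^'n^'n \<Rightarrow> ((complex^'n) \<times> (complex^'n)) set" where
  "class_rel A = {(v, w). v \<in> MV A \<and> w \<in> MV A \<and> (\<exists>\<kappa>\<in>K - {0}. v = \<kappa> *s w)}"

lemma class_rel_iff [simp]:
  "(v, w) \<in> class_rel A \<longleftrightarrow> v \<in> MV A \<and> w \<in> MV A \<and> (\<exists>\<kappa>\<in>K - {0}. v = \<kappa> *s w)"
  by (simp add: class_rel_def)

abbreviation "MC \<equiv> minimal_classes K \<aa> l"

lemma minimal_classes_eq: "MC A = MV A // class_rel A"
  by (simp add: minimal_classes_def class_rel_def)

lemma equiv_class_rel: "equiv (MV A) (class_rel A)"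
proof (rule equivI)
  show "class_rel A \<subseteq> MV A \<times> MV A" by (auto simp: class_rel_def)
  have "v = 1 *s v" for v :: "complex^'n" by simp
  then show "refl_on (MV A) (class_rel A)"
    using K_1 by (auto simp: refl_on_def intro!: bexI[of _ 1])
  show "sym (class_rel A)"
  proof (rule symI)
    fix v w assume vw: "(v, w) \<in> class_rel A"
    then obtain \<kappa> where k: "\<kappa> \<in> K - {0}" "v = \<kappa> *s w" by auto
    then have "w = inverse \<kappa> *s v" by (simp add: vector_smult_assoc)
    moreover have "inverse \<kappa> \<in> K - {0}" using k K_inverse by simp
    moreover have "v \<in> MV A" "w \<in> MV A" using vw by auto
    ultimately show "(w, v) \<in> class_rel A" unfolding class_rel_iff by blast
  qed
  show "trans (class_rel A)"
  proof (rule transI)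
    fix u v w assume uv: "(u, v) \<in> class_rel A" and vw: "(v, w) \<in> class_rel A"
    then obtain \<kappa> \<kappa>' where k: "\<kappa> \<in> K - {0}" "u = \<kappa> *s v" "\<kappa>' \<in> K - {0}" "v = \<kappa>' *s w"
      unfolding class_rel_iff by blast
    then have "u = (\<kappa> * \<kappa>') *s w" by (simp add: vector_smult_assoc)
    moreover have "\<kappa> * \<kappa>' \<in> K - {0}" using k K_mult by simp
    moreover have "u \<in> MV A" "w \<in> MV A" using uv vw by auto
    ultimately show "(u, w) \<in> class_rel A" unfolding class_rel_iff by blast
  qed
qed

lemma class_matrix_eq:
  assumes "c \<in> MC A"
  shows "\<exists>x. x \<in> c \<and> x \<in> MV A \<and> class_matrix c = rank_one x"
proof -
  have "c \<noteq> {}" "c \<subseteq> MV A"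
    using assms equiv_class_rel in_quotient_imp_non_empty in_quotient_imp_subset
    unfolding minimal_classes_eq by blast+
  then have "(SOME x. x \<in> c) \<in> c" by (simp add: some_in_eq)
  then show ?thesis using \<open>c \<subseteq> MV A\<close> unfolding class_matrix_def by blast
qed

lemma rank_one_class_matrix:
  assumes "v \<in> MV A"
  shows "\<exists>c\<in>MC A. \<exists>r>0. rank_one v = r *\<^sub>R class_matrix c"
proof -
  let ?c = "class_rel A `` {v}"
  have c: "?c \<in> MC A" unfolding minimal_classes_eq using assms by (rule quotientI)
  obtain x where x: "x \<in> ?c" "class_matrix ?c = rank_one x" using class_matrix_eq[OF c] by blast
  then obtain \<kappa> where "\<kappa> \<in> K - {0}" "v = \<kappa> *s x" by auto
  then have "rank_one v = (norm \<kappa>)\<^sup>2 *\<^sub>R class_matrix ?c" "(norm \<kappa>)\<^sup>2 > 0"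
    using x by (auto simp: rank_one_smult)
  then show ?thesis using c by blast
qed

text \<open>Each class has a representative y with bounded \<open>vnorm\<close>, and coercivity
  bounds its normalized matrix by \<open>mn A / c\<close>; so y lies in a fixed ball.\<close>

lemma finite_minimal_classes:
  assumes A: "A \<in> positive_forms"
  shows "finite (MC A)"
proof -
  obtain C where C: "C > 0" "\<And>x. x \<in> L0 \<Longrightarrow> \<exists>\<kappa>\<in>K. \<kappa> \<noteq> 0 \<and> \<kappa> *s x \<in> L0 \<and> vnorm (\<kappa> *s x) \<le> C"
    using bounded_vnorm_representative by blast
  obtain c where c: "c > 0" "\<And>x. x \<in> L0 \<Longrightarrow> c * norm (nrank_one x) \<le> nval A x"
    using positive_form_coercive[OF A] by blast
  define b where "b = sqrt (mn A / c * C)"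
  have "MC A \<subseteq> (\<lambda>x. class_rel A `` {x}) ` {x \<in> L. norm x \<le> b}"
  proof
    fix q assume "q \<in> MC A"
    then obtain v where v: "v \<in> MV A" "q = class_rel A `` {v}"
      unfolding minimal_classes_eq by (rule quotientE)
    have vL: "v \<in> L0" using v MV_iff by blast
    obtain \<kappa> where k: "\<kappa> \<in> K" "\<kappa> \<noteq> 0" "\<kappa> *s v \<in> L0" "vnorm (\<kappa> *s v) \<le> C" using C(2)[OF vL] by blast
    let ?y = "\<kappa> *s v"
    have y1: "1 \<le> vnorm ?y" using vnorm_ge_1[OF k(3)] .
    have d: "nrank_one ?y = nrank_one v" using nrank_one_smult[OF vL k(1-3)] .
    have yM: "?y \<in> MV A" using v(1) k(3) d by (auto simp: MV_iff)
    have "norm (nrank_one ?y) = (norm ?y)\<^sup>2 / vnorm ?y" by (rule norm_nrank_one[OF k(3)])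
    moreover have "c * norm (nrank_one ?y) \<le> mn A" using c(2)[OF k(3)] yM by (simp only: MV_iff)
    then have "norm (nrank_one ?y) \<le> mn A / c" using c(1) by (simp add: field_simps)
    ultimately have "(norm ?y)\<^sup>2 \<le> mn A / c * vnorm ?y" using y1 by (simp add: divide_le_eq)
    also have "\<dots> \<le> mn A / c * C"
      using k(4) c(1) lattice_min_pos[OF A] by (intro mult_left_mono) auto
    finally have "norm ?y \<le> b" by (simp add: b_def real_le_rsqrt)
    moreover have "(?y, v) \<in> class_rel A" using yM v(1) k by auto
    then have "q = class_rel A `` {?y}" using equiv_class_eq[OF equiv_class_rel] v(2) by metis
    ultimately show "q \<in> (\<lambda>x. class_rel A `` {x}) ` {x \<in> L. norm x \<le> b}" using k(3) by blast
  qed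
  then show ?thesis by (rule finite_subset) (use finite_L_ball in blast)
qed

text \<open>Spans may therefore be taken over all minimal vectors, without choosing class
  representatives.\<close>

lemma span_class_matrix: "span (class_matrix ` MC A) = span (rank_one ` MV A)"
proof (rule span_eq[THEN iffD2], intro conjI subsetI)
  fix T assume "T \<in> class_matrix ` MC A"
  then show "T \<in> span (rank_one ` MV A)" using class_matrix_eq by (metis imageE imageI span_base)
next
  fix T assume "T \<in> rank_one ` MV A"
  then obtain c r where "c \<in> MC A" "T = r *\<^sub>R class_matrix c" using rank_one_class_matrix by blast
  then show "T \<in> span (class_matrix ` MC A)" by (auto intro: span_scale span_base)
qed

lemma perfect_form_iff:
  "perfect A \<longleftrightarrow> A \<in> positive_forms \<and> span (rank_one ` MV A) = hermitian_matrices"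
  by (simp add: perfect_form_def span_class_matrix)

text \<open>The hull of a finite set is a polyhedron, which supplies finiteness of the facets and
  the description by half-spaces.\<close>

lemma voronoi_domain_eq:
  assumes "A \<in> positive_forms"
  shows "VD A = convex_cone hull (class_matrix ` MC A)"
proof
  have fin: "finite (MC A)" using finite_minimal_classes[OF assms] .
  show "VD A \<subseteq> convex_cone hull (class_matrix ` MC A)"
  proof
    fix T assume "T \<in> VD A"
    then obtain \<mu> where T: "T = (\<Sum>c\<in>MC A. \<mu> c *\<^sub>R class_matrix c)" "\<forall>c\<in>MC A. 0 \<le> \<mu> c"
      by (auto simp: voronoi_domain_def)
    have "(\<Sum>c\<in>S. \<mu> c *\<^sub>R class_matrix c) \<in> convex_cone hull (class_matrix ` MC A)"
      if "finite S" "S \<subseteq> MC A" for S using that T(2)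
    proof (induction S rule: finite_induct)
      case (insert c S)
      then have "\<mu> c *\<^sub>R class_matrix c \<in> convex_cone hull (class_matrix ` MC A)"
        by (intro convex_cone_hull_mul hull_inc) auto
      then show ?case using insert by (simp add: convex_cone_hull_add)
    qed (simp add: convex_cone_hull_contains_0)
    then show "T \<in> convex_cone hull (class_matrix ` MC A)" using T(1) fin by blast
  qed
  show "convex_cone hull (class_matrix ` MC A) \<subseteq> VD A"
  proof (rule hull_minimal)
    show "class_matrix ` MC A \<subseteq> VD A"
    proof
      fix T assume "T \<in> class_matrix ` MC A"
      then obtain c where c: "c \<in> MC A" "T = class_matrix c" by blast
      have "T = (\<Sum>d\<in>MC A. (if d = c then 1 else 0) *\<^sub>R class_matrix d)"
        using c fin by (simp add: if_distrib[of "\<lambda>r. r *\<^sub>R _"] cong: if_cong)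
      then show "T \<in> VD A" unfolding voronoi_domain_def
        by (auto intro!: exI[of _ "\<lambda>d. if d = c then 1 else 0"])
    qed
    show "convex_cone (VD A)" unfolding convex_cone_iff
    proof (intro conjI ballI allI impI)
      show "0 \<in> VD A" unfolding voronoi_domain_def by (auto intro!: exI[of _ "\<lambda>_. 0"])
      fix S assume "S \<in> VD A"
      then obtain \<mu> where S: "S = (\<Sum>c\<in>MC A. \<mu> c *\<^sub>R class_matrix c)" "\<forall>c\<in>MC A. 0 \<le> \<mu> c"
        by (auto simp: voronoi_domain_def)
      {
        fix T assume "T \<in> VD A"
        then obtain \<nu> where T: "T = (\<Sum>c\<in>MC A. \<nu> c *\<^sub>R class_matrix c)" "\<forall>c\<in>MC A. 0 \<le> \<nu> c"
          by (auto simp: voronoi_domain_def)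
        have "S + T = (\<Sum>c\<in>MC A. (\<mu> c + \<nu> c) *\<^sub>R class_matrix c)"
          by (simp add: S T scaleR_left_distrib sum.distrib)
        then show "S + T \<in> VD A" unfolding voronoi_domain_def
          using S T by (auto intro!: exI[of _ "\<lambda>c. \<mu> c + \<nu> c"])
      }
      fix r :: real assume "0 \<le> r"
      have "r *\<^sub>R S = (\<Sum>c\<in>MC A. (r * \<mu> c) *\<^sub>R class_matrix c)" by (simp add: S scaleR_sum_right)
      then show "r *\<^sub>R S \<in> VD A" unfolding voronoi_domain_def
        using S \<open>0 \<le> r\<close> by (auto intro!: exI[of _ "\<lambda>c. r * \<mu> c"])
    qed
  qed
qed

lemma convex_cone_voronoi_domain: "A \<in> positive_forms \<Longrightarrow> convex_cone (VD A)"
  by (simp add: voronoi_domain_eq convex_cone_convex_cone_hull)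

lemma polyhedron_voronoi_domain: "A \<in> positive_forms \<Longrightarrow> polyhedron (VD A)"
  by (simp add: voronoi_domain_eq polyhedron_convex_cone_hull finite_minimal_classes)

lemma class_matrix_in_voronoi_domain: "A \<in> positive_forms \<Longrightarrow> c \<in> MC A \<Longrightarrow> class_matrix c \<in> VD A"
  by (simp add: voronoi_domain_eq hull_inc)

lemma rank_one_in_voronoi_domain:
  assumes "A \<in> positive_forms" "v \<in> MV A"
  shows "rank_one v \<in> VD A"
proof -
  obtain c r where "c \<in> MC A" "r > 0" "rank_one v = r *\<^sub>R class_matrix c"
    using rank_one_class_matrix[OF assms(2)] by blast
  then show ?thesis using convex_cone_scaleR[OF convex_cone_voronoi_domain[OF assms(1)]]
      class_matrix_in_voronoi_domain[OF assms(1)] by simp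
qed

lemma voronoi_domain_subset_span: "VD A \<subseteq> span (rank_one ` MV A)"
proof
  fix T assume "T \<in> VD A"
  then obtain \<mu> where "T = (\<Sum>c\<in>MC A. \<mu> c *\<^sub>R class_matrix c)" by (auto simp: voronoi_domain_def)
  then have "T \<in> span (class_matrix ` MC A)" by (simp only:) (intro span_sum span_scale span_base imageI)
  then show "T \<in> span (rank_one ` MV A)" by (simp add: span_class_matrix)
qed

lemma span_voronoi_domain:
  assumes "A \<in> positive_forms"
  shows "span (VD A) = span (rank_one ` MV A)"
proof (rule span_eq[THEN iffD2], intro conjI)
  show "VD A \<subseteq> span (rank_one ` MV A)" by (rule voronoi_domain_subset_span)
  show "rank_one ` MV A \<subseteq> span (VD A)" using rank_one_in_voronoi_domain[OF assms] span_base by blast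
qed

lemma rank_one_MV_hermitian: "span (rank_one ` MV A) \<subseteq> hermitian_matrices"
  using span_mono[of "rank_one ` MV A" hermitian_matrices] rank_one_hermitian by auto

lemma voronoi_domain_hermitian: "T \<in> VD A \<Longrightarrow> T \<in> hermitian_matrices"
  using voronoi_domain_subset_span rank_one_MV_hermitian by blast

lemma voronoi_domain_inner_nonneg:
  assumes "\<And>x. x \<in> MV A \<Longrightarrow> 0 \<le> fval R x" "T \<in> VD A"
  shows "0 \<le> R \<bullet> T"
proof -
  obtain \<mu> where T: "T = (\<Sum>c\<in>MC A. \<mu> c *\<^sub>R class_matrix c)" "\<forall>c\<in>MC A. 0 \<le> \<mu> c"
    using assms(2) by (auto simp: voronoi_domain_def)
  have "0 \<le> R \<bullet> class_matrix c" if "c \<in> MC A" for c using class_matrix_eq[OF that] assms(1) by auto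
  then show ?thesis using T(2) by (simp add: T(1) inner_sum_right sum_nonneg)
qed

text \<open>A form attains its minimum on the generators of its own Voronoi domain, so for T in the
  domain it has the least trace product among the forms whose normalized values are at least
  \<open>mn A\<close>.\<close>

lemma voronoi_domain_inner_le:
  assumes "\<And>y. y \<in> L0 \<Longrightarrow> mn A \<le> nval B y" "T \<in> VD A"
  shows "A \<bullet> T \<le> B \<bullet> T"
proof -
  have "0 \<le> fval (B - A) x" if "x \<in> MV A" for x
    using that assms(1)[of x] inner_rank_one_sign(1)[of x "B - A"]
    by (simp add: MV_iff inner_diff_left)
  then have "0 \<le> (B - A) \<bullet> T" using voronoi_domain_inner_nonneg assms(2) by blast
  then show ?thesis by (simp add: inner_diff_left)
qed

text \<open>Only finitely many normalized matrices are short; there, values above m tolerate a small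
  change and values equal to m do not decrease. On the long ones the coercivity of A outweighs the
  perturbation.\<close>

lemma extend_bounded_below:
  assumes A: "A \<in> positive_forms" and le: "\<And>x. x \<in> L0 \<Longrightarrow> m \<le> nval A x"
    and R: "\<And>x. x \<in> L0 \<Longrightarrow> nval A x = m \<Longrightarrow> 0 \<le> nval R x"
  shows "\<exists>e>0. \<forall>t. 0 \<le> t \<and> t \<le> e \<longrightarrow> (\<forall>x\<in>L0. m \<le> nval (A + t *\<^sub>R R) x)"
proof -
  obtain c where c: "c > 0" "\<And>x. x \<in> L0 \<Longrightarrow> c * norm (nrank_one x) \<le> nval A x"
    using positive_form_coercive[OF A] by blast
  \<comment> \<open>Beyond this length, half of the coercive bound is already at least m; the other
    half absorbs t R by the choice of e below.\<close>
  define b where "b = 2 * m / c"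
  define F where "F = {d \<in> nrank_one ` L0. norm d \<le> b}"
  have fin: "finite F" unfolding F_def by (rule finite_nrank_one_ball)
  have "\<forall>\<^sub>F t in at_right 0. m \<le> A \<bullet> d + t * (R \<bullet> d)" if dF: "d \<in> F" for d
  proof -
    obtain x where x: "x \<in> L0" "d = nrank_one x" using dF unfolding F_def by blast
    show ?thesis
    proof (cases "A \<bullet> d = m")
      case True
      then have "0 \<le> R \<bullet> d" using R[OF x(1)] x(2) by simp
      then show ?thesis unfolding eventually_at_right_field using True by (intro exI[of _ 1]) auto
    next
      case False
      then have "m < A \<bullet> d + 0 * (R \<bullet> d)" using le[OF x(1)] x(2) by simp
      moreover have "((\<lambda>t. A \<bullet> d + t * (R \<bullet> d)) \<longlongrightarrow> A \<bullet> d + 0 * (R \<bullet> d)) (at_right 0)"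
        by (intro tendsto_intros)
      ultimately show ?thesis using order_tendstoD(1) by (fastforce elim: eventually_mono)
    qed
  qed
  then have "\<forall>\<^sub>F t in at_right 0. \<forall>d\<in>F. m \<le> A \<bullet> d + t * (R \<bullet> d)"
    using fin by (simp add: eventually_ball_finite)
  then obtain e2 where e2: "e2 > 0" "\<And>d t. d \<in> F \<Longrightarrow> 0 < t \<Longrightarrow> t < e2 \<Longrightarrow> m \<le> A \<bullet> d + t * (R \<bullet> d)"
    unfolding eventually_at_right_field by blast
  have at_0: "m \<le> A \<bullet> d" if "d \<in> F" for d using that le by (auto simp: F_def)
  define e1 where "e1 = e2 / 2"
  have e1: "e1 > 0" "\<And>d t. d \<in> F \<Longrightarrow> 0 \<le> t \<Longrightarrow> t \<le> e1 \<Longrightarrow> m \<le> A \<bullet> d + t * (R \<bullet> d)"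
  proof -
    show "e1 > 0" using e2(1) by (simp add: e1_def)
    show "m \<le> A \<bullet> d + t * (R \<bullet> d)" if "d \<in> F" "0 \<le> t" "t \<le> e1" for d t
      using e2 at_0[OF that(1)] that by (cases "t = 0") (auto simp: e1_def)
  qed
  define e where "e = min e1 (c / (2 * (norm R + 1)))"
  have nR: "norm R + 1 > 0" by (simp add: add_nonneg_pos)
  have e: "e > 0" "e \<le> e1" "e \<le> c / (2 * (norm R + 1))" using e1 c nR by (auto simp: e_def)
  have "m \<le> nval (A + t *\<^sub>R R) x" if t: "0 \<le> t" "t \<le> e" and x: "x \<in> L0" for t x
  proof (cases "nrank_one x \<in> F")
    case True
    then show ?thesis using e1(2)[OF True t(1)] t e by (simp add: inner_add_left)
  next
    case False
    let ?d = "nrank_one x"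
    have big: "b < norm ?d" using False x by (auto simp: F_def)
    have "t * (norm R + 1) \<le> c / 2" using order_trans[OF t(2) e(3)] nR by (simp add: field_simps)
    then have "t * norm R \<le> c / 2" using t(1) by (simp add: algebra_simps)
    then have "t * norm R * norm ?d \<le> c / 2 * norm ?d" by (rule mult_right_mono) simp
    moreover have "\<bar>t * (R \<bullet> ?d)\<bar> \<le> t * (norm R * norm ?d)"
      using t(1) Cauchy_Schwarz_ineq2[of R ?d] by (simp add: abs_mult mult_left_mono)
    ultimately have "c / 2 * norm ?d \<le> c * norm ?d + t * (R \<bullet> ?d)" by (simp add: abs_le_iff mult.assoc)
    also have "\<dots> \<le> (A + t *\<^sub>R R) \<bullet> ?d" using c(2)[OF x] by (simp add: inner_add_left)
    finally have "c / 2 * norm ?d \<le> (A + t *\<^sub>R R) \<bullet> ?d" .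
    moreover have "m \<le> c / 2 * norm ?d" using big c(1) by (simp add: b_def field_simps)
    ultimately show ?thesis by linarith
  qed
  then show ?thesis using e(1) by blast
qed

text \<open>\<rho> is the supremum of the lengths up to which no value drops below the minimum:
  finite because the value at x0 decreases, positive by \<open>extend_bounded_below\<close>. If R
  were nonnegative on all minimal vectors at \<rho>, the same lemma would extend the interval past
  \<rho>.\<close>

lemma advance:
  assumes A: "A \<in> positive_forms" and R: "R \<in> hermitian_matrices"
    and nonneg: "\<And>x. x \<in> MV A \<Longrightarrow> 0 \<le> nval R x"
    and neg: "x0 \<in> L0" "nval R x0 < 0"
  obtains \<rho> x1 where "\<rho> > 0"
    "\<And>t. 0 \<le> t \<Longrightarrow> t \<le> \<rho> \<Longrightarrow> A + t *\<^sub>R R \<in> positive_forms"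
    "\<And>t x. 0 \<le> t \<Longrightarrow> t \<le> \<rho> \<Longrightarrow> x \<in> L0 \<Longrightarrow> mn A \<le> nval (A + t *\<^sub>R R) x"
    "x1 \<in> L0" "nval (A + \<rho> *\<^sub>R R) x1 = mn A" "nval R x1 < 0"
proof -
  define m where "m = mn A"
  have m: "m > 0" using lattice_min_pos[OF A] by (simp add: m_def)
  have le: "m \<le> nval A x" if "x \<in> L0" for x using lattice_min_le[OF A that] by (simp add: m_def)
  define I where "I = {t. 0 \<le> t \<and> (\<forall>x\<in>L0. m \<le> nval (A + t *\<^sub>R R) x)}"
  have bound: "t \<le> (nval A x - m) / (- (nval R x))"
    if "t \<in> I" "x \<in> L0" "nval R x < 0" for t x
  proof -
    have "m \<le> nval A x + t * (nval R x)" using that by (simp add: I_def inner_add_left)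
    then show ?thesis using that(3) by (subst pos_le_divide_eq) auto
  qed
  have bdd: "bdd_above I" using bound[OF _ neg] by (auto simp: bdd_above_def)
  have "\<exists>e>0. \<forall>t. 0 \<le> t \<and> t \<le> e \<longrightarrow> (\<forall>x\<in>L0. m \<le> nval (A + t *\<^sub>R R) x)"
  proof (rule extend_bounded_below[OF A le])
    fix x assume "x \<in> L0" "nval A x = m"
    then show "0 \<le> nval R x" using nonneg[of x] by (simp add: MV_iff m_def)
  qed
  then obtain e where e: "e > 0" "e \<in> I" by (auto simp: I_def)
  define \<rho> where "\<rho> = Sup I"
  have \<rho>0: "\<rho> > 0" using e cSup_upper[OF e(2) bdd] by (simp add: \<rho>_def)
  have \<rho>: "m \<le> nval A x + \<rho> * (nval R x)" if "x \<in> L0" for x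
  proof (cases "0 \<le> nval R x")
    case True
    then show ?thesis using le[OF that] \<rho>0 by (simp add: add_increasing2)
  next
    case False
    then have "\<rho> \<le> (nval A x - m) / (- (nval R x))"
      unfolding \<rho>_def using e(2) bound[OF _ that] by (intro cSup_least) auto
    then have "\<rho> * (- (nval R x)) \<le> nval A x - m"
      using False by (subst pos_le_divide_eq[symmetric]) auto
    then show ?thesis by simp
  qed
  have all: "m \<le> nval (A + t *\<^sub>R R) x" if "0 \<le> t" "t \<le> \<rho>" "x \<in> L0" for t x
  proof (cases "0 \<le> nval R x")
    case True
    then show ?thesis using le[OF that(3)] that(1) by (simp add: inner_add_left add_increasing2)
  next
    case False
    then have "\<rho> * (nval R x) \<le> t * (nval R x)" using that(2) by (intro mult_right_mono_neg) auto
    then show ?thesis using \<rho>[OF that(3)] by (simp add: inner_add_left)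
  qed
  have herm: "A + t *\<^sub>R R \<in> hermitian_matrices" for t
    using hermitian_add_scaleR[OF positive_forms_hermitian[OF A] R] .
  have pos: "A + t *\<^sub>R R \<in> positive_forms" if "0 \<le> t" "t \<le> \<rho>" for t
    using positive_if_bounded_below_on_L[OF herm m all[OF that]] .
  have "\<exists>x1\<in>L0. nval (A + \<rho> *\<^sub>R R) x1 = m \<and> nval R x1 < 0"
  proof (rule ccontr)
    assume none: "\<not> ?thesis"
    have "\<exists>e>0. \<forall>t. 0 \<le> t \<and> t \<le> e \<longrightarrow> (\<forall>x\<in>L0. m \<le> nval (A + \<rho> *\<^sub>R R + t *\<^sub>R R) x)"
    proof (rule extend_bounded_below)
      show "A + \<rho> *\<^sub>R R \<in> positive_forms" using pos \<rho>0 by simp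
      show "m \<le> nval (A + \<rho> *\<^sub>R R) x" if "x \<in> L0" for x using all that \<rho>0 by simp
      show "0 \<le> nval R x" if "x \<in> L0" "nval (A + \<rho> *\<^sub>R R) x = m" for x using none that by force
    qed
    then obtain e where e: "e > 0" "\<forall>x\<in>L0. m \<le> nval (A + \<rho> *\<^sub>R R + e *\<^sub>R R) x" by auto
    then have "\<rho> + e \<in> I" using \<rho>0 by (simp add: I_def scaleR_left_distrib add.assoc)
    then have "\<rho> + e \<le> \<rho>" unfolding \<rho>_def by (rule cSup_upper[OF _ bdd])
    then show False using e by simp
  qed
  then obtain x1 where "x1 \<in> L0" "nval (A + \<rho> *\<^sub>R R) x1 = m" "nval R x1 < 0" by blast
  then show thesis using that[OF \<rho>0 pos] all unfolding m_def by blast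
qed

end


section \<open>Facets and contiguous forms\<close>

context steinitz
begin

section \<open>The search for a first perfect form\<close>

abbreviation "admissible \<equiv> admissible_lengths K \<aa> l"

abbreviation "contiguous \<equiv> contiguous_forms K \<aa> l"

lemma improve_exists:
  assumes A: "A \<in> positive_forms" and np: "\<not> perfect A"
  shows "\<exists>R \<rho>. R \<in> hermitian_matrices \<and> R \<noteq> 0 \<and> (\<forall>T\<in>span (VD A). trace_product R T = 0)
    \<and> \<rho> \<in> admissible A R \<and> (\<forall>\<sigma>\<in>admissible A R. \<sigma> \<le> \<rho>)"
proof -
  have "span (rank_one ` MV A) \<noteq> hermitian_matrices" using A np by (simp add: perfect_form_iff)
  then have "span (rank_one ` MV A) \<subset> span hermitian_matrices" using rank_one_MV_hermitian by auto
  then obtain R0 where R0: "R0 \<noteq> 0" "R0 \<in> hermitian_matrices"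
    "\<And>T. T \<in> span (rank_one ` MV A) \<Longrightarrow> orthogonal R0 T"
    using orthogonal_to_subspace_exists_gen[of "rank_one ` MV A" hermitian_matrices] by auto
  \<comment> \<open>A nonzero Hermitian form cannot vanish on all of \<open>L\<close>, so R0 or its
    negative decreases some value; this settles the sign.\<close>
  obtain x0 where x0: "x0 \<in> L0" "fval R0 x0 \<noteq> 0"
    using hermitian_eq_0_if_zero_on_L[OF R0(2)] R0(1) by blast
  define R where "R = (if fval R0 x0 < 0 then R0 else - R0)"
  have R: "R \<noteq> 0" "R \<in> hermitian_matrices" and neg: "nval R x0 < 0"
    using R0 x0 inner_rank_one_sign(2)[OF x0(1), of R] subspace_neg[OF subspace_hermitian]
    by (auto simp: R_def)
  have perp: "R \<bullet> T = 0" if "T \<in> span (rank_one ` MV A)" for T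
    using R0(3)[OF that] by (auto simp: R_def orthogonal_def)
  have MV0: "nval R x = 0" if "x \<in> MV A" for x
    using perp[of "rank_one x"] that inner_rank_one_sign(3)[of x R] span_base[of "rank_one x" "rank_one ` MV A"]
    by (simp add: MV_iff)
  obtain \<rho> x1 where \<rho>: "\<rho> > 0"
    "\<And>t. 0 \<le> t \<Longrightarrow> t \<le> \<rho> \<Longrightarrow> A + t *\<^sub>R R \<in> positive_forms"
    "\<And>t x. 0 \<le> t \<Longrightarrow> t \<le> \<rho> \<Longrightarrow> x \<in> L0 \<Longrightarrow> mn A \<le> nval (A + t *\<^sub>R R) x"
    "x1 \<in> L0" "nval (A + \<rho> *\<^sub>R R) x1 = mn A" "nval R x1 < 0"
    using advance[OF A R(2) _ x0(1) neg] MV0 by (metis order_refl)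
  obtain v where v: "v \<in> MV A" using minimal_vectors_nonempty[OF A] by blast
  have same: "mn (A + t *\<^sub>R R) = mn A" if "0 \<le> t" "t \<le> \<rho>" for t
  proof (rule lattice_min_eqI)
    show "v \<in> L0" using v MV_iff by blast
    show "nval (A + t *\<^sub>R R) v = mn A" using v MV0[OF v] by (simp add: inner_add_left MV_iff)
  qed (rule \<rho>(3)[OF that])
  have "\<rho> \<in> admissible A R" using \<rho>(1,2) same by (simp add: admissible_lengths_def)
  moreover have "\<sigma> \<le> \<rho>" if "\<sigma> \<in> admissible A R" for \<sigma>
  proof (rule ccontr)
    assume "\<not> \<sigma> \<le> \<rho>"
    have s: "A + \<sigma> *\<^sub>R R \<in> positive_forms" "mn (A + \<sigma> *\<^sub>R R) = mn A"
      using that by (auto simp: admissible_lengths_def)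
    have "mn A \<le> nval A x1 + \<sigma> * (nval R x1)"
      using lattice_min_le[OF s(1) \<rho>(4)] s(2) by (simp add: inner_add_left)
    moreover have "\<sigma> * (nval R x1) < \<rho> * (nval R x1)"
      using \<open>\<not> \<sigma> \<le> \<rho>\<close> \<rho>(6) by (intro mult_strict_right_mono_neg) auto
    ultimately show False using \<rho>(5) by (simp add: inner_add_left)
  qed
  moreover have "trace_product R T = 0" if "T \<in> span (VD A)" for T
  proof -
    have "T \<in> span (rank_one ` MV A)" using that span_voronoi_domain[OF A] by simp
    moreover from this have "T \<in> hermitian_matrices" using rank_one_MV_hermitian by blast
    ultimately show ?thesis using perp by (simp add: trace_product_inner)
  qed
  ultimately show ?thesis using R by blast
qed

text \<open>R vanishes on the old minimal vectors, so these stay minimal. Maximality of \<rho>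
  forces a new minimal vector with R[x] < 0, and its rank one matrix is outside the old span because
  R is orthogonal to that span.\<close>

lemma improve_progress:
  assumes A: "A \<in> positive_forms" and R: "R \<in> hermitian_matrices"
    and perp: "\<forall>T\<in>span (VD A). trace_product R T = 0"
    and \<rho>: "\<rho> \<in> admissible A R" "\<forall>\<sigma>\<in>admissible A R. \<sigma> \<le> \<rho>"
  shows "A + \<rho> *\<^sub>R R \<in> positive_forms
    \<and> dim (rank_one ` MV A) < dim (rank_one ` MV (A + \<rho> *\<^sub>R R))"
proof -
  define B where "B = A + \<rho> *\<^sub>R R"
  have \<rho>0: "\<rho> > 0" and adm: "\<And>t. 0 \<le> t \<Longrightarrow> t \<le> \<rho> \<Longrightarrow> A + t *\<^sub>R R \<in> positive_forms \<and> mn (A + t *\<^sub>R R) = mn A"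
    using \<rho>(1) by (auto simp: admissible_lengths_def)
  have B: "B \<in> positive_forms" "mn B = mn A" using adm[of \<rho>] \<rho>0 by (auto simp: B_def)
  have perp': "fval R x = 0" if "x \<in> MV A" for x
    using perp rank_one_in_voronoi_domain[OF A that] span_base trace_product_inner[OF rank_one_hermitian]
    by metis
  have MV0: "nval R x = 0" if "x \<in> MV A" for x using perp'[OF that] by (simp add: inner_nrank_one)
  have sub: "MV A \<subseteq> MV B" using MV0 B(2) by (auto simp: B_def MV_iff inner_add_left)
  have "\<exists>x\<in>MV B. nval R x < 0"
  proof (rule ccontr)
    assume none: "\<not> ?thesis"
    have "\<exists>e>0. \<forall>t. 0 \<le> t \<and> t \<le> e \<longrightarrow> (\<forall>x\<in>L0. mn A \<le> nval (B + t *\<^sub>R R) x)"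
    proof (rule extend_bounded_below[OF B(1)])
      show "mn A \<le> nval B x" if "x \<in> L0" for x using lattice_min_le[OF B(1) that] B(2) by simp
      show "0 \<le> nval R x" if "x \<in> L0" "nval B x = mn A" for x
      proof -
        have "x \<in> MV B" using that B(2) by (simp add: MV_iff)
        then show ?thesis using none not_le by blast
      qed
    qed
    then obtain e where e: "e > 0" "\<And>t x. 0 \<le> t \<Longrightarrow> t \<le> e \<Longrightarrow> x \<in> L0 \<Longrightarrow> mn A \<le> nval (B + t *\<^sub>R R) x"
      by blast
    obtain v where v: "v \<in> MV A" using minimal_vectors_nonempty[OF A] by blast
    have "A + t *\<^sub>R R \<in> positive_forms \<and> mn (A + t *\<^sub>R R) = mn A" if t: "0 \<le> t" "t \<le> \<rho> + e" for t
    proof (cases "t \<le> \<rho>")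
      case False
      have eq: "A + t *\<^sub>R R = B + (t - \<rho>) *\<^sub>R R" by (simp add: B_def algebra_simps)
      have ge: "mn A \<le> nval (A + t *\<^sub>R R) x" if "x \<in> L0" for x
        unfolding eq using False t that by (intro e(2)) auto
      have "A + t *\<^sub>R R \<in> hermitian_matrices"
        using hermitian_add_scaleR[OF positive_forms_hermitian[OF A] R] .
      then have "A + t *\<^sub>R R \<in> positive_forms"
        using positive_if_bounded_below_on_L[OF _ lattice_min_pos[OF A] ge] by blast
      moreover have "mn (A + t *\<^sub>R R) = mn A"
      proof (rule lattice_min_eqI)
        show "v \<in> L0" using v MV_iff by blast
        show "nval (A + t *\<^sub>R R) v = mn A" using v MV0[OF v] by (simp add: inner_add_left MV_iff)
      qed (rule ge)
      ultimately show ?thesis by blast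
    qed (use adm t in blast)
    then have "\<rho> + e \<in> admissible A R" using \<rho>0 e(1) by (simp add: admissible_lengths_def)
    then show False using \<rho>(2) e(1) by fastforce
  qed
  then obtain x where x: "x \<in> MV B" "fval R x \<noteq> 0"
    using inner_rank_one_sign(3) MV_iff by (metis order_less_irrefl)
  have "rank_one x \<notin> span (rank_one ` MV A)"
    using inner_span_eq_0[of "rank_one x" "rank_one ` MV A" R] perp' x(2) by auto
  moreover have "rank_one x \<in> span (rank_one ` MV B)" using x by (auto intro: span_base)
  moreover have "span (rank_one ` MV A) \<subseteq> span (rank_one ` MV B)" using sub by (intro span_mono) auto
  ultimately have "span (rank_one ` MV A) \<subset> span (rank_one ` MV B)" by blast
  then show ?thesis using dim_psubset B(1) by (auto simp: B_def)
qed

section \<open>Facets, uniqueness and existence of contiguous forms\<close>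

lemma perfect_positive: "perfect A \<Longrightarrow> A \<in> positive_forms" by (simp add: perfect_form_iff)

lemma perfect_span: "perfect A \<Longrightarrow> span (VD A) = hermitian_matrices"
  using perfect_form_iff[of A] span_voronoi_domain[of A] by simp

text \<open>The source of rigidity: a perfect form is determined by its values on its minimal
  vectors.\<close>

lemma perfect_eqI:
  assumes "perfect A" "R \<in> hermitian_matrices" "\<And>x. x \<in> MV A \<Longrightarrow> fval R x = 0"
  shows "R = 0"
  by (rule orthogonal_span_eq_0[of R "rank_one ` MV A"]) (use assms perfect_form_iff in auto)

text \<open>A nonempty face of a cone contains the apex: a nonzero f lies in the open segment from 0
  to 2 f. Affine and linear dimension of the facet then agree.\<close>

lemma facet_contains_0:
  assumes A: "A \<in> positive_forms" and F: "F facet_of VD A"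
  shows "0 \<in> F"
proof -
  have face: "F face_of VD A" "F \<noteq> {}" using F by (auto simp: facet_of_def)
  then obtain f where f: "f \<in> F" by blast
  have FV: "F \<subseteq> VD A" using face face_of_imp_subset by blast
  show ?thesis
  proof (cases "f = 0")
    case False
    have "0 \<in> VD A" "2 *\<^sub>R f \<in> VD A"
      using convex_cone_voronoi_domain[OF A] f FV by (auto simp: convex_cone_iff)
    moreover have "f \<in> open_segment 0 (2 *\<^sub>R f)"
      using False by (auto simp: in_segment intro!: exI[of _ "1/2"])
    ultimately show ?thesis using face(1) f unfolding face_of_def by blast
  qed (use f in simp)
qed

lemma facet_hermitian: "F facet_of VD A \<Longrightarrow> F \<subseteq> hermitian_matrices"
  using facet_of_imp_subset[of F "VD A"] voronoi_domain_hermitian[of _ A] by auto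

text \<open>Since the facet and the domain both contain 0, codimension one holds for linear spans as
  well, and one vector outside restores the full space.\<close>

lemma facet_insert_span:
  assumes P: "perfect A" and F: "F facet_of VD A"
    and T: "T \<in> hermitian_matrices" "T \<notin> span F"
  shows "span (insert T F) = hermitian_matrices"
proof -
  have A: "A \<in> positive_forms" using perfect_positive[OF P] .
  have "0 \<in> F" using facet_contains_0[OF A F] .
  then have "aff_dim F = int (dim F)" by (intro aff_dim_zero hull_inc)
  moreover have "0 \<in> VD A" using convex_cone_voronoi_domain[OF A] by (simp add: convex_cone_contains_0)
  then have "aff_dim (VD A) = int (dim (VD A))" by (intro aff_dim_zero hull_inc)
  moreover have "dim (VD A) = dim (hermitian_matrices :: (complex^'n^'n) set)"
    using arg_cong[OF perfect_span[OF P], of dim] by simp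
  ultimately have "int (dim F) = int (dim (hermitian_matrices :: (complex^'n^'n) set)) - 1"
    using F by (simp add: facet_of_def)
  then have "dim (insert T F) = dim (hermitian_matrices :: (complex^'n^'n) set)"
    using T(2) by (simp add: dim_insert)
  moreover have "insert T F \<subseteq> hermitian_matrices" using facet_hermitian[OF F] T(1) by blast
  ultimately have "span (insert T F) = span hermitian_matrices" by (intro dim_eq_span) auto
  then show ?thesis by simp
qed

lemma facet_vector_inner:
  assumes "facet_vector K \<aa> l A F R" "F facet_of VD A"
  shows "R \<in> hermitian_matrices" "R \<noteq> 0" "\<And>S. S \<in> F \<Longrightarrow> R \<bullet> S = 0" "\<And>T. T \<in> VD A \<Longrightarrow> 0 \<le> R \<bullet> T"
proof -
  show "R \<in> hermitian_matrices" "R \<noteq> 0" using assms(1) by (auto simp: facet_vector_def)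
  show "R \<bullet> S = 0" if "S \<in> F" for S
    using assms(1) that facet_hermitian[OF assms(2)] trace_product_inner[of S R]
    by (auto simp: facet_vector_def)
  show "0 \<le> R \<bullet> T" if "T \<in> VD A" for T
    using assms(1) that voronoi_domain_hermitian[OF that] trace_product_inner[of T R]
    by (auto simp: facet_vector_def)
qed

text \<open>The orthogonal complement of a facet in the Hermitian matrices is a line, and a T in the
  domain with R \<bullet> T nonzero fixes the sign.\<close>

lemma facet_vector_unique:
  assumes P: "perfect A" and F: "F facet_of VD A"
    and R: "facet_vector K \<aa> l A F R" and R': "facet_vector K \<aa> l A F R'"
  obtains c where "c > 0" "R' = c *\<^sub>R R"
proof -
  note r = facet_vector_inner[OF R F] and r' = facet_vector_inner[OF R' F]
  obtain T where T: "T \<in> VD A" "R \<bullet> T \<noteq> 0"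
    using orthogonal_span_eq_0[of R "VD A"] r(1,2) perfect_span[OF P] by blast
  have TF: "T \<notin> span F" using inner_span_eq_0[OF _ r(3)] T(2) by blast
  have span: "span (insert T F) = hermitian_matrices"
    using facet_insert_span[OF P F voronoi_domain_hermitian[OF T(1)] TF] .
  define c where "c = (R' \<bullet> T) / (R \<bullet> T)"
  have "R' - c *\<^sub>R R \<in> span (insert T F)" unfolding span using r(1) r'(1)
    by (simp add: subspace_diff[OF subspace_hermitian] subspace_scale[OF subspace_hermitian])
  then have "R' - c *\<^sub>R R = 0"
    by (rule orthogonal_span_eq_0) (use r(3) r'(3) T(2) in \<open>auto simp: inner_diff_left c_def\<close>)
  then have eq: "R' = c *\<^sub>R R" by simp
  moreover have "c \<ge> 0" using r(4)[OF T(1)] r'(4)[OF T(1)] by (simp add: c_def)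
  moreover have "c \<noteq> 0" using eq r'(2) by auto
  ultimately show thesis using that[of c] by simp
qed

text \<open>At a minimal vector of the middle form, the value along the ray is affine in the
  parameter, equals the minimum at s and is at least the minimum at 0 and at t; it is therefore
  constant. So R vanishes on the minimal vectors of a perfect form.\<close>

lemma no_perfect_between:
  assumes A: "A \<in> positive_forms" and R: "R \<in> hermitian_matrices" "R \<noteq> 0"
    and st: "0 < s" "s < t"
    and B: "perfect (A + s *\<^sub>R R)" "mn (A + s *\<^sub>R R) = mn A"
    and C: "A + t *\<^sub>R R \<in> positive_forms" "mn (A + t *\<^sub>R R) = mn A"
  shows False
proof -
  have "fval R x = 0" if "x \<in> MV (A + s *\<^sub>R R)" for x
  proof -
    have x: "x \<in> L0" "nval A x + s * (nval R x) = mn A"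
      using that B(2) by (auto simp: MV_iff inner_add_left)
    have "mn A \<le> nval A x" using lattice_min_le[OF A x(1)] .
    then have "s * (nval R x) \<le> 0" using x(2) by linarith
    then have le: "nval R x \<le> 0" using st(1) by (simp add: mult_le_0_iff)
    have "mn A \<le> nval A x + t * (nval R x)"
      using lattice_min_le[OF C(1) x(1)] C(2) by (simp add: inner_add_left)
    then have "0 \<le> (t - s) * (nval R x)" using x(2) by (simp add: algebra_simps)
    then have "0 \<le> nval R x" using st(2) by (simp add: zero_le_mult_iff)
    then have "nval R x = 0" using le by linarith
    then show ?thesis using inner_rank_one_sign(3)[OF x(1)] by blast
  qed
  then show False using perfect_eqI[OF B(1) R(1)] R(2) by blast
qed

text \<open>By uniqueness of facet vectors both forms lie on one ray from A, and neither can lie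
  strictly between A and the other. With finitely many facets this makes the contiguous forms finite
  in number.\<close>

lemma contiguous_unique:
  assumes P: "perfect A" and F: "F facet_of VD A"
    and B: "contiguous_through K \<aa> l A F B" and C: "contiguous_through K \<aa> l A F C"
  shows "B = C"
proof -
  obtain R s where R: "facet_vector K \<aa> l A F R" "s > 0" "B = A + s *\<^sub>R R"
    and pB: "perfect B" "mn B = mn A" using B by (auto simp: contiguous_through_def)
  obtain R' s' where R': "facet_vector K \<aa> l A F R'" "s' > 0" "C = A + s' *\<^sub>R R'"
    and pC: "perfect C" "mn C = mn A" using C by (auto simp: contiguous_through_def)
  obtain c where c: "c > 0" "R' = c *\<^sub>R R" using facet_vector_unique[OF P F R(1) R'(1)] .
  define t where "t = s' * c"
  have Ceq: "C = A + t *\<^sub>R R" and t: "t > 0" using R' c by (auto simp: t_def)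
  note r = facet_vector_inner(1,2)[OF R(1) F]
  have "\<not> s < t"
    using no_perfect_between[OF perfect_positive[OF P] r R(2), of t] pB pC perfect_positive
    unfolding R(3) Ceq by blast
  moreover have "\<not> t < s"
    using no_perfect_between[OF perfect_positive[OF P] r t, of s] pB pC perfect_positive
    unfolding R(3) Ceq by blast
  ultimately show ?thesis using R(3) Ceq by (metis linorder_neqE_linordered_idom)
qed

lemma finite_contiguous_forms:
  assumes P: "perfect A"
  shows "finite (contiguous A)"
proof (rule finite_subset)
  show "contiguous A
      \<subseteq> (\<lambda>F. THE B. contiguous_through K \<aa> l A F B) ` {F. F facet_of VD A}"
  proof
    fix B assume "B \<in> contiguous A"
    then obtain F where F: "F facet_of VD A" "contiguous_through K \<aa> l A F B"
      by (auto simp: contiguous_forms_def)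
    then have "(THE B. contiguous_through K \<aa> l A F B) = B"
      using contiguous_unique[OF P F(1)] by (intro the_equality) auto
    then show "B \<in> (\<lambda>F. THE B. contiguous_through K \<aa> l A F B) ` {F. F facet_of VD A}"
      using F(1) by (metis (mono_tags, lifting) imageI mem_Collect_eq)
  qed
  show "finite ((\<lambda>F. THE B. contiguous_through K \<aa> l A F B) ` {F. F facet_of VD A})"
    by (intro finite_imageI finite_polyhedron_facets polyhedron_voronoi_domain perfect_positive P)
qed

text \<open>In an irredundant half-space description relative to the affine hull, every half-space
  cuts out a facet. The one violated by Q supplies R as the negative of its normal; its boundary
  passes through 0 because the facet does, and parallelism to the hull makes the normal
  Hermitian.\<close>

lemma voronoi_domain_separation:
  assumes P: "perfect A" and Q: "Q \<in> hermitian_matrices" "Q \<notin> VD A"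
  obtains F R where "F facet_of VD A" "facet_vector K \<aa> l A F R" "R \<bullet> Q < 0"
proof -
  let ?V = "VD A"
  have A: "A \<in> positive_forms" using perfect_positive[OF P] .
  have 0: "0 \<in> ?V" using convex_cone_voronoi_domain[OF A] by (simp add: convex_cone_contains_0)
  have aff: "affine hull ?V = hermitian_matrices"
    using affine_hull_span_0[OF hull_inc[OF 0]] perfect_span[OF P] by simp
  obtain H where H: "finite H" "?V = affine hull ?V \<inter> \<Inter>H"
    "\<forall>h\<in>H. \<exists>a b. a \<noteq> 0 \<and> h = {x. a \<bullet> x \<le> b} \<and> (\<forall>x\<in>affine hull ?V. x + a \<in> affine hull ?V)"
    "\<forall>H'. H' \<subset> H \<longrightarrow> ?V \<subset> affine hull ?V \<inter> \<Inter>H'"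
    using polyhedron_voronoi_domain[OF A] unfolding polyhedron_Int_affine_parallel_minimal by blast
  obtain a b where ab: "\<And>h. h \<in> H \<Longrightarrow> a h \<noteq> 0" "\<And>h. h \<in> H \<Longrightarrow> h = {x. a h \<bullet> x \<le> b h}"
    "\<And>h x. h \<in> H \<Longrightarrow> x \<in> affine hull ?V \<Longrightarrow> x + a h \<in> affine hull ?V" using H(3) by metis
  obtain h where h: "h \<in> H" "Q \<notin> h" using Q H(2) unfolding aff by blast
  define F where "F = ?V \<inter> {x. a h \<bullet> x = b h}"
  have F: "F facet_of ?V"
    using facet_of_polyhedron_explicit[OF H(1,2), of a b F] ab(1,2) H(4) h(1) unfolding F_def by blast
  then have "0 \<in> F" using facet_contains_0[OF A] by blast
  then have b0: "b h = 0" by (simp add: F_def)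
  have VH: "a h \<bullet> T \<le> 0" if "T \<in> ?V" for T
  proof -
    have "T \<in> h" using that H(2) h(1) by blast
    then show ?thesis using ab(2)[OF h(1)] b0 by auto
  qed
  have "0 + a h \<in> hermitian_matrices" using ab(3)[OF h(1), of 0] 0 hull_inc[of 0 ?V] aff by blast
  then have aH: "- a h \<in> hermitian_matrices" by (simp add: subspace_neg[OF subspace_hermitian])
  have "facet_vector K \<aa> l A F (- a h)" unfolding facet_vector_def
  proof (intro conjI ballI)
    show "- a h \<noteq> 0" using ab(1)[OF h(1)] by simp
    fix T assume "T \<in> F"
    then show "trace_product (- a h) T = 0"
      using b0 voronoi_domain_hermitian[of T] by (auto simp: F_def trace_product_inner)
  next
    fix T assume "T \<in> ?V"
    then show "0 \<le> trace_product (- a h) T"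
      using VH voronoi_domain_hermitian[of T] by (simp add: trace_product_inner)
  qed (rule aH)
  moreover have "- a h \<bullet> Q < 0" using h(2) ab(2)[OF h(1)] b0 by auto
  ultimately show thesis using that F by blast
qed

text \<open>The pairing of T with R is a sum of nonnegative terms, so only generators on which R
  vanishes occur in T with positive coefficient.\<close>

lemma facet_in_span:
  assumes R: "\<And>x. x \<in> MV A \<Longrightarrow> 0 \<le> fval R x" and T: "T \<in> VD A" "R \<bullet> T = 0"
  shows "T \<in> span (rank_one ` {x \<in> MV A. fval R x = 0})"
proof (cases "finite (MC A)")
  case True
  obtain \<mu> where \<mu>: "T = (\<Sum>c\<in>MC A. \<mu> c *\<^sub>R class_matrix c)" "\<forall>c\<in>MC A. 0 \<le> \<mu> c"
    using T(1) by (auto simp: voronoi_domain_def)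
  have nn: "0 \<le> R \<bullet> class_matrix c" if "c \<in> MC A" for c using class_matrix_eq[OF that] R by auto
  have "(\<Sum>c\<in>MC A. \<mu> c * (R \<bullet> class_matrix c)) = 0" using T(2) by (simp add: \<mu>(1) inner_sum_right)
  then have z: "\<mu> c * (R \<bullet> class_matrix c) = 0" if "c \<in> MC A" for c
    using sum_nonneg_eq_0_iff[OF True, of "\<lambda>c. \<mu> c * (R \<bullet> class_matrix c)"] \<mu>(2) nn that by simp
  have "\<mu> c *\<^sub>R class_matrix c \<in> span (rank_one ` {x \<in> MV A. fval R x = 0})" if c: "c \<in> MC A" for c
  proof (cases "\<mu> c = 0")
    case False
    obtain x where x: "x \<in> MV A" "class_matrix c = rank_one x" using class_matrix_eq[OF c] by blast
    then have "fval R x = 0" using z[OF c] False by simp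
    then have "rank_one x \<in> rank_one ` {x \<in> MV A. fval R x = 0}" using x by blast
    then show ?thesis unfolding x(2) by (intro span_scale span_base)
  qed (simp add: span_zero)
  then show ?thesis unfolding \<mu>(1) by (rule span_sum)
next
  case False
  \<comment> \<open>Sums over infinite index sets are 0, so T = 0 here.\<close>
  then show ?thesis using T(1) by (auto simp: voronoi_domain_def span_zero)
qed

text \<open>The hypothesis on \<open>Q\<close> says that it lies in the closed cone spanned by the \<open>x\<^sup>* x\<close>. If \<open>R\<close>
  is a facet vector with \<open>Tr(R Q) < 0\<close>, the contiguous form through that facet exists.\<close>

lemma contiguous_descent:
  assumes P: "perfect A" and Q: "Q \<in> hermitian_matrices" "Q \<notin> VD A"
    and cone: "\<And>R. (\<And>x. x \<in> L0 \<Longrightarrow> 0 \<le> fval R x) \<Longrightarrow> 0 \<le> R \<bullet> Q"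
  obtains B where "B \<in> contiguous A" "B \<bullet> Q < A \<bullet> Q"
proof -
  have A: "A \<in> positive_forms" using perfect_positive[OF P] .
  obtain F R where F: "F facet_of VD A" and R: "facet_vector K \<aa> l A F R" and RQ: "R \<bullet> Q < 0"
    using voronoi_domain_separation[OF P Q] .
  note r = facet_vector_inner[OF R F]
  obtain x0 where x0: "x0 \<in> L0" "fval R x0 < 0" using cone[of R] RQ by (meson not_le)
  have nonneg: "0 \<le> fval R x" if "x \<in> MV A" for x
    using r(4) rank_one_in_voronoi_domain[OF A that] by blast
  have "0 \<le> nval R x" if "x \<in> MV A" for x
    using nonneg[OF that] inner_rank_one_sign(1)[of x R] that MV_iff by blast
  moreover have "nval R x0 < 0" using x0 inner_rank_one_sign(2) by blast
  ultimately obtain \<rho> x1 where \<rho>: "\<rho> > 0"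
    "\<And>t. 0 \<le> t \<Longrightarrow> t \<le> \<rho> \<Longrightarrow> A + t *\<^sub>R R \<in> positive_forms"
    "\<And>t x. 0 \<le> t \<Longrightarrow> t \<le> \<rho> \<Longrightarrow> x \<in> L0 \<Longrightarrow> mn A \<le> nval (A + t *\<^sub>R R) x"
    "x1 \<in> L0" "nval (A + \<rho> *\<^sub>R R) x1 = mn A" "nval R x1 < 0"
    using advance[OF A r(1) _ x0(1)] by metis
  define B where "B = A + \<rho> *\<^sub>R R"
  have Bp: "B \<in> positive_forms" using \<rho>(1,2) by (simp add: B_def)
  have mB: "mn B = mn A" using lattice_min_eqI[OF \<rho>(4,5)] \<rho>(1,3) unfolding B_def by simp
  have x1: "x1 \<in> MV B" using \<rho>(4,5) mB by (simp add: MV_iff B_def)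
  have sub: "x \<in> MV B" if "x \<in> MV A" "fval R x = 0" for x
    using that mB by (simp add: MV_iff B_def inner_add_left inner_nrank_one)
  \<comment> \<open>The minimal vectors at which R vanishes stay minimal for B, and the span of
    their matrices contains F; the new vector x1, where R is negative, supplies the missing
    dimension.\<close>
  have FB: "F \<subseteq> span (rank_one ` MV B)"
  proof
    fix T assume T: "T \<in> F"
    then have "T \<in> span (rank_one ` {x \<in> MV A. fval R x = 0})"
      using facet_in_span[OF nonneg] r(3) facet_of_imp_subset[OF F] by blast
    moreover have "rank_one ` {x \<in> MV A. fval R x = 0} \<subseteq> rank_one ` MV B" using sub by blast
    ultimately show "T \<in> span (rank_one ` MV B)" using span_mono by blast
  qed
  have "fval R x1 < 0" using inner_rank_one_sign(2)[OF \<rho>(4)] \<rho>(6) by blast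
  then have "rank_one x1 \<notin> span F" using inner_span_eq_0[OF _ r(3)] by fastforce
  then have "span (insert (rank_one x1) F) = hermitian_matrices"
    using facet_insert_span[OF P F rank_one_hermitian] by blast
  moreover have "rank_one x1 \<in> span (rank_one ` MV B)" using x1 by (intro span_base) blast
  then have "span (insert (rank_one x1) F) \<subseteq> span (rank_one ` MV B)"
    using FB by (intro span_minimal) auto
  ultimately have "perfect B" using Bp rank_one_MV_hermitian[of B] by (auto simp: perfect_form_iff)
  then have "contiguous_through K \<aa> l A F B"
    unfolding contiguous_through_def using R \<rho>(1) mB B_def by blast
  then have "B \<in> contiguous A" using F by (auto simp: contiguous_forms_def)
  moreover have "B \<bullet> Q < A \<bullet> Q" using RQ \<rho>(1) by (simp add: B_def inner_add_left mult_pos_neg)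
  ultimately show thesis using that by blast
qed

end


section \<open>Equivalence\<close>

lemma conj_transpose_mult: "conj_transpose (A ** B) = conj_transpose B ** conj_transpose A"
  by (simp add: conj_transpose_def matrix_matrix_mult_def vec_eq_iff mult.commute)

lemma conj_transpose_conj_transpose [simp]: "conj_transpose (conj_transpose A) = A"
  by (simp add: conj_transpose_def vec_eq_iff)

lemma conj_transpose_mat_1 [simp]: "conj_transpose (mat 1) = mat 1"
  by (simp add: conj_transpose_def vec_eq_iff mat_def)

lemma matrix_mult_row: "(A ** B) $ i = (A $ i) v* B"
  by (simp add: matrix_matrix_mult_def vector_matrix_mult_def vec_eq_iff)

lemma vector_matrix_mult_sum: "t v* X = (\<Sum>j\<in>UNIV. t $ j *s X $ j)"
  by (simp add: vector_matrix_mult_def vec_eq_iff)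

definition congruent_form :: "complex^'n^'n \<Rightarrow> complex^'n^'n \<Rightarrow> complex^'n^'n" where
  "congruent_form U A = U ** A ** conj_transpose U"

lemma congruent_form_hermitian: "A \<in> hermitian_matrices \<Longrightarrow> congruent_form U A \<in> hermitian_matrices"
  by (simp add: hermitian_matrices_def congruent_form_def conj_transpose_mult matrix_mul_assoc)

lemma congruent_form_mult: "congruent_form U (congruent_form V A) = congruent_form (U ** V) A"
  by (simp add: congruent_form_def conj_transpose_mult matrix_mul_assoc)

lemma congruent_form_1 [simp]: "congruent_form (mat 1) A = A" by (simp add: congruent_form_def)

lemma congruent_form_scaleR: "congruent_form U (r *\<^sub>R A) = r *\<^sub>R congruent_form U A"
  by (simp add: congruent_form_def matrix_matrix_mult_def vec_eq_iff flip: scaleR_sum_right)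

lemma inner_congruent_form: "fval (congruent_form U A) x = fval A (x v* U)"
proof -
  have adj: "(\<Sum>j\<in>UNIV. (w v* conj_transpose U) $ j * cnj (x $ j)) = (\<Sum>i\<in>UNIV. w $ i * cnj ((x v* U) $ i))"
    for w
  proof -
    have "(\<Sum>j\<in>UNIV. (w v* conj_transpose U) $ j * cnj (x $ j))
        = (\<Sum>j\<in>UNIV. \<Sum>i\<in>UNIV. w $ i * (cnj (U $ j $ i) * cnj (x $ j)))"
      by (simp add: vector_matrix_mult_def conj_transpose_def sum_distrib_right mult.assoc)
    also have "\<dots> = (\<Sum>i\<in>UNIV. \<Sum>j\<in>UNIV. w $ i * (cnj (U $ j $ i) * cnj (x $ j)))" by (rule sum.swap)
    also have "\<dots> = (\<Sum>i\<in>UNIV. w $ i * cnj ((x v* U) $ i))"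
      by (simp add: vector_matrix_mult_def sum_distrib_left mult.commute)
    finally show ?thesis .
  qed
  have "form_value (congruent_form U A) x = form_value A (x v* U)"
    unfolding form_value_def congruent_form_def by (simp add: adj flip: vector_matrix_mul_assoc)
  then show ?thesis by (simp only: form_value_inner)
qed

context steinitz
begin

section \<open>Lattice automorphisms and invariance of perfection\<close>

abbreviation equivalent (infix "\<asymp>" 50) where "A \<asymp> B \<equiv> equivalent_forms K \<aa> l A B"

abbreviation "Aut \<equiv> lattice_automorphisms K \<aa> l"

lemma Aut_iff:
  "U \<in> Aut \<longleftrightarrow> (\<forall>i j. U $ i $ j \<in> K) \<and> (\<exists>V. (\<forall>i j. V $ i $ j \<in> K) \<and> U ** V = mat 1 \<and> V ** U = mat 1)
     \<and> (\<lambda>x. x v* U) ` L = L" by (simp add: lattice_automorphisms_def)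

lemma Aut_inverse:
  assumes "U \<in> Aut"
  obtains V where "V \<in> Aut" "U ** V = mat 1" "V ** U = mat 1"
proof -
  obtain V where V: "\<forall>i j. V $ i $ j \<in> K" "U ** V = mat 1" "V ** U = mat 1" using assms by (auto simp: Aut_iff)
  have "(\<lambda>x. x v* V) ` L = (\<lambda>x. x v* V) ` (\<lambda>x. x v* U) ` L" using assms by (simp add: Aut_iff)
  also have "\<dots> = L" by (simp add: image_image vector_matrix_mul_assoc V)
  finally have "V \<in> Aut" using V assms by (auto simp: Aut_iff)
  then show thesis using that V by blast
qed

lemma Aut_mult:
  assumes "U \<in> Aut" "V \<in> Aut"
  shows "U ** V \<in> Aut"
proof -
  obtain U' where U': "U' \<in> Aut" "U ** U' = mat 1" "U' ** U = mat 1" using Aut_inverse[OF assms(1)] .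
  obtain V' where V': "V' \<in> Aut" "V ** V' = mat 1" "V' ** V = mat 1" using Aut_inverse[OF assms(2)] .
  have K: "(A ** B) $ i $ j \<in> K" if "A \<in> Aut" "B \<in> Aut" for A B :: "complex^'n^'n" and i j
    using that by (auto simp: Aut_iff matrix_matrix_mult_def intro!: K_sum K_mult)
  have "(U ** V) ** (V' ** U') = U ** (V ** V') ** U'" by (simp only: matrix_mul_assoc)
  then have 1: "(U ** V) ** (V' ** U') = mat 1" using U' V' by simp
  have "(V' ** U') ** (U ** V) = V' ** (U' ** U) ** V" by (simp only: matrix_mul_assoc)
  then have 2: "(V' ** U') ** (U ** V) = mat 1" using U' V' by simp
  have "(\<lambda>x. x v* (U ** V)) ` L = (\<lambda>x. x v* V) ` (\<lambda>x. x v* U) ` L"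
    by (simp add: image_image vector_matrix_mul_assoc)
  also have "\<dots> = L" using assms by (simp add: Aut_iff)
  finally show ?thesis unfolding Aut_iff using 1 2 K assms U' V' by blast
qed

lemma Aut_1: "mat 1 \<in> Aut"
proof -
  have "(mat 1 :: complex^'n^'n) $ i $ j \<in> K" for i j by (simp add: mat_def K_0 K_1)
  moreover have "mat 1 ** mat 1 = (mat 1 :: complex^'n^'n)" by simp
  moreover have "(\<lambda>x. x v* mat 1) ` L = L" by simp
  ultimately show ?thesis unfolding Aut_iff by blast
qed

lemma Aut_L: "U \<in> Aut \<Longrightarrow> x \<in> L \<Longrightarrow> x v* U \<in> L" unfolding Aut_iff by blast

lemma Aut_cancel: "U ** V = mat 1 \<Longrightarrow> (x v* U) v* V = x" for U V :: "complex^'n^'n"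
  by (simp add: vector_matrix_mul_assoc)

lemma Aut_L0:
  assumes "U \<in> Aut" "x \<in> L0"
  shows "x v* U \<in> L0"
proof -
  obtain V where "U ** V = mat 1" using Aut_inverse[OF assms(1)] .
  then have "x v* U \<noteq> 0" using Aut_cancel[of U V x] assms(2) by auto
  then show ?thesis using Aut_L[OF assms(1)] assms(2) by blast
qed

text \<open>This description refers to \<open>L\<close> as a whole, hence is preserved by lattice
  automorphisms; that is what makes N(\<aa>_x) invariant. The converse is tested on vectors with a
  single nonzero entry.\<close>

lemma dual_lattice_iff_pairing:
  "y \<in> dual_lattice \<longleftrightarrow> (\<forall>j. y j \<in> K) \<and> (\<forall>x\<in>L. (\<Sum>j\<in>UNIV. x $ j * y j) \<in> OK)"
proof
  assume y: "y \<in> dual_lattice"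
  have "y j \<in> K" for j
    using y O_K by (cases "j = l") (auto simp: dual_lattice_iff ideal_inverse_def)
  then show "(\<forall>j. y j \<in> K) \<and> (\<forall>x\<in>L. (\<Sum>j\<in>UNIV. x $ j * y j) \<in> OK)"
    using dual_lattice_pairing y by blast
next
  assume y: "(\<forall>j. y j \<in> K) \<and> (\<forall>x\<in>L. (\<Sum>j\<in>UNIV. x $ j * y j) \<in> OK)"
  have pair: "(\<Sum>j\<in>UNIV. axis i c $ j * y j) = c * y i" for i c
  proof -
    have "(\<Sum>j\<in>UNIV. axis i c $ j * y j) = (\<Sum>j\<in>UNIV. if j = i then c * y i else 0)"
      by (rule sum.cong) (auto simp: axis_def)
    then show ?thesis by simp
  qed
  have "y j \<in> OK" if "j \<noteq> l" for j
  proof -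
    have "axis j 1 \<in> L" using that ideal_0[OF ideal_\<aa>] by (auto simp: L_iff axis_def)
    then show ?thesis using y pair[of j 1] by force
  qed
  moreover have "z * y l \<in> OK" if "z \<in> \<aa>" for z
  proof -
    have "axis l z \<in> L" using that by (auto simp: L_iff axis_def)
    then show ?thesis using y pair[of l z] by force
  qed
  ultimately show "y \<in> dual_lattice" using y by (auto simp: dual_lattice_iff ideal_inverse_def mult.commute)
qed

lemma vector_ideal_Aut_subset:
  assumes "U \<in> Aut"
  shows "vid (x v* U) \<subseteq> vid x"
proof
  have swap: "(\<Sum>j\<in>UNIV. (z v* U) $ j * y j) = (\<Sum>i\<in>UNIV. z $ i * (\<Sum>j\<in>UNIV. U $ i $ j * y j))" for z y
  proof -
    have "(\<Sum>j\<in>UNIV. (z v* U) $ j * y j) = (\<Sum>j\<in>UNIV. \<Sum>i\<in>UNIV. z $ i * (U $ i $ j * y j))"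
      by (simp add: vector_matrix_mult_def sum_distrib_right mult.assoc)
    also have "\<dots> = (\<Sum>i\<in>UNIV. \<Sum>j\<in>UNIV. z $ i * (U $ i $ j * y j))" by (rule sum.swap)
    finally show ?thesis by (simp add: sum_distrib_left)
  qed
  fix u assume "u \<in> vid (x v* U)"
  then obtain y where y: "y \<in> dual_lattice" "u = (\<Sum>j\<in>UNIV. (x v* U) $ j * y j)"
    unfolding vector_ideal_eq by blast
  have "(\<lambda>i. \<Sum>j\<in>UNIV. U $ i $ j * y j) \<in> dual_lattice" unfolding dual_lattice_iff_pairing
  proof (intro conjI allI ballI)
    fix i show "(\<Sum>j\<in>UNIV. U $ i $ j * y j) \<in> K"
      using assms y(1) by (intro K_sum K_mult) (auto simp: Aut_iff dual_lattice_iff_pairing)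
  next
    fix z assume "z \<in> L"
    then show "(\<Sum>i\<in>UNIV. z $ i * (\<Sum>j\<in>UNIV. U $ i $ j * y j)) \<in> OK"
      using dual_lattice_pairing[OF Aut_L[OF assms] y(1)] by (simp add: swap)
  qed
  then show "u \<in> vid x" unfolding y(2) swap by (rule vector_idealI)
qed

lemma vnorm_Aut:
  assumes "U \<in> Aut"
  shows "vnorm (x v* U) = vnorm x"
proof -
  obtain V where V: "V \<in> Aut" "U ** V = mat 1" using Aut_inverse[OF assms] .
  have "vid x = vid (x v* U)"
    using vector_ideal_Aut_subset[OF assms, of x] vector_ideal_Aut_subset[OF V(1), of "x v* U"]
      Aut_cancel[OF V(2), of x] by simp
  then show ?thesis by (simp add: vnorm_def)
qed

lemma inner_congruent_form_nrank_one:
  "U \<in> Aut \<Longrightarrow> nval (congruent_form U A) x = nval A (x v* U)"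
  by (simp add: inner_nrank_one inner_congruent_form vnorm_Aut)

lemma equivalent_forms_iff:
  "A \<asymp> B \<longleftrightarrow> (\<exists>\<alpha>>0. \<exists>U\<in>Aut. B = \<alpha> *\<^sub>R congruent_form U A)"
  by (simp add: equivalent_forms_def congruent_form_def)

lemma equivalent_forms_sym:
  assumes "A \<asymp> B"
  shows "B \<asymp> A"
proof -
  obtain \<alpha> U where \<alpha>: "\<alpha> > 0" and U: "U \<in> Aut" and B: "B = \<alpha> *\<^sub>R congruent_form U A"
    using assms by (auto simp: equivalent_forms_iff)
  obtain V where V: "V \<in> Aut" "U ** V = mat 1" "V ** U = mat 1" using Aut_inverse[OF U] .
  have "A = (1 / \<alpha>) *\<^sub>R congruent_form V B"
    using \<alpha> V by (simp add: B congruent_form_scaleR congruent_form_mult)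
  then show ?thesis unfolding equivalent_forms_iff using \<alpha> V(1) by (intro exI[of _ "1 / \<alpha>"]) auto
qed

lemma equivalent_forms_trans:
  assumes "A \<asymp> B" "B \<asymp> C"
  shows "A \<asymp> C"
proof -
  obtain \<alpha> U where \<alpha>: "\<alpha> > 0" and U: "U \<in> Aut" and B: "B = \<alpha> *\<^sub>R congruent_form U A"
    using assms(1) by (auto simp: equivalent_forms_iff)
  obtain \<beta> V where \<beta>: "\<beta> > 0" and V: "V \<in> Aut" and C: "C = \<beta> *\<^sub>R congruent_form V B"
    using assms(2) by (auto simp: equivalent_forms_iff)
  have "C = (\<beta> * \<alpha>) *\<^sub>R congruent_form (V ** U) A"
    by (simp add: B C congruent_form_scaleR congruent_form_mult)
  then show ?thesis unfolding equivalent_forms_iff using \<alpha> \<beta> Aut_mult[OF V U]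
    by (intro exI[of _ "\<beta> * \<alpha>"]) auto
qed

lemma equivalent_forms_scaleR: "\<alpha> > 0 \<Longrightarrow> A \<asymp> (\<alpha> *\<^sub>R A)"
  unfolding equivalent_forms_iff using Aut_1 by (intro exI[of _ \<alpha>]) (auto intro: bexI[of _ "mat 1"])

lemma equivalent_forms_congruent: "U \<in> Aut \<Longrightarrow> \<alpha> > 0 \<Longrightarrow> A \<asymp> (\<alpha> *\<^sub>R congruent_form U A)"
  unfolding equivalent_forms_iff by blast

lemma perfect_congruent:
  assumes P: "perfect A" and \<alpha>: "\<alpha> > 0" and U: "U \<in> Aut"
  shows "perfect (\<alpha> *\<^sub>R congruent_form U A)" "mn (\<alpha> *\<^sub>R congruent_form U A) = \<alpha> * mn A"
proof -
  define B where "B = \<alpha> *\<^sub>R congruent_form U A"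
  obtain V where V: "V \<in> Aut" "U ** V = mat 1" "V ** U = mat 1" using Aut_inverse[OF U] .
  have A: "A \<in> positive_forms" using perfect_positive[OF P] .
  have herm: "B \<in> hermitian_matrices"
    unfolding B_def using congruent_form_hermitian[OF positive_forms_hermitian[OF A]]
    by (rule subspace_scale[OF subspace_hermitian])
  have pos: "B \<in> positive_forms" unfolding positive_forms_iff
  proof (intro conjI allI impI)
    fix x :: "complex^'n" assume "x \<noteq> 0"
    then have "x v* U \<noteq> 0" using Aut_cancel[OF V(2), of x] by auto
    then show "0 < fval B x" using A \<alpha> by (simp add: B_def inner_congruent_form positive_forms_iff)
  qed (rule herm)
  have val: "nval B x = \<alpha> * (nval A (x v* U))" for x
    by (simp add: B_def inner_congruent_form_nrank_one[OF U])
  obtain x where x: "x \<in> L0" "nval A x = mn A" using lattice_min_attained[OF A] by blast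
  have mn: "mn B = \<alpha> * mn A"
  proof (rule lattice_min_eqI)
    show "x v* V \<in> L0" using Aut_L0[OF V(1) x(1)] .
    show "nval B (x v* V) = \<alpha> * mn A" by (simp add: val Aut_cancel[OF V(3)] x(2))
    fix y assume "y \<in> L0"
    then show "\<alpha> * mn A \<le> nval B y" using lattice_min_le[OF A Aut_L0[OF U]] \<alpha> by (simp add: val)
  qed
  have MV: "y v* V \<in> MV B" if "y \<in> MV A" for y
    using that Aut_L0[OF V(1), of y] by (simp add: MV_iff val mn Aut_cancel[OF V(3)])
  have "span (rank_one ` MV B) = hermitian_matrices"
  proof (rule span_eq_hermitianI)
    show "rank_one ` MV B \<subseteq> hermitian_matrices" using rank_one_hermitian by blast
    fix R assume R: "R \<in> hermitian_matrices" "\<And>s. s \<in> rank_one ` MV B \<Longrightarrow> R \<bullet> s = 0"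
    \<comment> \<open>V maps the minimal vectors of A to minimal vectors of B, so R pulls back to a
      form vanishing on all minimal vectors of the perfect form A.\<close>
    have "congruent_form V R = 0"
      by (rule perfect_eqI[OF P congruent_form_hermitian[OF R(1)]]) (simp add: inner_congruent_form R(2) MV)
    then have "congruent_form U (congruent_form V R) = congruent_form U (0 *\<^sub>R 0)" by simp
    then show "R = 0" unfolding congruent_form_scaleR by (simp add: congruent_form_mult V(2))
  qed
  then show "perfect (\<alpha> *\<^sub>R congruent_form U A)" using pos unfolding B_def perfect_form_iff by blast
  show "mn (\<alpha> *\<^sub>R congruent_form U A) = \<alpha> * mn A" using mn by (simp add: B_def)
qed

section \<open>Normalized perfect forms in bounded sets\<close>

lemma perfect_scaleR:
  assumes "perfect A" "\<alpha> > 0"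
  shows "perfect (\<alpha> *\<^sub>R A)" "mn (\<alpha> *\<^sub>R A) = \<alpha> * mn A"
  using perfect_congruent[OF assms Aut_1] by simp_all

lemma perfect_normalize:
  assumes "perfect A"
  obtains \<alpha> where "\<alpha> > 0" "perfect (\<alpha> *\<^sub>R A)" "mn (\<alpha> *\<^sub>R A) = 1"
proof -
  have "mn A > 0" using lattice_min_pos perfect_positive assms by blast
  then show thesis using perfect_scaleR[OF assms, of "1 / mn A"] by (intro that[of "1 / mn A"]) auto
qed

lemma perfect_eq_if_MV:
  assumes "perfect A" "B \<in> hermitian_matrices"
    and "\<And>x. x \<in> MV A \<Longrightarrow> nval B x = nval A x"
  shows "B = A"
proof -
  have "B - A = 0"
  proof (rule perfect_eqI[OF assms(1)])
    show "B - A \<in> hermitian_matrices"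
      using assms(2) positive_forms_hermitian[OF perfect_positive[OF assms(1)]]
      by (rule subspace_diff[OF subspace_hermitian])
    fix x assume x: "x \<in> MV A"
    then have "x \<in> L0" using MV_iff by blast
    then show "fval (B - A) x = 0"
      using assms(3)[OF x] inner_rank_one_sign(3)[of x "B - A"] by (simp add: inner_diff_left)
  qed
  then show ?thesis by simp
qed

text \<open>The conditions defining C are closed, and by the lower bound 1 on all values C still
  consists of positive definite forms; compactness gives a common coercivity constant. So the
  normalized minimal matrices all lie in one finite set E, and a perfect form of minimum one is
  determined by the subset it uses.\<close>

lemma finite_bounded_perfect:
  assumes "bounded S"
  shows "finite {A \<in> S. perfect A \<and> mn A = 1}" (is "finite ?P")
proof -
  obtain b where b: "\<And>A. A \<in> S \<Longrightarrow> norm A \<le> b" using assms by (auto simp: bounded_iff)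
  define C where "C = cball 0 b \<inter> (hermitian_matrices \<inter> (\<Inter>x\<in>L0. {A. 1 \<le> nval A x}))"
  have "closed {A. 1 \<le> nval A x}" for x by (intro closed_Collect_le continuous_intros)
  then have "compact C" unfolding C_def
    by (intro compact_Int_closed closed_Int closed_INT closed_subspace subspace_hermitian) auto
  moreover have "C \<subseteq> positive_forms"
  proof
    fix A assume "A \<in> C"
    then show "A \<in> positive_forms" using positive_if_bounded_below_on_L[of A 1] by (simp add: C_def)
  qed
  ultimately obtain c where c: "c > 0" "\<And>A. A \<in> C \<Longrightarrow> \<forall>x. c * (norm x)\<^sup>2 \<le> fval A x"
    using compact_positive_forms_bound[of C] by auto
  define E where "E = {d \<in> nrank_one ` L0. norm d \<le> 1 / c}"
  have fE: "finite (Pow E)" unfolding E_def using finite_nrank_one_ball by simp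
  have "nrank_one ` MV A \<subseteq> E" if AP: "A \<in> ?P" for A
  proof
    fix d assume "d \<in> nrank_one ` MV A"
    then obtain x where x: "x \<in> L0" "d = nrank_one x" "nval A x = 1" using AP by (auto simp: MV_iff)
    have A: "A \<in> positive_forms" using AP perfect_positive by blast
    have "A \<in> C"
      using AP b lattice_min_le[OF A] positive_forms_hermitian[OF A] by (auto simp: C_def)
    then have "c * norm d \<le> 1" using nrank_one_lower_bound[OF c(2) x(1), of A] x by simp
    then show "d \<in> E" using x c(1) by (auto simp: E_def field_simps)
  qed
  then have "(\<lambda>A. nrank_one ` MV A) ` ?P \<subseteq> Pow E" by blast
  moreover have "inj_on (\<lambda>A. nrank_one ` MV A) ?P"
  proof (rule inj_onI)
    fix A B assume A: "A \<in> ?P" and B: "B \<in> ?P" and eq: "nrank_one ` MV A = nrank_one ` MV B"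
    show "A = B"
    proof (rule perfect_eq_if_MV)
      show "perfect B" using B by blast
      show "A \<in> hermitian_matrices" using A perfect_positive positive_forms_hermitian by blast
      fix x assume x: "x \<in> MV B"
      then obtain y where y: "y \<in> MV A" "nrank_one x = nrank_one y" using eq by blast
      then show "nval A x = nval B x" using x A B by (simp add: MV_iff)
    qed
  qed
  ultimately show ?thesis by (rule finite_imageD[OF finite_subset[OF _ fE]])
qed

end


section \<open>Finiteness of perfect forms up to equivalence\<close>

lemma inner_rank_one_rank_one:
  "fval (rank_one v) y = (norm (\<Sum>i\<in>UNIV. y $ i * cnj (v $ i)))\<^sup>2"
proof -
  let ?h = "\<Sum>i\<in>UNIV. y $ i * cnj (v $ i)"
  have "fval (rank_one v) y
      = (\<Sum>i\<in>UNIV. \<Sum>j\<in>UNIV. Re ((y $ i * cnj (v $ i)) * cnj (y $ j * cnj (v $ j))))"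
    by (simp add: inner_vec_def rank_one_def complex_inner_cnj mult_ac)
  also have "\<dots> = Re (?h * cnj ?h)" by (simp only: Re_sum cnj_sum sum_product)
  also have "\<dots> = (norm ?h)\<^sup>2" by (metis Re_complex_of_real complex_norm_square)
  finally show ?thesis .
qed

text \<open>A vector real orthogonal to a complex subspace is complex orthogonal to it: pairing with
  y gives the real part, pairing with i y the imaginary part up to sign.\<close>

lemma complex_orthogonal_exists:
  fixes S :: "(complex^'n) set"
  assumes "vec.span S \<noteq> UNIV"
  obtains v where "v \<noteq> 0" "\<And>y. y \<in> S \<Longrightarrow> (\<Sum>i\<in>UNIV. y $ i * cnj (v $ i)) = 0"
proof -
  let ?W = "vec.span S"
  have scale: "r *\<^sub>R x \<in> ?W" if "x \<in> ?W" for r and x :: "complex^'n"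
  proof -
    have "r *\<^sub>R x = of_real r *s x" by (simp add: vec_eq_iff scaleR_conv_of_real[where 'a = complex])
    then show ?thesis using vec.span_scale[OF that] by simp
  qed
  have "subspace ?W" using scale by (auto simp: subspace_def vec.span_zero vec.span_add)
  then have W: "span ?W = ?W" by (simp add: span_eq_iff)
  have "span ?W \<subset> span UNIV" unfolding W using assms by auto
  then obtain v where v: "v \<noteq> 0" "\<And>y. y \<in> ?W \<Longrightarrow> orthogonal v y"
    using orthogonal_to_subspace_exists_gen[of ?W UNIV] unfolding W by auto
  have "(\<Sum>i\<in>UNIV. y $ i * cnj (v $ i)) = 0" if "y \<in> S" for y
  proof -
    have re: "inner v y = Re (\<Sum>i\<in>UNIV. y $ i * cnj (v $ i))" for y
      by (simp add: inner_vec_def inner_complex_def mult.commute)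
    have yW: "y \<in> ?W" "\<i> *s y \<in> ?W" using that by (auto intro: vec.span_scale vec.span_base)
    have "(\<Sum>i\<in>UNIV. (\<i> *s y) $ i * cnj (v $ i)) = \<i> * (\<Sum>i\<in>UNIV. y $ i * cnj (v $ i))"
      by (simp add: sum_distrib_left mult.assoc)
    then have "inner v (\<i> *s y) = - Im (\<Sum>i\<in>UNIV. y $ i * cnj (v $ i))" unfolding re by simp
    then show ?thesis using v(2)[OF yW(1)] v(2)[OF yW(2)] re[of y] by (simp add: orthogonal_def complex_eq_iff)
  qed
  then show thesis using that v(1) by blast
qed

context steinitz
begin

text \<open>If the minimal vectors of bounded norm failed to span, some nonzero v would be
  orthogonal to all of them; then the form \<open>rank_one v\<close>, whose value at y is the
  squared modulus of the pairing of y with v, would vanish on every minimal vector, contradicting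
  perfection.\<close>

lemma minimal_basis:
  assumes P: "perfect A" and m: "mn A = 1"
    and C: "\<And>x. x \<in> L0 \<Longrightarrow> \<exists>\<kappa>\<in>K. \<kappa> \<noteq> 0 \<and> \<kappa> *s x \<in> L0 \<and> vnorm (\<kappa> *s x) \<le> C"
  obtains X Y :: "complex^'n^'n"
  where "X ** Y = mat 1" "Y ** X = mat 1" "\<And>j. X $ j \<in> L0" "\<And>j. fval A (X $ j) \<le> C"
proof -
  define S where "S = {x \<in> MV A. vnorm x \<le> C}"
  have span: "vec.span S = UNIV"
  proof (rule ccontr)
    assume "vec.span S \<noteq> UNIV"
    then obtain v where v: "v \<noteq> 0" "\<And>y. y \<in> S \<Longrightarrow> (\<Sum>i\<in>UNIV. y $ i * cnj (v $ i)) = 0"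
      using complex_orthogonal_exists by metis
    have "fval (rank_one v) y = 0" if y: "y \<in> MV A" for y
    proof -
      have yL: "y \<in> L0" using y MV_iff by blast
      obtain \<kappa> where k: "\<kappa> \<in> K" "\<kappa> \<noteq> 0" "\<kappa> *s y \<in> L0" "vnorm (\<kappa> *s y) \<le> C" using C[OF yL] by blast
      have "\<kappa> *s y \<in> S" using y k nrank_one_smult[OF yL k(1-3)] by (simp add: S_def MV_iff)
      then have "fval (rank_one v) (\<kappa> *s y) = 0" by (simp only: inner_rank_one_rank_one v(2)) simp
      then show ?thesis using k(2) by (simp add: rank_one_smult)
    qed
    then have "rank_one v = 0" by (rule perfect_eqI[OF P rank_one_hermitian])
    then show False using norm_rank_one[of v] v(1) by simp
  qed
  obtain B where B: "B \<subseteq> S" "vec.independent B" "S \<subseteq> vec.span B" "card B = vec.dim S"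
    using vec.basis_exists[of S] .
  have spanB: "vec.span B = UNIV" using vec.span_mono[OF B(3)] span by (simp add: top.extremum_unique vec.span_span)
  have "vec.dim S = vec.dim (vec.span S)" by (simp only: vec.dim_span)
  then have "card B = CARD('n)" using B(4) span by (simp add: vec_dim_card del: vec.dim_UNIV)
  moreover from this have "finite B" by (metis card.infinite zero_less_card_finite less_irrefl)
  ultimately obtain f where f: "bij_betw f (UNIV :: 'n set) B"
    using finite_same_card_bij[of "UNIV :: 'n set" B] by auto
  define X where "X = (\<chi> i. f i)"
  have rows: "rows X = B"
    using f by (auto simp: rows_def row_def X_def bij_betw_def vec_nth_inverse)
  obtain Y where Y: "Y ** X = mat 1"
    using matrix_left_invertible_span_rows_gen[of X] spanB rows by auto
  then have Y': "X ** Y = mat 1" by (simp add: matrix_left_right_inverse)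
  have XS: "X $ j \<in> S" for j using f B(1) by (auto simp: X_def bij_betw_def)
  have "X $ j \<in> L0" "fval A (X $ j) \<le> C" for j
  proof -
    show L: "X $ j \<in> L0" using XS[of j] by (simp add: S_def MV_iff)
    show "fval A (X $ j) \<le> C"
      using XS[of j] m unfolding rank_one_nrank_one[OF L] by (simp add: S_def MV_iff)
  qed
  then show thesis using that Y Y' by blast
qed

text \<open>If \<open>q t\<close> is close to an integral vector \<open>w\<close>, then \<open>(q t - w) X\<close> is a lattice vector on which
  the form is smaller than its minimum; hence \<open>q t = w\<close>.\<close>

lemma coordinates_bounded_denominator:
  assumes "C > 0"
  shows "\<exists>M::nat. M > 0 \<and> (\<forall>(A :: complex^'n^'n) X. (\<forall>v. 0 \<le> fval A v) \<longrightarrow> (\<forall>y\<in>L0. 1 \<le> fval A y)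
    \<longrightarrow> (\<forall>j. X $ j \<in> L \<and> fval A (X $ j) \<le> C) \<longrightarrow> (\<exists>Y :: complex^'n^'n. X ** Y = mat 1)
    \<longrightarrow> (\<forall>t. t v* X \<in> L \<longrightarrow> (\<forall>j. of_nat M * t $ j \<in> OK)))"
proof -
  let ?n = "CARD('n)"
  \<comment> \<open>Chosen so that 2^n n \<epsilon>^2 C = 1/2, which is below the minimum.\<close>
  define \<epsilon> where "\<epsilon> = sqrt (1 / (2 ^ ?n * real ?n * C * 2))"
  have e0: "\<epsilon> > 0" using assms by (simp add: \<epsilon>_def)
  have e2: "\<epsilon>\<^sup>2 = 1 / (2 ^ ?n * real ?n * C * 2)" using assms by (simp add: \<epsilon>_def)
  obtain Q :: nat where Q: "\<And>z :: 'n \<Rightarrow> complex. \<exists>q w. 0 < q \<and> q \<le> Q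
           \<and> (\<forall>j. w j \<in> OK \<and> norm (of_nat q * z j - w j) < \<epsilon>)"
    using O_approximation[where 'm = 'n, OF e0] by auto
  have "of_nat (fact Q) * t $ j \<in> OK"
    if psd: "\<forall>v. 0 \<le> fval A v" and ge: "\<forall>y\<in>L0. 1 \<le> fval A y"
      and X: "\<forall>j. X $ j \<in> L \<and> fval A (X $ j) \<le> C" and Y: "X ** Y = mat 1"
      and t: "t v* X \<in> L" for A X Y :: "complex^'n^'n" and t j
  proof -
    obtain q w where qw: "0 < q" "q \<le> Q" "\<And>j. w j \<in> OK" "\<And>j. norm (of_nat q * t $ j - w j) < \<epsilon>"
      using Q[of "\<lambda>j. t $ j"] by auto
    define u where "u = (\<chi> j. of_nat q * t $ j - w j)"
    have "u v* X = of_nat q *s (t v* X) - (\<Sum>j\<in>UNIV. w j *s X $ j)"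
      by (simp add: vector_matrix_mult_sum u_def vec.scale_sum_right vector_sub_rdistrib
          sum_subtractf vector_smult_assoc)
    moreover have "of_nat q *s (t v* X) \<in> L" using t by (intro L_smult) auto
    moreover have "(\<Sum>j\<in>UNIV. w j *s X $ j) \<in> L" using X qw(3) by (intro L_sum L_smult) auto
    ultimately have uL: "u v* X \<in> L" using L_diff by simp
    have "fval A (u v* X) \<le> 2 ^ ?n * (\<Sum>j\<in>UNIV. fval A (u $ j *s X $ j))"
      unfolding vector_matrix_mult_sum using psd by (intro semidefinite_sum_le) auto
    also have "\<dots> \<le> 2 ^ ?n * (\<Sum>j\<in>(UNIV :: 'n set). \<epsilon>\<^sup>2 * C)"
    proof (intro mult_left_mono sum_mono)
      fix j
      have "norm (u $ j) \<le> \<epsilon>" using qw(4)[of j] by (simp add: u_def)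
      then show "fval A (u $ j *s X $ j) \<le> \<epsilon>\<^sup>2 * C"
        using psd X by (simp add: rank_one_smult mult_mono power_mono)
    qed simp
    also have "\<dots> < 1" using assms by (simp add: e2)
    finally have "\<not> 1 \<le> fval A (u v* X)" by simp
    then have "u v* X = 0" using ge uL by blast
    then have "u = 0" using Aut_cancel[OF Y, of u] by simp
    then have "of_nat q * t $ j = w j" by (simp add: u_def vec_eq_iff)
    moreover obtain c where "fact Q = q * c" using qw(1,2) dvd_fact[of q Q] by (auto elim: dvdE)
    ultimately have "of_nat (fact Q) * t $ j = of_nat c * w j"
      by (metis mult.assoc mult.commute of_nat_mult)
    then show ?thesis using O_mult[OF O_of_nat qw(3)] by simp
  qed
  then show ?thesis by (intro exI[of _ "fact Q"]) auto
qed

text \<open>Such a \<Lambda> lies between O_K^n and (1/M) O_K^n, so it is determined by which of the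
  finitely many representatives F of the quotient it contains.\<close>

lemma finite_lattices_between:
  assumes "M > 0"
  shows "finite {\<Lambda> :: (complex^'n) set. (\<forall>z. (\<forall>j. z $ j \<in> OK) \<longrightarrow> z \<in> \<Lambda>)
    \<and> (\<forall>s\<in>\<Lambda>. \<forall>t\<in>\<Lambda>. s - t \<in> \<Lambda>) \<and> (\<forall>t\<in>\<Lambda>. \<forall>j. of_nat M * t $ j \<in> OK)}" (is "finite ?\<M>")
proof -
  have MO: "idl ((*) (of_nat M) ` OK)" using ideal_scale_O[OF ideal_OK, of "of_nat M"] assms by simp
  obtain T where T: "transversal OK ((*) (of_nat M) ` OK) T" using transversal_exists[OF MO] .
  have "card T > 0" using ideal_index_transversal[OF MO T] ideal_index_pos[OF MO] by simp
  then have "finite T" by (simp add: card_gt_0_iff)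
  define F where "F = (\<lambda>f. \<chi> j. f j / of_nat M) ` ((UNIV :: 'n set) \<rightarrow>\<^sub>E T)"
  have "finite F" unfolding F_def using \<open>finite T\<close> by (intro finite_imageI finite_PiE) auto
  have reduce: "\<exists>z. (\<forall>j. z $ j \<in> OK) \<and> t - z \<in> F" if t: "\<And>j. of_nat M * t $ j \<in> OK" for t
  proof -
    have "\<exists>s w. s \<in> T \<and> w \<in> OK \<and> of_nat M * t $ j - s = of_nat M * w" for j
      using T t[of j] unfolding transversal_def by blast
    then obtain s w where sw: "\<And>j. s j \<in> T" "\<And>j. w j \<in> OK" "\<And>j. of_nat M * t $ j - s j = of_nat M * w j"
      by metis
    have "t - (\<chi> j. w j) = (\<chi> j. s j / of_nat M)"
      using sw(3) assms by (simp add: vec_eq_iff field_simps)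
    moreover have "(\<chi> j. s j / of_nat M) \<in> F" unfolding F_def using sw(1) by (intro imageI) auto
    ultimately show ?thesis using sw(2) by (intro exI[of _ "\<chi> j. w j"]) auto
  qed
  have sub: "\<Lambda> \<subseteq> \<Lambda>'" if L: "\<Lambda> \<in> ?\<M>" "\<Lambda>' \<in> ?\<M>" "\<Lambda> \<inter> F = \<Lambda>' \<inter> F" for \<Lambda> \<Lambda>'
  proof
    fix t assume t: "t \<in> \<Lambda>"
    obtain z where z: "\<forall>j. z $ j \<in> OK" "t - z \<in> F" using reduce[of t] t L(1) by blast
    have "z \<in> \<Lambda>" "- z \<in> \<Lambda>'" using z(1) O_minus L(1,2) by auto
    moreover have "t - z \<in> \<Lambda>" using t \<open>z \<in> \<Lambda>\<close> L(1) by blast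
    then have "t - z \<in> \<Lambda>'" using z(2) L(3) by blast
    ultimately have "(t - z) - (- z) \<in> \<Lambda>'" using L(2) by blast
    then show "t \<in> \<Lambda>'" by simp
  qed
  have inj: "inj_on (\<lambda>\<Lambda>. \<Lambda> \<inter> F) ?\<M>"
  proof (rule inj_onI)
    fix \<Lambda> \<Lambda>' assume L: "\<Lambda> \<in> ?\<M>" "\<Lambda>' \<in> ?\<M>" "\<Lambda> \<inter> F = \<Lambda>' \<inter> F"
    show "\<Lambda> = \<Lambda>'" by (rule subset_antisym[OF sub[OF L] sub[OF L(2,1) L(3)[symmetric]]])
  qed
  have "(\<lambda>\<Lambda>. \<Lambda> \<inter> F) ` ?\<M> \<subseteq> Pow F" by (rule image_subsetI) (rule PowI, rule Int_lower2)
  moreover have "finite (Pow F)" using \<open>finite F\<close> by simp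
  ultimately have "finite ((\<lambda>\<Lambda>. \<Lambda> \<inter> F) ` ?\<M>)" by (rule finite_subset)
  then show ?thesis by (rule finite_imageD[OF _ inj])
qed

text \<open>Semidefiniteness bounds every value A[x] in terms of the values on the basis. Applied to
  finitely many rank one matrices spanning the Hermitian matrices, this bounds the norm of
  A.\<close>

lemma bounded_on_basis:
  fixes X Y :: "complex^'n^'n"
  assumes Y: "Y ** X = mat 1"
  shows "bounded {A \<in> positive_forms. \<forall>j. fval A (X $ j) \<le> C}" (is "bounded ?S")
proof -
  obtain R where R: "R \<subseteq> range (rank_one :: complex^'n \<Rightarrow> _)" "independent R" "range rank_one \<subseteq> span R"
    using maximal_independent_subset[of "range (rank_one :: complex^'n \<Rightarrow> _)"] by blast
  have finR: "finite R" using R(2) by (rule independent_imp_finite)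
  have "hermitian_matrices \<subseteq> span R" using span_minimal[OF R(3)] by (simp add: span_rank_one)
  moreover obtain c where c: "c > 0" "\<forall>A\<in>span R. norm A \<le> c * (\<Sum>s\<in>R. \<bar>A \<bullet> s\<bar>)"
    using norm_le_sum_inner_on_span[OF finR] by blast
  ultimately have norm_le: "norm A \<le> c * (\<Sum>s\<in>R. \<bar>A \<bullet> s\<bar>)" if "A \<in> hermitian_matrices" for A
    using that by blast
  define b where "b = (\<lambda>x. 2 ^ CARD('n) * (\<Sum>j\<in>UNIV. (norm ((x v* Y) $ j))\<^sup>2 * C))"
  have val: "fval A x \<le> b x" if "A \<in> ?S" for A x
  proof -
    have "x = (\<Sum>j\<in>UNIV. (x v* Y) $ j *s X $ j)"
      using Aut_cancel[OF Y, of x] by (simp add: vector_matrix_mult_sum[of "x v* Y"])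
    then have "fval A x = fval A (\<Sum>j\<in>UNIV. (x v* Y) $ j *s X $ j)" by simp
    also have "\<dots> \<le> 2 ^ CARD('n) * (\<Sum>j\<in>UNIV. fval A ((x v* Y) $ j *s X $ j))"
      using that positive_forms_nonneg by (intro semidefinite_sum_le) auto
    also have "\<dots> \<le> b x"
      unfolding b_def using that by (intro mult_left_mono sum_mono) (auto simp: rank_one_smult intro!: mult_left_mono)
    finally show ?thesis .
  qed
  have "\<forall>s\<in>R. \<exists>x. s = rank_one x" using R(1) by auto
  then obtain g where g: "\<And>s. s \<in> R \<Longrightarrow> s = rank_one (g s)" using bchoice[of R "\<lambda>s x. s = rank_one x"] by auto
  have "norm A \<le> c * (\<Sum>s\<in>R. b (g s))" if A: "A \<in> ?S" for A
  proof -
    have "\<bar>A \<bullet> s\<bar> \<le> b (g s)" if "s \<in> R" for s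
      using val[OF A, of "g s"] positive_forms_nonneg[of A "g s"] A g[OF that] by auto
    then have "c * (\<Sum>s\<in>R. \<bar>A \<bullet> s\<bar>) \<le> c * (\<Sum>s\<in>R. b (g s))"
      using c(1) by (intro mult_left_mono sum_mono) auto
    then show ?thesis using norm_le[of A] A positive_forms_hermitian by fastforce
  qed
  then show ?thesis unfolding bounded_iff by blast
qed

text \<open>Y X' keeps the coordinates of a vector but reads them with respect to X' instead of X.
  Its entries lie in \<open>K\<close> because g times a unit vector is a lattice vector and is
  mapped to one.\<close>

lemma Aut_if_lattices_eq:
  fixes X Y X' Y' :: "complex^'n^'n"
  assumes X: "X ** Y = mat 1" "Y ** X = mat 1" and X': "X' ** Y' = mat 1" "Y' ** X' = mat 1"
    and eq: "{t. t v* X \<in> L} = {t. t v* X' \<in> L}"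
  shows "Y ** X' \<in> Aut"
proof -
  have one: "(Y ** X') ** (Y' ** X) = mat 1" "(Y' ** X) ** (Y ** X') = mat 1"
  proof -
    have "(Y ** X') ** (Y' ** X) = Y ** (X' ** Y') ** X" by (simp only: matrix_mul_assoc)
    then show "(Y ** X') ** (Y' ** X) = mat 1" by (simp add: X X')
    have "(Y' ** X) ** (Y ** X') = Y' ** (X ** Y) ** X'" by (simp only: matrix_mul_assoc)
    then show "(Y' ** X) ** (Y ** X') = mat 1" by (simp add: X X')
  qed
  have step: "x v* (Y ** X') \<in> L \<longleftrightarrow> x \<in> L" for x
  proof -
    have "x v* (Y ** X') \<in> L \<longleftrightarrow> x v* Y \<in> {t. t v* X' \<in> L}" by (simp add: vector_matrix_mul_assoc)
    also have "\<dots> \<longleftrightarrow> (x v* Y) v* X \<in> L" using eq by blast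
    finally show ?thesis by (simp add: Aut_cancel[OF X(2)])
  qed
  have step': "x v* (Y' ** X) \<in> L \<longleftrightarrow> x \<in> L" for x
    using step[of "x v* (Y' ** X)"] Aut_cancel[OF one(2), of x] by simp
  have entries: "U $ i $ j \<in> K" if U: "\<And>x. x \<in> L \<Longrightarrow> x v* U \<in> L" for U :: "complex^'n^'n" and i j
  proof -
    obtain g :: nat where g: "g > 0" "of_nat g \<in> \<aa>" using \<aa>_integer .
    have "(\<chi> k. of_nat g * (if k = i then 1 else 0)) \<in> L" by (rule L_integer_multiple[OF g(2)]) auto
    then have "(\<chi> k. of_nat g * (if k = i then 1 else 0)) v* U \<in> L" by (rule U)
    moreover have "((\<chi> k. of_nat g * (if k = i then 1 else 0)) v* U) $ j = of_nat g * U $ i $ j"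
      by (simp add: vector_matrix_mult_def if_distrib if_distribR cong: if_cong)
    ultimately have "of_nat g * U $ i $ j \<in> K" using L_O O_K by metis
    then have "of_nat g * U $ i $ j / of_nat g \<in> K" by (intro K_divide K_of_nat)
    then show ?thesis using g(1) by simp
  qed
  have "(\<lambda>x. x v* (Y ** X')) ` L = L"
  proof
    show "(\<lambda>x. x v* (Y ** X')) ` L \<subseteq> L" using step by blast
    show "L \<subseteq> (\<lambda>x. x v* (Y ** X')) ` L"
    proof
      fix x assume "x \<in> L"
      then have "x v* (Y' ** X) \<in> L" using step' by blast
      then show "x \<in> (\<lambda>x. x v* (Y ** X')) ` L"
        by (rule image_eqI[rotated]) (simp add: Aut_cancel[OF one(2)])
    qed
  qed
  then show ?thesis
    unfolding Aut_iff using one entries[of "Y ** X'"] entries[of "Y' ** X"] step step' by blast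
qed

theorem finite_perfect_classes:
  obtains \<P> where "finite \<P>" "\<And>A. perfect A \<Longrightarrow> \<exists>B\<in>\<P>. A \<asymp> B"
proof -
  obtain C where C: "C > 0" "\<And>x. x \<in> L0 \<Longrightarrow> \<exists>\<kappa>\<in>K. \<kappa> \<noteq> 0 \<and> \<kappa> *s x \<in> L0 \<and> vnorm (\<kappa> *s x) \<le> C"
    using bounded_vnorm_representative by blast
  obtain M :: nat where M: "M > 0" "\<And>(A :: complex^'n^'n) X t (Y :: complex^'n^'n) j. (\<forall>v. 0 \<le> fval A v) \<Longrightarrow> (\<forall>y\<in>L0. 1 \<le> fval A y)
    \<Longrightarrow> (\<forall>j. X $ j \<in> L \<and> fval A (X $ j) \<le> C) \<Longrightarrow> X ** Y = mat 1
    \<Longrightarrow> t v* X \<in> L \<Longrightarrow> of_nat M * t $ j \<in> OK" using coordinates_bounded_denominator[OF C(1)] by meson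
  define good where "good = (\<lambda>(X :: complex^'n^'n) A. perfect A \<and> mn A = 1
    \<and> (\<forall>j. X $ j \<in> L0 \<and> fval A (X $ j) \<le> C) \<and> (\<exists>Y. X ** Y = mat 1 \<and> Y ** X = mat 1))"
  define \<Lambda> where "\<Lambda> = (\<lambda>X :: complex^'n^'n. {t. t v* X \<in> L})"
  define \<X> where "\<X> = {X. \<exists>A. good X A}"
  have ge: "1 \<le> fval A y" if "good X A" "y \<in> L0" for X A y
  proof -
    have A: "A \<in> positive_forms" "mn A = 1" using that perfect_positive by (auto simp: good_def)
    have "1 * 1 \<le> vnorm y * (nval A y)"
      using vnorm_ge_1[OF that(2)] lattice_min_le[OF A(1) that(2)] A(2) by (intro mult_mono) auto
    then show ?thesis unfolding rank_one_nrank_one[OF that(2)] by simp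
  qed
  have "\<Lambda> ` \<X> \<subseteq> {\<Lambda> :: (complex^'n) set. (\<forall>z. (\<forall>j. z $ j \<in> OK) \<longrightarrow> z \<in> \<Lambda>)
    \<and> (\<forall>s\<in>\<Lambda>. \<forall>t\<in>\<Lambda>. s - t \<in> \<Lambda>) \<and> (\<forall>t\<in>\<Lambda>. \<forall>j. of_nat M * t $ j \<in> OK)}"
  proof (intro image_subsetI CollectI conjI allI impI ballI)
    fix X assume "X \<in> \<X>"
    then obtain A where A: "good X A" by (auto simp: \<X>_def)
    then have X: "\<forall>j. X $ j \<in> L \<and> fval A (X $ j) \<le> C" and "\<exists>Y. X ** Y = mat 1"
      by (auto simp: good_def)
    then obtain Y where Y: "X ** Y = mat 1" by blast
    {
      fix z :: "complex^'n" assume "\<forall>j. z $ j \<in> OK"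
      then show "z \<in> \<Lambda> X" using X by (auto simp: \<Lambda>_def vector_matrix_mult_sum intro!: L_sum L_smult)
    next
      fix s t assume "s \<in> \<Lambda> X" "t \<in> \<Lambda> X"
      then show "s - t \<in> \<Lambda> X" using L_diff by (simp add: \<Lambda>_def vector_matrix_mult_diff_distrib)
    next
      fix t j assume t: "t \<in> \<Lambda> X"
      have "\<forall>v. 0 \<le> fval A v"
        using A perfect_positive positive_forms_nonneg unfolding good_def by blast
      moreover have "\<forall>y\<in>L0. 1 \<le> fval A y" using ge[OF A] by blast
      moreover have "t v* X \<in> L" using t by (simp add: \<Lambda>_def)
      ultimately show "of_nat M * t $ j \<in> OK" using M(2)[OF _ _ X Y] by simp
    }
  qed
  then have "finite (\<Lambda> ` \<X>)" using finite_lattices_between[OF M(1)] by (rule finite_subset)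
  \<comment> \<open>Finitely many bases realize all coordinate lattices that occur.\<close>
  then obtain \<X>0 where X0: "\<X>0 \<subseteq> \<X>" "finite \<X>0" "\<Lambda> ` \<X> = \<Lambda> ` \<X>0"
    using finite_subset_image[of "\<Lambda> ` \<X>" \<Lambda> \<X>] by auto
  define \<P> where "\<P> = (\<Union>X\<in>\<X>0. {A \<in> {A \<in> positive_forms. \<forall>j. fval A (X $ j) \<le> C}.
    perfect A \<and> mn A = 1})"
  have "finite \<P>" unfolding \<P>_def
  proof (rule finite_UN_I[OF X0(2)])
    fix X assume "X \<in> \<X>0"
    then obtain Y where "Y ** X = mat 1" using X0(1) by (auto simp: \<X>_def good_def)
    then show "finite {A \<in> {A \<in> positive_forms. \<forall>j. fval A (X $ j) \<le> C}.
        perfect A \<and> mn A = 1}" by (intro finite_bounded_perfect bounded_on_basis)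
  qed
  moreover have "\<exists>B\<in>\<P>. A \<asymp> B" if A: "perfect A" for A
  proof -
    obtain \<alpha> where \<alpha>: "\<alpha> > 0" "perfect (\<alpha> *\<^sub>R A)" "mn (\<alpha> *\<^sub>R A) = 1" using perfect_normalize[OF A] .
    let ?A = "\<alpha> *\<^sub>R A"
    obtain X Y :: "complex^'n^'n" where XY: "X ** Y = mat 1" "Y ** X = mat 1"
      "\<And>j. X $ j \<in> L0" "\<And>j. fval ?A (X $ j) \<le> C" using minimal_basis[OF \<alpha>(2,3) C(2)] by blast
    have "good X ?A" unfolding good_def using XY \<alpha> by blast
    then have "X \<in> \<X>" by (auto simp: \<X>_def)
    then obtain X' where X': "X' \<in> \<X>0" "\<Lambda> X = \<Lambda> X'" using X0(3) by blast
    then obtain Y' where Y': "X' ** Y' = mat 1" "Y' ** X' = mat 1" using X0(1) by (auto simp: \<X>_def good_def)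
    \<comment> \<open>U takes the reference basis X' to X, so the transported form is bounded by C
      on X' and belongs to the finite set.\<close>
    define U where "U = Y' ** X"
    have U: "U \<in> Aut" unfolding U_def using Aut_if_lattices_eq[OF Y' XY(1,2)] X'(2) by (simp add: \<Lambda>_def)
    let ?B = "1 *\<^sub>R congruent_form U ?A"
    have B: "perfect ?B" "mn ?B = 1" using perfect_congruent[OF \<alpha>(2) zero_less_one U] \<alpha>(3) by auto
    have "X' ** U = X" unfolding U_def by (simp add: matrix_mul_assoc Y')
    then have "(X' $ j) v* U = X $ j" for j by (metis matrix_mult_row)
    then have "fval ?B (X' $ j) \<le> C" for j using XY(4) by (simp add: inner_congruent_form)
    then have "?B \<in> \<P>" unfolding \<P>_def using X'(1) B perfect_positive[OF B(1)] by blast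
    moreover have "A \<asymp> ?B"
      using equivalent_forms_trans[OF equivalent_forms_scaleR[OF \<alpha>(1)] equivalent_forms_congruent[OF U zero_less_one]] .
    ultimately show ?thesis by blast
  qed
  ultimately show thesis using that by blast
qed

end


section \<open>Termination and completeness\<close>

context steinitz
begin

text \<open>Among the forms of minimum one equivalent to a member of \<open>\<L>\<close>, take one with least trace
  product with \<open>Q\<close>, an interior point of the Voronoi domain of the target \<open>B\<close>. It has \<open>Q\<close> in its
  own Voronoi domain, since otherwise a contiguous form would do better, so it equals \<open>B\<close>.
  Contiguous forms are only taken of members of \<open>\<L>\<close> itself, with \<open>Q\<close> transported instead.\<close>

lemma closed_under_contiguity_complete:
  assumes ne: "\<L> \<noteq> {}" and perf: "\<And>A. A \<in> \<L> \<Longrightarrow> perfect A"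
    and closed: "\<And>A C. A \<in> \<L> \<Longrightarrow> C \<in> contiguous A \<Longrightarrow> \<exists>A'\<in>\<L>. A' \<asymp> C"
    and B: "perfect B"
  shows "\<exists>A\<in>\<L>. A \<asymp> B"
proof -
  obtain \<beta> where \<beta>: "\<beta> > 0" and B1: "perfect (\<beta> *\<^sub>R B)" "mn (\<beta> *\<^sub>R B) = 1"
    using perfect_normalize[OF B] .
  define G where "G = \<beta> *\<^sub>R B"
  have G: "perfect G" "mn G = 1" using B1 by (simp_all add: G_def)
  have Gp: "G \<in> positive_forms" using perfect_positive[OF G(1)] .
  define I where "I = MC G"
  have finI: "finite I" unfolding I_def by (rule finite_minimal_classes[OF Gp])
  have "\<forall>c\<in>I. \<exists>x. x \<in> MV G \<and> class_matrix c = rank_one x" using class_matrix_eq unfolding I_def by blast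
  then obtain x where x: "\<And>c. c \<in> I \<Longrightarrow> x c \<in> MV G" "\<And>c. c \<in> I \<Longrightarrow> class_matrix c = rank_one (x c)"
    using bchoice[of I "\<lambda>c x. x \<in> MV G \<and> class_matrix c = rank_one x"] by blast
  have xL: "x c \<in> L0" if "c \<in> I" for c using x(1)[OF that] MV_iff by blast
  have span: "span (class_matrix ` I) = hermitian_matrices"
    unfolding I_def span_class_matrix using G(1) perfect_form_iff by blast
  define Q where "Q = (\<Sum>c\<in>I. rank_one (x c))"
  define \<D> where "\<D> = {A. perfect A \<and> mn A = 1 \<and> (\<exists>A0\<in>\<L>. A0 \<asymp> A)}"
  obtain A0 where A0: "A0 \<in> \<L>" using ne by blast
  obtain \<alpha> where \<alpha>: "\<alpha> > 0" "perfect (\<alpha> *\<^sub>R A0)" "mn (\<alpha> *\<^sub>R A0) = 1"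
    using perfect_normalize[OF perf[OF A0]] .
  define A1 where "A1 = \<alpha> *\<^sub>R A0"
  have A1: "A1 \<in> \<D>" unfolding \<D>_def A1_def using \<alpha> A0 equivalent_forms_scaleR[OF \<alpha>(1)] by blast
  \<comment> \<open>An upper bound on the trace product with Q bounds a positive definite form,
    since Q is a sum of rank one matrices that span the Hermitian matrices; hence \<D>1 is finite
    and a minimum exists.\<close>
  define \<D>1 where "\<D>1 = {A \<in> \<D>. A \<bullet> Q \<le> A1 \<bullet> Q}"
  have "bounded {A \<in> positive_forms. A \<bullet> Q \<le> A1 \<bullet> Q}"
  proof -
    obtain c where c: "c > 0" "\<forall>A\<in>span (class_matrix ` I). norm A \<le> c * (\<Sum>s\<in>class_matrix ` I. \<bar>A \<bullet> s\<bar>)"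
      using norm_le_sum_inner_on_span[of "class_matrix ` I"] finI by blast
    have "norm A \<le> c * (\<Sum>s\<in>class_matrix ` I. A1 \<bullet> Q)" if A: "A \<in> positive_forms" "A \<bullet> Q \<le> A1 \<bullet> Q" for A
    proof -
      have nn: "0 \<le> fval A (x d)" for d using positive_forms_nonneg[OF A(1)] .
      have "\<bar>A \<bullet> s\<bar> \<le> A1 \<bullet> Q" if s: "s \<in> class_matrix ` I" for s
      proof -
        obtain d where d: "d \<in> I" "s = rank_one (x d)" using s x(2) by auto
        have "fval A (x d) \<le> (\<Sum>c\<in>I. fval A (x c))" using finI d(1) nn by (intro member_le_sum) auto
        also have "\<dots> = A \<bullet> Q" by (simp add: Q_def inner_sum_right)
        finally show ?thesis using A(2) nn[of d] d(2) by simp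
      qed
      then have "c * (\<Sum>s\<in>class_matrix ` I. \<bar>A \<bullet> s\<bar>) \<le> c * (\<Sum>s\<in>class_matrix ` I. A1 \<bullet> Q)"
        using c(1) by (intro mult_left_mono sum_mono) auto
      moreover have "A \<in> span (class_matrix ` I)" using positive_forms_hermitian[OF A(1)] span by simp
      ultimately show ?thesis using c(2) by (meson order_trans)
    qed
    then show ?thesis unfolding bounded_iff by blast
  qed
  from finite_bounded_perfect[OF this] have "finite \<D>1"
    by (rule rev_finite_subset) (auto simp: \<D>1_def \<D>_def perfect_positive)
  moreover have "A1 \<in> \<D>1" using A1 by (simp add: \<D>1_def)
  ultimately obtain A where A: "A \<in> \<D>1" "\<And>A'. A' \<in> \<D>1 \<Longrightarrow> A \<bullet> Q \<le> A' \<bullet> Q"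
    using ex_is_arg_min_if_finite[of \<D>1 "\<lambda>A. A \<bullet> Q"] by (auto simp: is_arg_min_linorder)
  have minimal: "A \<bullet> Q \<le> A' \<bullet> Q" if "A' \<in> \<D>" for A'
    using A that by (cases "A' \<in> \<D>1") (auto simp: \<D>1_def)
  have PA: "perfect A" "mn A = 1" using A(1) by (auto simp: \<D>1_def \<D>_def)
  have Ap: "A \<in> positive_forms" using perfect_positive[OF PA(1)] .
  obtain T where T: "T \<in> \<L>" "T \<asymp> A" using A(1) by (auto simp: \<D>1_def \<D>_def)
  obtain \<gamma> U where \<gamma>: "\<gamma> > 0" and U: "U \<in> Aut" and AT: "A = \<gamma> *\<^sub>R congruent_form U T"
    using T(2) by (auto simp: equivalent_forms_iff)
  obtain V where V: "V \<in> Aut" "U ** V = mat 1" "V ** U = mat 1" using Aut_inverse[OF U] .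
  define Q' where "Q' = (\<Sum>c\<in>I. rank_one (x c v* U))"
  have Q': "congruent_form U S \<bullet> Q = S \<bullet> Q'" for S
    by (simp add: Q_def Q'_def inner_sum_right inner_congruent_form)
  have mT: "\<gamma> * mn T = 1" using perfect_congruent(2)[OF perf[OF T(1)] \<gamma> U] PA(2) by (simp add: AT)
  have "Q' \<in> VD T"
  proof (rule ccontr)
    assume Q'T: "Q' \<notin> VD T"
    have herm: "Q' \<in> hermitian_matrices"
      unfolding Q'_def by (rule subspace_sum[OF subspace_hermitian rank_one_hermitian])
    have cone: "0 \<le> R \<bullet> Q'" if "\<And>y. y \<in> L0 \<Longrightarrow> 0 \<le> fval R y" for R
      unfolding Q'_def inner_sum_right by (intro sum_nonneg that Aut_L0[OF U] xL)
    obtain C where C: "C \<in> contiguous T" "C \<bullet> Q' < T \<bullet> Q'"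
      using contiguous_descent[OF perf[OF T(1)] herm Q'T cone] .
    obtain T' where T': "T' \<in> \<L>" "T' \<asymp> C" using closed[OF T(1) C(1)] by blast
    have pC: "perfect C" "mn C = mn T"
      using C(1) by (auto simp: contiguous_forms_def contiguous_through_def)
    define C' where "C' = \<gamma> *\<^sub>R congruent_form U C"
    have "perfect C'" "mn C' = 1"
      using perfect_congruent[OF pC(1) \<gamma> U] pC(2) mT by (simp_all add: C'_def)
    moreover have "T' \<asymp> C'"
      unfolding C'_def using equivalent_forms_trans[OF T'(2) equivalent_forms_congruent[OF U \<gamma>]] .
    ultimately have "C' \<in> \<D>" using T'(1) by (auto simp: \<D>_def)
    then have "A \<bullet> Q \<le> C' \<bullet> Q" by (rule minimal)
    then show False using C(2) \<gamma> by (simp add: AT C'_def Q')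
  qed
  \<comment> \<open>The scaled transform of G by V has all values at least the minimum of T, so T
    does at least as well on Q'; transporting back compares A with G on Q.\<close>
  then have "T \<bullet> Q' \<le> ((1 / \<gamma>) *\<^sub>R congruent_form V G) \<bullet> Q'"
  proof (rule voronoi_domain_inner_le[rotated])
    fix y assume "y \<in> L0"
    then have "1 \<le> nval (congruent_form V G) y"
      using lattice_min_le[OF Gp Aut_L0[OF V(1)]] G(2) by (simp add: inner_congruent_form_nrank_one[OF V(1)])
    then show "mn T \<le> nval ((1 / \<gamma>) *\<^sub>R congruent_form V G) y" using mT \<gamma> by (simp add: field_simps)
  qed
  moreover have "congruent_form V G \<bullet> Q' = G \<bullet> Q"
    using Q'[of "congruent_form V G"] by (simp add: congruent_form_mult V(2))
  ultimately have le: "A \<bullet> Q \<le> G \<bullet> Q" using \<gamma> by (simp add: AT Q' field_simps)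
  have ge: "fval G (x c) \<le> fval A (x c)" if c: "c \<in> I" for c
  proof -
    have "nval G (x c) \<le> nval A (x c)"
      using lattice_min_le[OF Ap xL[OF c]] PA(2) x(1)[OF c] G(2) by (simp add: MV_iff)
    then show ?thesis
      using vnorm_ge_1[OF xL[OF c]] by (simp add: rank_one_nrank_one[OF xL[OF c]] mult_left_mono)
  qed
  have "(\<Sum>c\<in>I. fval A (x c) - fval G (x c)) \<le> 0"
    using le by (simp add: Q_def inner_sum_right sum_subtractf)
  then have "(\<Sum>c\<in>I. fval A (x c) - fval G (x c)) = 0"
    using sum_nonneg[of I "\<lambda>c. fval A (x c) - fval G (x c)"] ge by fastforce
  then have eq: "fval A (x c) = fval G (x c)" if "c \<in> I" for c
    using sum_nonneg_eq_0_iff[OF finI, of "\<lambda>c. fval A (x c) - fval G (x c)"] ge that by auto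
  have "A - G \<in> span (class_matrix ` I)"
    unfolding span using positive_forms_hermitian[OF Ap] positive_forms_hermitian[OF Gp]
    by (rule subspace_diff[OF subspace_hermitian])
  then have "A - G = 0" by (rule orthogonal_span_eq_0) (use eq x(2) in \<open>auto simp: inner_diff_left\<close>)
  then have "T \<asymp> G" using T(2) by simp
  moreover have "G \<asymp> B"
    unfolding G_def by (rule equivalent_forms_sym[OF equivalent_forms_scaleR[OF \<beta>]])
  ultimately show ?thesis using T(1) equivalent_forms_trans by blast
qed

section \<open>Invariant, progress and measure of the algorithm\<close>

definition covered :: "complex^'n^'n \<Rightarrow> (complex^'n^'n) list \<Rightarrow> bool" where
  "covered C Ls \<longleftrightarrow> (\<exists>A\<in>set Ls. A \<asymp> C)"

text \<open>Processed forms are those no longer in \<open>Ts\<close>; for them all contiguous forms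
  must be covered. Inequivalence is stated for each form against the later ones, which bounds the
  length of the list by the number of classes.\<close>

definition sound_lists :: "(complex^'n^'n) list \<Rightarrow> (complex^'n^'n) list \<Rightarrow> bool" where
  "sound_lists Ls Ts \<longleftrightarrow> Ls \<noteq> [] \<and> (\<forall>A\<in>set Ls. perfect A) \<and> set Ts \<subseteq> set Ls
    \<and> sorted_wrt (\<lambda>A C. \<not> A \<asymp> C) Ls
    \<and> (\<forall>A\<in>set Ls. A \<in> set Ts \<or> (\<forall>C\<in>contiguous A. covered C Ls))"

text \<open>During a check, a contiguous form of T that is no longer waiting in \<open>Cs\<close>
  must already be covered; once \<open>Cs\<close> is empty this allows T to leave
  \<open>Ts\<close>.\<close>

definition voronoi_invariant :: "'n voronoi_state \<Rightarrow> bool" where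
  "voronoi_invariant s = (case s of
      Search A \<Rightarrow> A \<in> positive_forms
    | Loop Ls Ts \<Rightarrow> sound_lists Ls Ts
    | Check T Cs Ls Ts \<Rightarrow> sound_lists Ls Ts \<and> T \<in> set Ts \<and> (\<forall>C\<in>set Cs. perfect C)
        \<and> (\<forall>C\<in>contiguous T. C \<in> set Cs \<or> covered C Ls))"

lemma voronoi_invariant_simps [simp]:
  "voronoi_invariant (Search A) \<longleftrightarrow> A \<in> positive_forms"
  "voronoi_invariant (Loop Ls Ts) \<longleftrightarrow> sound_lists Ls Ts"
  "voronoi_invariant (Check T Cs Ls Ts) \<longleftrightarrow> sound_lists Ls Ts \<and> T \<in> set Ts
     \<and> (\<forall>C\<in>set Cs. perfect C) \<and> (\<forall>C\<in>contiguous T. C \<in> set Cs \<or> covered C Ls)"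
  by (simp_all add: voronoi_invariant_def)

lemma contiguous_perfect: "C \<in> contiguous A \<Longrightarrow> perfect C"
  by (auto simp: contiguous_forms_def contiguous_through_def)

lemma covered_append: "covered C Ls \<Longrightarrow> covered C (Ls @ Ls')" by (auto simp: covered_def)

lemma equivalent_forms_refl: "A \<asymp> A" using equivalent_forms_scaleR[of 1 A] by simp

lemma voronoi_invariant_step:
  assumes "voronoi_invariant s" "voronoi_step K \<aa> l s s'"
  shows "voronoi_invariant s'" using assms(2)
proof (cases rule: voronoi_step.cases)
  case (improve A R \<rho>)
  then show ?thesis using assms(1) improve_progress[of A R \<rho>] by simp
next
  case (found A)
  then show ?thesis by (simp add: sound_lists_def)
next
  case (take T Ts Cs Ls)
  then show ?thesis using assms(1) contiguous_perfect by simp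
next
  case (ignore Ls C T Cs Ts)
  then have "covered C Ls" by (simp add: covered_def)
  then show ?thesis using assms(1) ignore by auto
next
  case (add Ls C T Cs Ts)
  have s: "sound_lists Ls Ts" "T \<in> set Ts" "\<forall>C'\<in>set (C # Cs). perfect C'"
    "\<forall>C'\<in>contiguous T. C' \<in> set (C # Cs) \<or> covered C' Ls"
    using assms(1) unfolding add(1) voronoi_invariant_simps by blast+
  have C: "covered C (Ls @ [C])" using equivalent_forms_refl by (simp add: covered_def)
  have "sound_lists (Ls @ [C]) (Ts @ [C])"
    using s(1,3) add(3) covered_append by (auto simp: sound_lists_def sorted_wrt_append)
  then show ?thesis using add s C covered_append by auto
next
  case (finish T Ls Ts)
  have s: "sound_lists Ls Ts" "\<forall>C\<in>contiguous T. covered C Ls"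
    using assms(1) unfolding finish(1) voronoi_invariant_simps by auto
  have "A \<in> set (remove1 T Ts)" if "A \<in> set Ts" "A \<noteq> T" for A
    using that by (simp add: in_set_remove1)
  then have "sound_lists Ls (remove1 T Ts)"
    using s notin_set_remove1[of _ Ts T] unfolding sound_lists_def by blast
  then show ?thesis using finish by simp
qed

text \<open>Premature halting is ruled out: a direction exists for every positive definite form that
  is not perfect, and the contiguous forms of a perfect one can be listed since they are finite in
  number.\<close>

lemma voronoi_progress:
  assumes "voronoi_invariant s"
  shows "(\<exists>s'. voronoi_step K \<aa> l s s') \<or> (\<exists>Ls. s = Loop Ls [])"
proof (cases s)
  case (Search A)
  show ?thesis
  proof (cases "perfect A")
    case True
    then show ?thesis using Search voronoi_step.found by metis
  next
    case False
    obtain R \<rho> where "R \<in> hermitian_matrices" "R \<noteq> 0" "\<forall>T\<in>span (VD A). trace_product R T = 0"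
      "\<rho> \<in> admissible A R" "\<forall>\<sigma>\<in>admissible A R. \<sigma> \<le> \<rho>"
      using improve_exists[OF _ False] assms Search by auto
    then show ?thesis using voronoi_step.improve[OF False] Search by blast
  qed
next
  case (Loop Ls Ts)
  show ?thesis
  proof (cases Ts)
    case (Cons T Ts')
    then have "perfect T" using assms Loop by (auto simp: sound_lists_def)
    then obtain Cs where "set Cs = contiguous T" "distinct Cs"
      using finite_distinct_list[OF finite_contiguous_forms] by blast
    then show ?thesis using voronoi_step.take[of T Ts Cs K \<aa> l Ls] Cons Loop by auto
  qed (use Loop in simp)
next
  case (Check T Cs Ls Ts)
  show ?thesis
  proof (cases Cs)
    case Nil
    then show ?thesis using Check voronoi_step.finish by metis
  next
    case (Cons C Cs')
    then show ?thesis using Check voronoi_step.ignore voronoi_step.add by metis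
  qed
qed

text \<open>Pigeonhole: two listed forms sharing a representative in \<P> would be
  equivalent.\<close>

lemma inequivalent_length_le:
  assumes "finite \<P>" "sorted_wrt (\<lambda>A C. \<not> A \<asymp> C) Ls"
    and "\<And>A. A \<in> set Ls \<Longrightarrow> \<exists>B\<in>\<P>. A \<asymp> B"
  shows "length Ls \<le> card \<P>"
proof -
  obtain f where f: "\<And>A. A \<in> set Ls \<Longrightarrow> f A \<in> \<P> \<and> A \<asymp> (f A)"
    using bchoice[of "set Ls" "\<lambda>A B. B \<in> \<P> \<and> A \<asymp> B"] assms(3) by blast
  have "distinct (map f Ls)" using assms(2) f
  proof (induction Ls)
    case (Cons A Ls)
    have "f A \<noteq> f C" if "C \<in> set Ls" for C
    proof
      assume eq: "f A = f C"
      have "A \<asymp> (f A)" "C \<asymp> (f A)" using Cons.prems(2)[of A] Cons.prems(2)[of C] that eq by auto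
      then have "A \<asymp> C" using equivalent_forms_sym equivalent_forms_trans by blast
      then show False using Cons.prems(1) that by simp
    qed
    then show ?case using Cons by auto
  qed simp
  then have "length Ls = card (set (map f Ls))" by (simp only: distinct_card length_map)
  also have "\<dots> \<le> card \<P>" using f assms(1) by (intro card_mono) auto
  finally show ?thesis .
qed

text \<open>The form being processed stays in the second list until its contiguous forms are checked;
  the factor two makes both the start and the end of this phase a descent.\<close>

definition voronoi_measure :: "nat \<Rightarrow> 'n voronoi_state \<Rightarrow> nat \<times> nat \<times> nat" where
  "voronoi_measure N s = (case s of
      Search A \<Rightarrow> (N + 1, dim (hermitian_matrices :: (complex^'n^'n) set) - dim (rank_one ` MV A), 0)
    | Loop Ls Ts \<Rightarrow> (N - length Ls, 2 * length Ts, 0)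
    | Check T Cs Ls Ts \<Rightarrow> (N - length Ls, 2 * length Ts - 1, length Cs))"

abbreviation "lex_order \<equiv> less_than <*lex*> less_than <*lex*> less_than"

lemma voronoi_measure_decreases:
  assumes N: "\<And>Ls Ts. sound_lists Ls Ts \<Longrightarrow> length Ls \<le> N"
    and inv: "voronoi_invariant s" and step: "voronoi_step K \<aa> l s s'"
  shows "(voronoi_measure N s', voronoi_measure N s) \<in> lex_order" using step
proof (cases rule: voronoi_step.cases)
  case (improve A R \<rho>)
  let ?B = "A + \<rho> *\<^sub>R R"
  have "dim (rank_one ` MV A) < dim (rank_one ` MV ?B)"
    using improve inv improve_progress[of A R \<rho>] by simp
  moreover have "dim (rank_one ` MV ?B) \<le> dim (hermitian_matrices :: (complex^'n^'n) set)"
    using rank_one_hermitian by (intro dim_subset) blast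
  ultimately show ?thesis using improve by (simp add: voronoi_measure_def)
next
  case (found A)
  \<comment> \<open>With N + 1 as first component during the search, the drop holds even for N = 0,
    where N - 1 is 0.\<close>
  have "N - 1 < N + 1" by linarith
  then show ?thesis using found by (simp add: voronoi_measure_def)
next
  case (take T Ts Cs Ls)
  then have "length Ts > 0" by (auto simp: length_greater_0_conv)
  then show ?thesis using take by (simp add: voronoi_measure_def)
next
  case (add Ls C T Cs Ts)
  \<comment> \<open>Subtraction is truncated, so the first component strictly decreases only if the
    extended list still has length at most N; the invariant of the next state provides this.\<close>
  have "sound_lists (Ls @ [C]) (Ts @ [C])" using voronoi_invariant_step[OF inv step] add by simp
  then have "Suc (length Ls) \<le> N" using N[of "Ls @ [C]"] by simp
  then have "N - Suc (length Ls) < N - length Ls" by linarith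
  then show ?thesis using add by (simp add: voronoi_measure_def)
next
  case (finish T Ls Ts)
  then have "T \<in> set Ts" using inv by simp
  then have "length Ts > 0" "length (remove1 T Ts) = length Ts - 1"
    by (auto simp: length_remove1 length_greater_0_conv)
  then have "2 * length (remove1 T Ts) < 2 * length Ts - 1" by linarith
  then show ?thesis using finish by (simp add: voronoi_measure_def)
qed (simp_all add: voronoi_measure_def)

lemma voronoi_terminates:
  assumes "A0 \<in> positive_forms"
  shows "\<nexists>s. s 0 = Search A0 \<and> (\<forall>k. voronoi_step K \<aa> l (s k) (s (Suc k)))"
proof
  assume "\<exists>s. s 0 = Search A0 \<and> (\<forall>k. voronoi_step K \<aa> l (s k) (s (Suc k)))"
  then obtain s where s: "s 0 = Search A0" "\<And>k. voronoi_step K \<aa> l (s k) (s (Suc k))" by blast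
  obtain \<P> where \<P>: "finite \<P>" "\<And>A. perfect A \<Longrightarrow> \<exists>B\<in>\<P>. A \<asymp> B" using finite_perfect_classes by blast
  have N: "length Ls \<le> card \<P>" if "sound_lists Ls Ts" for Ls Ts
    using that \<P> by (intro inequivalent_length_le) (auto simp: sound_lists_def)
  have inv: "voronoi_invariant (s k)" for k
    by (induction k) (use s assms voronoi_invariant_step in auto)
  have "(voronoi_measure (card \<P>) (s (Suc k)), voronoi_measure (card \<P>) (s k)) \<in> lex_order" for k
    using voronoi_measure_decreases[OF N inv s(2)] .
  moreover have "wf lex_order" by (intro wf_lex_prod wf_less_than)
  ultimately show False unfolding wf_iff_no_infinite_down_chain
    by (elim notE) (rule exI[of _ "\<lambda>k. voronoi_measure (card \<P>) (s k)"], blast)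
qed

lemma voronoi_halts_complete:
  assumes "A0 \<in> positive_forms" "halts_at K \<aa> l A0 s"
  shows "\<exists>Ls. s = Loop Ls [] \<and> (\<forall>A\<in>set Ls. perfect A)
    \<and> (\<forall>B. perfect B \<longrightarrow> (\<exists>A\<in>set Ls. A \<asymp> B))"
proof -
  have "(voronoi_step K \<aa> l)\<^sup>*\<^sup>* (Search A0) s" using assms(2) by (simp add: halts_at_def)
  then have inv: "voronoi_invariant s"
    by (induction rule: rtranclp_induct) (use assms(1) voronoi_invariant_step in auto)
  then obtain Ls where Ls: "s = Loop Ls []"
    using voronoi_progress assms(2) by (auto simp: halts_at_def)
  then have sound: "sound_lists Ls []" using inv by simp
  have "\<exists>A\<in>set Ls. A \<asymp> B" if "perfect B" for B
  proof (rule closed_under_contiguity_complete[OF _ _ _ that])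
    show "set Ls \<noteq> {}" using sound by (simp add: sound_lists_def)
    show "perfect A" if "A \<in> set Ls" for A using sound that by (simp add: sound_lists_def)
    show "\<exists>A'\<in>set Ls. A' \<asymp> C"
      if "A \<in> set Ls" "C \<in> contiguous A" for A C
      using sound that by (simp add: sound_lists_def covered_def)
  qed
  then show ?thesis using Ls sound by (auto simp: sound_lists_def)
qed

end

theorem theorem4p14:
  fixes K \<aa> :: "complex set" and l :: "'n::finite" and A\<^sub>0 :: "complex^'n^'n"
  assumes "imaginary_quadratic_field K"
    and "minimal_class_representative K \<aa>"
    and "A\<^sub>0 \<in> positive_forms"
  shows "(\<nexists>s. s 0 = Search A\<^sub>0 \<and> (\<forall>k. voronoi_step K \<aa> l (s k) (s (Suc k))))
    \<and> (\<forall>s. halts_at K \<aa> l A\<^sub>0 s \<longrightarrow>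
        (\<exists>Ls. s = Loop Ls []
          \<and> (\<forall>A\<in>set Ls. perfect_form K \<aa> l A)
          \<and> (\<forall>B. perfect_form K \<aa> l B \<longrightarrow> (\<exists>A\<in>set Ls. equivalent_forms K \<aa> l A B))))"
proof -
  interpret steinitz K \<aa> l
    using assms(1,2) by unfold_locales (auto simp: minimal_class_representative_def)
  show ?thesis using voronoi_terminates[OF assms(3)] voronoi_halts_complete[OF assms(3)] by blast
qed

end
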